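(* Let $G$ be a compact Lie group and $0<r\leq 1$. Let $1\leq p<\infty$ and $\widetilde{p}=\min\{2,p\}$. Let $A:L^{p}(G)\to L^{p}(G)$ be a linear continuous operator with matrix-valued symbol $\sigma_A(x,\xi)$ such that $$\sum_{[\xi]\in\widehat G}d_{\xi}^{\,2+\frac{r}{\widetilde{p}}}\,\Big\|\,\|(\sigma_A(x,\xi))^t\|_{op(\ell^{\infty},\ell^{\infty})}\Big\|_{L^{p}(G)}^r<\infty,$$ where the $L^p(G)$-norm is taken with respect to $x$. Then $A:L^{p}(G)\to L^{p}(G)$ is $r$-nuclear and its trace is given by $$\operatorname{Tr}A=\int_{G}\sum_{[\xi]\in\widehat{G}}d_{\xi}\operatorname{Tr}(\sigma_A(x,\xi))\,d\mu(x),$$ where $\mu$ is the normalised Haar measure on $G$.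
   Context: $\widehat G$ is the set of equivalence classes of continuous irreducible unitary representations of $G$; for each $[\xi]\in\widehat G$ one fixes a representative viewed, via an orthonormal basis of its representation space, as a unitary-matrix-valued function $\xi:G\to\mathbb C^{d_\xi\times d_\xi}$, where $d_\xi$ is its dimension. The matrix-valued symbol of a linear continuous operator $A$ from $C^\infty(G)$ to $\mathcal D'(G)$ (in particular of a bounded operator on $L^p(G)$) is $\sigma_A(x,\xi):=\xi(x)^*(A\xi)(x)\in\mathbb C^{d_\xi\times d_\xi}$, where $(A\xi)_{ij}=A(\xi_{ij})$; then $Af(x)=\sum_{[\xi]\in\widehat G}d_\xi\operatorname{Tr}(\xi(x)\sigma_A(x,\xi)\widehat f(\xi))$ (in the sense of distributions, for $f\in C^\infty(G)$) with $\widehat f(\xi)=\int_G f(x)\xi(x)^*dx$. $M^t$ is the transpose of $M$. For $B\in\mathbb C^{d\times d}$, $\|B\|_{op(\ell^\infty,\ell^\infty)}:=\max_{1\le i\le d}\sum_{j=1}^d|B_{ij}|$. For $0<r\le1$ and Banach spaces $E,F$, a linear operator $T:E\to F$ is $r$-nuclear if there are sequences $(x_n')$ in $E'$ and $(y_n)$ in $F$ with $Tx=\sum_{n=1}^\infty\langle x,x_n'\rangle y_n$ for all $x\in E$ and $\sum_{n=1}^\infty\|x_n'\|_{E'}^r\|y_n\|_F^r<\infty$. An $r$-nuclear operator is nuclear (i.e. $1$-nuclear). If $E=F$ has the approximation property (as $L^p$-spaces do), the trace of a nuclear operator $T=\sum_n x_n'\otimes y_n$ is $\operatorname{Tr}(T)=\sum_{n=1}^\infty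 x_n'(y_n)$, which is independent of the nuclear representation. *)

theory Defs
  imports
    "HOL-Analysis.Analysis"
    "HOL-Algebra.Group"
    "HOL-Probability.Probability_Measure"
    "Jordan_Normal_Form.Schur_Decomposition"
begin

section \<open>Compact Lie groups\<close>

text \<open>
  Manifolds are modelled on \<^term>\<open>Euclidean_space n\<close>, the space of real sequences supported in
  \<open>{..<n}\<close>. Unlike a type of class \<open>euclidean_space\<close> this allows \<open>n = 0\<close>, so that finite groups are
  included, and it makes \<open>n + n\<close> available for charts on the product \<open>G \<times> G\<close>.
\<close>

text \<open>\<open>C_diff n k U f\<close>: \<open>f\<close> has continuous partial derivatives up to order \<open>k\<close> on the open
  subset \<open>U\<close> of \<^term>\<open>Euclidean_space n\<close>.\<close>

primrec C_diff :: "nat \<Rightarrow> nat \<Rightarrow> (nat \<Rightarrow> real) set \<Rightarrow> ((nat \<Rightarrow> real) \<Rightarrow> real) \<Rightarrow> bool" where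
  "C_diff n 0 U f \<longleftrightarrow> continuous_map (subtopology (Euclidean_space n) U) euclideanreal f"
| "C_diff n (Suc k) U f \<longleftrightarrow>
     continuous_map (subtopology (Euclidean_space n) U) euclideanreal f \<and>
     (\<forall>i<n. \<exists>g. C_diff n k U g \<and>
        (\<forall>x\<in>U. ((\<lambda>t. f (x(i := t))) has_real_derivative g x) (at (x i))))"

definition smooth_map_on ::
    "nat \<Rightarrow> nat \<Rightarrow> (nat \<Rightarrow> real) set \<Rightarrow> ((nat \<Rightarrow> real) \<Rightarrow> nat \<Rightarrow> real) \<Rightarrow> bool" where
  "smooth_map_on n m U f \<longleftrightarrow> (\<forall>j<m. \<forall>k. C_diff n k U (\<lambda>x. f x j))"

type_synonym 'g chart = "'g set \<times> ('g \<Rightarrow> nat \<Rightarrow> real)"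

definition is_chart :: "nat \<Rightarrow> 'g::topological_space chart \<Rightarrow> bool" where
  "is_chart n = (\<lambda>(U, \<phi>). open U \<and> openin (Euclidean_space n) (\<phi> ` U) \<and>
     homeomorphic_map (top_of_set U) (subtopology (Euclidean_space n) (\<phi> ` U)) \<phi>)"

definition smooth_atlas :: "nat \<Rightarrow> 'g::topological_space chart set \<Rightarrow> bool" where
  "smooth_atlas n \<A> \<longleftrightarrow>
     (\<forall>c\<in>\<A>. is_chart n c) \<and> (\<Union>(U, \<phi>)\<in>\<A>. U) = UNIV \<and>
     (\<forall>(U, \<phi>)\<in>\<A>. \<forall>(V, \<psi>)\<in>\<A>.
        smooth_map_on n n (\<phi> ` (U \<inter> V)) (\<lambda>u. \<psi> (inv_into U \<phi> u)))"

definition left_coords :: "nat \<Rightarrow> (nat \<Rightarrow> real) \<Rightarrow> nat \<Rightarrow> real" where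
  "left_coords n w = (\<lambda>i. if i < n then w i else 0)"

definition right_coords :: "nat \<Rightarrow> (nat \<Rightarrow> real) \<Rightarrow> nat \<Rightarrow> real" where
  "right_coords n w = (\<lambda>i. if i < n then w (n + i) else 0)"

text \<open>Smoothness of the group operations is continuity together with smoothness in all charts of
  the atlas; continuity makes the domains of the coordinate expressions open.\<close>

locale compact_lie_group = group G
  for G :: "'g::{t2_space, second_countable_topology} monoid" (structure) +
  fixes n :: nat and \<A> :: "'g chart set"
  assumes carrier_UNIV: "carrier G = UNIV"
    and compact_UNIV: "compact (UNIV :: 'g set)"
    and atlas: "smooth_atlas n \<A>"
    and continuous_mult: "continuous_on UNIV (\<lambda>(x, y). x \<otimes> y)"
    and continuous_inv: "continuous_on UNIV (\<lambda>x. inv x)"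
    and smooth_mult:
      "\<lbrakk>(U, \<phi>) \<in> \<A>; (V, \<psi>) \<in> \<A>; (W, \<theta>) \<in> \<A>\<rbrakk> \<Longrightarrow>
        smooth_map_on (n + n) n
          {w \<in> topspace (Euclidean_space (n + n)).
             left_coords n w \<in> \<phi> ` U \<and> right_coords n w \<in> \<psi> ` V \<and>
             inv_into U \<phi> (left_coords n w) \<otimes> inv_into V \<psi> (right_coords n w) \<in> W}
          (\<lambda>w. \<theta> (inv_into U \<phi> (left_coords n w) \<otimes> inv_into V \<psi> (right_coords n w)))"
    and smooth_inv:
      "\<lbrakk>(U, \<phi>) \<in> \<A>; (W, \<theta>) \<in> \<A>\<rbrakk> \<Longrightarrow>
        smooth_map_on n n {u \<in> \<phi> ` U. inv (inv_into U \<phi> u) \<in> W}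
          (\<lambda>u. \<theta> (inv (inv_into U \<phi> u)))"

text \<open>On a compact group left invariance and total mass 1 determine the Haar measure, and
  regularity is automatic because the topology is second countable.\<close>

definition normalised_haar :: "'g::topological_space monoid \<Rightarrow> 'g measure \<Rightarrow> bool" where
  "normalised_haar G \<mu> \<longleftrightarrow> prob_space \<mu> \<and> sets \<mu> = sets borel \<and>
     (\<forall>g\<in>carrier G. distr \<mu> borel (\<lambda>x. g \<otimes>\<^bsub>G\<^esub> x) = \<mu>)"

section \<open>The unitary dual\<close>

definition unitary_rep :: "'g::topological_space monoid \<Rightarrow> ('g \<Rightarrow> complex mat) \<Rightarrow> nat \<Rightarrow> bool" where
  "unitary_rep G \<xi> d \<longleftrightarrow>
     (\<forall>x. \<xi> x \<in> carrier_mat d d \<and> mat_adjoint (\<xi> x) * \<xi> x = 1\<^sub>m d) \<and>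
     (\<forall>x y. \<xi> (x \<otimes>\<^bsub>G\<^esub> y) = \<xi> x * \<xi> y) \<and>
     (\<forall>i<d. \<forall>j<d. continuous_on UNIV (\<lambda>x. \<xi> x $$ (i, j)))"

definition linear_subspace :: "nat \<Rightarrow> complex vec set \<Rightarrow> bool" where
  "linear_subspace d W \<longleftrightarrow> W \<subseteq> carrier_vec d \<and> 0\<^sub>v d \<in> W \<and>
     (\<forall>v\<in>W. \<forall>w\<in>W. v + w \<in> W) \<and> (\<forall>a. \<forall>v\<in>W. a \<cdot>\<^sub>v v \<in> W)"

definition irreps :: "'g::topological_space monoid \<Rightarrow> ('g \<Rightarrow> complex mat) set" where
  "irreps G = {\<xi>. \<exists>d>0. unitary_rep G \<xi> d \<and>
     (\<forall>W. linear_subspace d W \<and> (\<forall>x. \<forall>w\<in>W. \<xi> x *\<^sub>v w \<in> W) \<longrightarrow> W = {0\<^sub>v d} \<or> W = carrier_vec d)}"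

definition rep_dim :: "'g monoid \<Rightarrow> ('g \<Rightarrow> complex mat) \<Rightarrow> nat" where
  "rep_dim G \<xi> = dim_row (\<xi> \<one>\<^bsub>G\<^esub>)"

definition rep_equiv ::
    "'g::topological_space monoid \<Rightarrow> (('g \<Rightarrow> complex mat) \<times> ('g \<Rightarrow> complex mat)) set" where
  "rep_equiv G = {(\<xi>, \<eta>). \<xi> \<in> irreps G \<and> \<eta> \<in> irreps G \<and> rep_dim G \<xi> = rep_dim G \<eta> \<and>
     (\<exists>T \<in> carrier_mat (rep_dim G \<xi>) (rep_dim G \<xi>). invertible_mat T \<and> (\<forall>x. T * \<xi> x = \<eta> x * T))}"

definition unitary_dual :: "'g::topological_space monoid \<Rightarrow> ('g \<Rightarrow> complex mat) set set" where
  "unitary_dual G = irreps G // rep_equiv G"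

section \<open>Nuclear operators and traces\<close>

text \<open>
  A Banach space of functions is given by a set \<open>E\<close> of complex functions, closed under the pointwise
  operations, with a seminorm \<open>N\<close>; the Banach space proper is the quotient by \<open>{f \<in> E. N f = 0}\<close>.
  Accordingly, operators are linear up to functions of seminorm 0. Boundedness makes operators and
  functionals well-defined on the quotient.
\<close>

definition bounded_operator ::
    "('a \<Rightarrow> complex) set \<Rightarrow> (('a \<Rightarrow> complex) \<Rightarrow> real) \<Rightarrow>
     ('b \<Rightarrow> complex) set \<Rightarrow> (('b \<Rightarrow> complex) \<Rightarrow> real) \<Rightarrow>
     (('a \<Rightarrow> complex) \<Rightarrow> ('b \<Rightarrow> complex)) \<Rightarrow> bool" where
  "bounded_operator E N F M T \<longleftrightarrow>
     (\<forall>f\<in>E. T f \<in> F) \<and>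
     (\<forall>f\<in>E. \<forall>g\<in>E. M (\<lambda>x. T (\<lambda>y. f y + g y) x - (T f x + T g x)) = 0) \<and>
     (\<forall>a. \<forall>f\<in>E. M (\<lambda>x. T (\<lambda>y. a * f y) x - a * T f x) = 0) \<and>
     (\<exists>C. \<forall>f\<in>E. M (T f) \<le> C * N f)"

definition dual_space ::
    "('a \<Rightarrow> complex) set \<Rightarrow> (('a \<Rightarrow> complex) \<Rightarrow> real) \<Rightarrow> (('a \<Rightarrow> complex) \<Rightarrow> complex) set" where
  "dual_space E N = {l.
     (\<forall>f\<in>E. \<forall>g\<in>E. l (\<lambda>y. f y + g y) = l f + l g) \<and>
     (\<forall>a. \<forall>f\<in>E. l (\<lambda>y. a * f y) = a * l f) \<and>
     (\<exists>C. \<forall>f\<in>E. cmod (l f) \<le> C * N f)}"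

definition dual_norm ::
    "('a \<Rightarrow> complex) set \<Rightarrow> (('a \<Rightarrow> complex) \<Rightarrow> real) \<Rightarrow> (('a \<Rightarrow> complex) \<Rightarrow> complex) \<Rightarrow> real" where
  "dual_norm E N l = (SUP f \<in> {f \<in> E. N f \<le> 1}. cmod (l f))"

definition nuclear_rep ::
    "real \<Rightarrow> ('a \<Rightarrow> complex) set \<Rightarrow> (('a \<Rightarrow> complex) \<Rightarrow> real) \<Rightarrow>
     ('b \<Rightarrow> complex) set \<Rightarrow> (('b \<Rightarrow> complex) \<Rightarrow> real) \<Rightarrow>
     (('a \<Rightarrow> complex) \<Rightarrow> ('b \<Rightarrow> complex)) \<Rightarrow>
     (nat \<Rightarrow> ('a \<Rightarrow> complex) \<Rightarrow> complex) \<Rightarrow> (nat \<Rightarrow> 'b \<Rightarrow> complex) \<Rightarrow> bool" where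
  "nuclear_rep r E N F M T x' y \<longleftrightarrow>
     (\<forall>n. x' n \<in> dual_space E N) \<and> (\<forall>n. y n \<in> F) \<and>
     (\<forall>f\<in>E. (\<lambda>k. M (\<lambda>x. T f x - (\<Sum>n<k. x' n f * y n x))) \<longlonglongrightarrow> 0) \<and>
     summable (\<lambda>n. dual_norm E N (x' n) powr r * M (y n) powr r)"

definition r_nuclear ::
    "real \<Rightarrow> ('a \<Rightarrow> complex) set \<Rightarrow> (('a \<Rightarrow> complex) \<Rightarrow> real) \<Rightarrow>
     ('b \<Rightarrow> complex) set \<Rightarrow> (('b \<Rightarrow> complex) \<Rightarrow> real) \<Rightarrow>
     (('a \<Rightarrow> complex) \<Rightarrow> ('b \<Rightarrow> complex)) \<Rightarrow> bool" where
  "r_nuclear r E N F M T \<longleftrightarrow> (\<exists>x' y. nuclear_rep r E N F M T x' y)"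

text \<open>The trace exists if every nuclear representation yields the same value.\<close>

definition has_nuclear_trace ::
    "('a \<Rightarrow> complex) set \<Rightarrow> (('a \<Rightarrow> complex) \<Rightarrow> real) \<Rightarrow>
     (('a \<Rightarrow> complex) \<Rightarrow> ('a \<Rightarrow> complex)) \<Rightarrow> complex \<Rightarrow> bool" where
  "has_nuclear_trace E N T t \<longleftrightarrow>
     r_nuclear 1 E N E N T \<and>
     (\<forall>x' y. nuclear_rep 1 E N E N T x' y \<longrightarrow> (\<lambda>n. x' n (y n)) sums t)"

definition Lp_space :: "real \<Rightarrow> 'a measure \<Rightarrow> ('a \<Rightarrow> complex) set" where
  "Lp_space p \<mu> = {f \<in> borel_measurable \<mu>. integrable \<mu> (\<lambda>x. cmod (f x) powr p)}"

definition Lp_norm :: "real \<Rightarrow> 'a measure \<Rightarrow> ('a \<Rightarrow> 'b::real_normed_vector) \<Rightarrow> real" where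
  "Lp_norm p \<mu> f = (LINT x|\<mu>. norm (f x) powr p) powr (1 / p)"

section \<open>Matrix-valued symbols\<close>

definition symbol ::
    "'g monoid \<Rightarrow> (('g \<Rightarrow> complex) \<Rightarrow> ('g \<Rightarrow> complex)) \<Rightarrow> 'g \<Rightarrow> ('g \<Rightarrow> complex mat) \<Rightarrow> complex mat" where
  "symbol G A x \<xi> = mat_adjoint (\<xi> x) *
     mat (rep_dim G \<xi>) (rep_dim G \<xi>) (\<lambda>(i, j). A (\<lambda>y. \<xi> y $$ (i, j)) x)"

definition opnorm_linf :: "complex mat \<Rightarrow> real" where
  "opnorm_linf B = (MAX i\<in>{..<dim_row B}. \<Sum>j<dim_col B. cmod (B $$ (i, j)))"

definition mat_trace :: "complex mat \<Rightarrow> complex" where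
  "mat_trace B = (\<Sum>i<dim_row B. B $$ (i, i))"

end

theory Submission
  imports Defs "HOL-Complex_Analysis.Great_Picard" "Jordan_Normal_Form.Spectral_Radius"
begin

text \<open>
  Since \<open>\<xi>(x)\<close> is unitary, \<open>A \<xi> = \<xi> \<sigma>\<^sub>A\<close>, and inserting the Fourier inversion formula of a
  trigonometric polynomial \<open>f\<close> gives \<open>A f = \<Sum> d\<^sub>\<xi> \<langle>f, \<xi>\<^sub>i\<^sub>j\<rangle> A \<xi>\<^sub>i\<^sub>j\<close>, the sum being over \<open>\<xi>, i, j\<close>.
  By Schur orthogonality and Hoelder's inequality the functional \<open>d\<^sub>\<xi> \<langle>\<cdot>, \<xi>\<^sub>i\<^sub>j\<rangle>\<close> has norm at most
  \<open>d\<^sub>\<xi>\<close> to the power \<open>1 / min 2 p\<close>, and \<open>|A \<xi>\<^sub>i\<^sub>j|\<close> is bounded by the maximum norm of the transposed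
  symbol because the entries of \<open>\<xi>\<close> are bounded by 1. As there are \<open>d\<^sub>\<xi>\<^sup>2\<close> pairs \<open>i, j\<close>, the
  hypothesis gives the \<open>r\<close>-summability of this series, which therefore represents \<open>A\<close> on all of
  \<open>L\<^sup>p\<close>, trigonometric polynomials being dense by the Peter--Weyl theorem. Its trace is the asserted
  integral, and it does not depend on the representation because \<open>L\<^sup>p\<close> has the approximation property.
\<close>

section \<open>Lebesgue spaces\<close>

text \<open>The obstacle is the Peter-Weyl theorem. The L2 inner product is used on continuous
  functions, which are not complete for it, so limits and orthogonal projections cannot simply be
  taken. Convolution with a symmetric kernel repairs this: it is self-adjoint, commutes with left
  translations, and maps L2-bounded sequences to equicontinuous ones and L2-Cauchy sequences to
  uniformly Cauchy ones, so that the required limits are again continuous functions. Maximising the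
  norm of its values on the unit ball yields an eigenspace of finite dimension, and a minimal
  invariant subspace of it is an irreducible representation. Functions that agree almost everywhere
  are not identified, hence \<open>A\<close> is linear only up to functions of seminorm 0, and many
  estimates carry an extra triangle step for this. A nuclear representation is a sequence, so the
  unitary dual must be shown to be countable; Bessel's inequality does that. The approximation
  property enters in its metric form, with finite-rank operators of norm at most 1, because the tail
  of a nuclear series must be controlled independently of the rank.\<close>

lemma powr_convex_comb:
  fixes x y t p :: real
  assumes "0 \<le> x" "0 \<le> y" "0 \<le> t" "t \<le> 1" "1 \<le> p"
  shows "(t * x + (1 - t) * y) powr p \<le> t * x powr p + (1 - t) * y powr p"
proof -
  \<comment> \<open>Convexity is invoked on the open half line only; when one argument is 0 the
    claim reduces to this inequality for the other weight.\<close>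
  have le: "s powr p \<le> s" if "0 \<le> s" "s \<le> 1" for s :: real
    using that assms(5) powr_mono'[of 1 p s] by (cases "s = 0") auto
  consider "x = 0" | "y = 0" | "x > 0" "y > 0" using assms by linarith
  then show ?thesis
  proof cases
    case 1
    then show ?thesis using assms le[of "1 - t"] by (auto simp: powr_mult intro!: mult_right_mono)
  next
    case 2
    then show ?thesis using assms le[of t] by (auto simp: powr_mult intro!: mult_right_mono)
  next
    case 3
    have "convex_on {0<..} (\<lambda>x::real. x powr p)" using assms(5) by (rule powr_convex)
    from convex_onD[OF this, of "1 - t" x y] show ?thesis using 3 assms by simp
  qed
qed

text \<open>Convexity at the midpoint. The constant is not sharp: the bound only serves to show that
  a sum of two p-integrable functions is p-integrable.\<close>

lemma powr_add_le:
  fixes x y p :: real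
  assumes "0 \<le> x" "0 \<le> y" "1 \<le> p"
  shows "(x + y) powr p \<le> 2 powr p * (x powr p + y powr p)"
proof -
  have "(x + y) powr p = 2 powr p * ((1/2) * x + (1 - 1/2) * y) powr p"
    using assms by (simp flip: powr_mult)
  also have "\<dots> \<le> 2 powr p * ((1/2) * x powr p + (1 - 1/2) * y powr p)"
    using assms by (intro mult_left_mono powr_convex_comb) auto
  also have "\<dots> \<le> 2 powr p * (x powr p + y powr p)"
    by (intro mult_left_mono add_mono) auto
  finally show ?thesis .
qed

lemma Lp_norm_nonneg [simp]: "0 \<le> Lp_norm p M f"
  by (simp add: Lp_norm_def)

lemma Lp_norm_powr:
  assumes "1 \<le> p"
  shows "Lp_norm p M f powr p = (LINT x|M. norm (f x) powr p)"
  using assms by (simp add: Lp_norm_def powr_powr)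

lemma Lp_norm_le_iff:
  assumes "1 \<le> p" "0 \<le> a"
  shows "Lp_norm p M f \<le> a \<longleftrightarrow> (LINT x|M. norm (f x) powr p) \<le> a powr p"
  using assms powr_mono2[of p "Lp_norm p M f" a] powr_less_mono2[of p a "Lp_norm p M f"]
  by (fastforce simp flip: Lp_norm_powr)

lemma Lp_norm_scale:
  fixes f :: "'a \<Rightarrow> complex"
  assumes "1 \<le> p"
  shows "Lp_norm p M (\<lambda>x. c * f x) = cmod c * Lp_norm p M f"
  using assms by (simp add: Lp_norm_def norm_mult powr_mult powr_powr)

lemma Lp_norm_zero [simp]: "Lp_norm p M (\<lambda>x. 0) = 0"
  by (simp add: Lp_norm_def)

lemma Lp_norm_minus_commute:
  fixes f g :: "'a \<Rightarrow> complex"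
  shows "Lp_norm p M (\<lambda>x. f x - g x) = Lp_norm p M (\<lambda>x. g x - f x)"
  by (simp add: Lp_norm_def norm_minus_commute)

lemma Lp_spaceD:
  assumes "f \<in> Lp_space p M"
  shows "f \<in> borel_measurable M" "integrable M (\<lambda>x. cmod (f x) powr p)"
  using assms by (auto simp: Lp_space_def)

lemma Lp_norm_mono:
  fixes f :: "'a \<Rightarrow> 'b::real_normed_vector" and g :: "'a \<Rightarrow> 'c::real_normed_vector"
  assumes "1 \<le> p" "integrable M (\<lambda>x. norm (g x) powr p)"
    and "AE x in M. norm (f x) \<le> norm (g x)"
  shows "Lp_norm p M f \<le> Lp_norm p M g"
  unfolding Lp_norm_def
proof (rule powr_mono2)
  show "(LINT x|M. norm (f x) powr p) \<le> (LINT x|M. norm (g x) powr p)"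
  proof (rule integral_mono_AE')
    show "AE x in M. norm (f x) powr p \<le> norm (g x) powr p"
      using assms(3) by eventually_elim (use assms(1) in \<open>auto intro: powr_mono2\<close>)
  qed (use assms in auto)
qed (use assms in auto)

lemma Lp_space_scale:
  assumes "f \<in> Lp_space p M"
  shows "(\<lambda>x. c * f x) \<in> Lp_space p M"
  using assms by (auto simp: Lp_space_def norm_mult powr_mult)

lemma Lp_space_add:
  assumes "1 \<le> p" "f \<in> Lp_space p M" "g \<in> Lp_space p M"
  shows "(\<lambda>x. f x + g x) \<in> Lp_space p M"
proof -
  note [measurable] = assms(2,3)[THEN Lp_spaceD(1)]
  have "integrable M (\<lambda>x. cmod (f x + g x) powr p)"
  proof (rule Bochner_Integration.integrable_bound)
    show "integrable M (\<lambda>x. 2 powr p * (cmod (f x) powr p + cmod (g x) powr p))"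
      using assms by (auto dest!: Lp_spaceD(2))
    have "cmod (f x + g x) powr p \<le> 2 powr p * (cmod (f x) powr p + cmod (g x) powr p)" for x
      using powr_add_le[of "cmod (f x)" "cmod (g x)" p] assms(1)
        powr_mono2[OF _ _ norm_triangle_ineq, of p "f x" "g x"] by force
    then show "AE x in M. norm (cmod (f x + g x) powr p)
        \<le> norm (2 powr p * (cmod (f x) powr p + cmod (g x) powr p))"
      by (simp add: abs_mult)
  qed simp
  then show ?thesis by (auto simp: Lp_space_def)
qed

lemma Lp_space_diff:
  assumes "1 \<le> p" "f \<in> Lp_space p M" "g \<in> Lp_space p M"
  shows "(\<lambda>x. f x - g x) \<in> Lp_space p M"
  using Lp_space_add[OF assms(1,2) Lp_space_scale[OF assms(3), of "-1"]] by simp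

lemma Lp_space_zero [simp]: "(\<lambda>x. 0) \<in> Lp_space p M"
  by (auto simp: Lp_space_def)

lemma Lp_space_sum:
  assumes "1 \<le> p" "\<And>i. i \<in> I \<Longrightarrow> f i \<in> Lp_space p M"
  shows "(\<lambda>x. \<Sum>i\<in>I. f i x) \<in> Lp_space p M"
  using assms(2) by (induction I rule: infinite_finite_induct) (auto intro: Lp_space_add[OF assms(1)])

text \<open>Minkowski's inequality by convexity: (f + g) / (a + b) is the convex combination of f /
  a and g / b with weights a / (a + b) and b / (a + b).\<close>

lemma Lp_norm_triangle:
  assumes p: "1 \<le> p" and f: "f \<in> Lp_space p M" and g: "g \<in> Lp_space p M"
  shows "Lp_norm p M (\<lambda>x. f x + g x) \<le> Lp_norm p M f + Lp_norm p M g"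
proof (rule field_le_epsilon)
  fix e :: real assume "0 < e"
  \<comment> \<open>The surplus e / 2 keeps both normalising constants positive when a norm
    vanishes.\<close>
  define a where "a = Lp_norm p M f + e / 2"
  define b where "b = Lp_norm p M g + e / 2"
  have a: "0 < a" "Lp_norm p M f \<le> a" and b: "0 < b" "Lp_norm p M g \<le> b"
    using \<open>0 < e\<close> Lp_norm_nonneg[of p M f] Lp_norm_nonneg[of p M g] by (auto simp: a_def b_def intro: add_nonneg_pos)
  define t where "t = a / (a + b)"
  have t: "0 \<le> t" "t \<le> 1" "1 - t = b / (a + b)" using a b by (auto simp: t_def field_simps)
  have pt: "cmod (f x + g x) powr p \<le>
      (a + b) powr p * (t * (cmod (f x) powr p / a powr p) + (1 - t) * (cmod (g x) powr p / b powr p))" for x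
  proof -
    have "cmod (f x + g x) \<le> cmod (f x) + cmod (g x)" by (rule norm_triangle_ineq)
    also have "\<dots> = (a + b) * (t * (cmod (f x) / a) + (1 - t) * (cmod (g x) / b))"
      unfolding t(3) unfolding t_def using a b by (simp flip: add_divide_distrib)
    finally have "cmod (f x + g x) powr p \<le> ((a + b) * (t * (cmod (f x) / a) + (1 - t) * (cmod (g x) / b))) powr p"
      using p by (intro powr_mono2) auto
    also have "\<dots> = (a + b) powr p * (t * (cmod (f x) / a) + (1 - t) * (cmod (g x) / b)) powr p"
      using a b t by (intro powr_mult)
    also have "\<dots> \<le> (a + b) powr p * (t * (cmod (f x) / a) powr p + (1 - t) * (cmod (g x) / b) powr p)"
      using a b t p by (intro mult_left_mono powr_convex_comb) auto
    finally show ?thesis using a b by (simp add: powr_divide)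
  qed
  have "(LINT x|M. cmod (f x + g x) powr p) \<le>
      (LINT x|M. (a + b) powr p * (t * (cmod (f x) powr p / a powr p) + (1 - t) * (cmod (g x) powr p / b powr p)))"
    using pt Lp_spaceD(2)[OF f] Lp_spaceD(2)[OF g] Lp_spaceD(2)[OF Lp_space_add[OF p f g]]
    by (intro integral_mono) auto
  also have "\<dots> = (a + b) powr p * (t * ((LINT x|M. cmod (f x) powr p) / a powr p)
      + (1 - t) * ((LINT x|M. cmod (g x) powr p) / b powr p))"
    using Lp_spaceD(2)[OF f] Lp_spaceD(2)[OF g] by simp
  also have "\<dots> \<le> (a + b) powr p * (t * 1 + (1 - t) * 1)"
    using a b t p Lp_norm_le_iff[OF p, of a M f] Lp_norm_le_iff[OF p, of b M g]
    by (intro mult_left_mono add_mono) (auto simp: divide_le_eq)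
  finally have "Lp_norm p M (\<lambda>x. f x + g x) \<le> a + b"
    using a b p by (subst Lp_norm_le_iff) auto
  then show "Lp_norm p M (\<lambda>x. f x + g x) \<le> Lp_norm p M f + Lp_norm p M g + e"
    by (simp add: a_def b_def)
qed

lemma Lp_norm_triangle_diff:
  assumes p: "1 \<le> p" and "f \<in> Lp_space p M" "g \<in> Lp_space p M" "h \<in> Lp_space p M"
  shows "Lp_norm p M (\<lambda>x. f x - h x) \<le> Lp_norm p M (\<lambda>x. f x - g x) + Lp_norm p M (\<lambda>x. g x - h x)"
  using Lp_norm_triangle[OF p Lp_space_diff[OF p assms(2,3)] Lp_space_diff[OF p assms(3,4)]] by simp

lemma Lp_norm_sum:
  assumes p: "1 \<le> p" and "\<And>i. i \<in> I \<Longrightarrow> f i \<in> Lp_space p M"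
  shows "Lp_norm p M (\<lambda>x. \<Sum>i\<in>I. f i x) \<le> (\<Sum>i\<in>I. Lp_norm p M (f i))"
  using assms(2)
proof (induction I rule: infinite_finite_induct)
  case (insert i I)
  then have "Lp_norm p M (\<lambda>x. f i x + (\<Sum>i\<in>I. f i x)) \<le> Lp_norm p M (f i) + Lp_norm p M (\<lambda>x. \<Sum>i\<in>I. f i x)"
    by (intro Lp_norm_triangle p Lp_space_sum) auto
  with insert show ?case by fastforce
qed auto

lemma Lp_norm_eq_0_AE:
  assumes "1 \<le> p" "f \<in> Lp_space p M" "Lp_norm p M f = 0"
  shows "AE x in M. f x = 0"
proof -
  have "(LINT x|M. cmod (f x) powr p) = 0"
    using assms Lp_norm_powr[of p M f] by simp
  then have "AE x in M. cmod (f x) powr p = 0"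
    using Lp_spaceD[OF assms(2)] by (subst (asm) integral_nonneg_eq_0_iff_AE) auto
  then show ?thesis by eventually_elim auto
qed

text \<open>Young's inequality for |f| / a and |g| / b: a = b = 1 gives integrability, the two norms
  as a and b give the bound. A vanishing norm cannot be divided by, but then the product is
  null.\<close>

lemma Holder:
  fixes f g :: "'a \<Rightarrow> complex"
  assumes pq: "1 < p" "1 < q" "1 / p + 1 / q = 1"
    and f: "f \<in> Lp_space p M" and g: "g \<in> Lp_space q M"
  shows "integrable M (\<lambda>x. f x * g x)"
    and "(LINT x|M. cmod (f x * g x)) \<le> Lp_norm p M f * Lp_norm q M g"
proof -
  note [measurable] = Lp_spaceD(1)[OF f] Lp_spaceD(1)[OF g]
  have young: "cmod (f x * g x) \<le> a * b * ((cmod (f x) powr p / a powr p) / p + (cmod (g x) powr q / b powr q) / q)"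
    if "0 < a" "0 < b" for a b x
  proof -
    have "cmod (f x) / a * (cmod (g x) / b) \<le> (cmod (f x) / a) powr p / p + (cmod (g x) / b) powr q / q"
      using pq that by (intro Youngs_inequality) auto
    then show ?thesis using that by (simp add: powr_divide norm_mult field_simps)
  qed
  show int: "integrable M (\<lambda>x. f x * g x)"
  proof (rule Bochner_Integration.integrable_bound)
    show "integrable M (\<lambda>x. 1 * 1 * ((cmod (f x) powr p / 1 powr p) / p + (cmod (g x) powr q / 1 powr q) / q))"
      using Lp_spaceD(2)[OF f] Lp_spaceD(2)[OF g] by simp
    have "cmod (f x * g x) \<le> norm (1 * 1 * ((cmod (f x) powr p / 1 powr p) / p + (cmod (g x) powr q / 1 powr q) / q))" for x
      using young[of 1 1 x] by simp
    then show "AE x in M. cmod (f x * g x) \<le> norm (1 * 1 * ((cmod (f x) powr p / 1 powr p) / p + (cmod (g x) powr q / 1 powr q) / q))"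
      by simp
  qed simp
  let ?a = "Lp_norm p M f" and ?b = "Lp_norm q M g"
  show "(LINT x|M. cmod (f x * g x)) \<le> ?a * ?b"
  proof (cases "?a = 0 \<or> ?b = 0")
    case True
    then have "AE x in M. f x * g x = 0"
      using Lp_norm_eq_0_AE[OF _ f] Lp_norm_eq_0_AE[OF _ g] pq by (auto elim: AE_mp)
    then have "(LINT x|M. cmod (f x * g x)) = (LINT x|M. 0)"
      by (intro integral_cong_AE) auto
    with True show ?thesis by auto
  next
    case False
    then have ab: "0 < ?a" "0 < ?b" using Lp_norm_nonneg[of p M f] Lp_norm_nonneg[of q M g] by linarith+
    have "(LINT x|M. cmod (f x * g x)) \<le>
        (LINT x|M. ?a * ?b * ((cmod (f x) powr p / ?a powr p) / p + (cmod (g x) powr q / ?b powr q) / q))"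
      using int Lp_spaceD(2)[OF f] Lp_spaceD(2)[OF g] young[OF ab]
      by (intro integral_mono) auto
    also have "\<dots> = ?a * ?b * (((LINT x|M. cmod (f x) powr p) / ?a powr p) / p
        + ((LINT x|M. cmod (g x) powr q) / ?b powr q) / q)"
      using Lp_spaceD(2)[OF f] Lp_spaceD(2)[OF g] by simp
    also have "\<dots> = ?a * ?b" using pq ab by (simp flip: Lp_norm_powr)
    finally show ?thesis .
  qed
qed

section \<open>Inclusions between Lebesgue spaces of a probability measure\<close>

context prob_space
begin

lemma bounded_in_Lp_space:
  assumes "f \<in> borel_measurable M" "\<And>x. x \<in> space M \<Longrightarrow> cmod (f x) \<le> B" "1 \<le> p"
  shows "f \<in> Lp_space p M"
proof -
  have "integrable M (\<lambda>x. cmod (f x) powr p)"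
    using assms by (intro integrable_const_bound[where B="B powr p"]) (auto intro!: AE_I2 powr_mono2)
  with assms show ?thesis by (simp add: Lp_space_def)
qed

lemma Lp_norm_bounded:
  assumes "AE x in M. norm (f x) \<le> B" "1 \<le> p" "0 \<le> B"
  shows "Lp_norm p M f \<le> B"
proof -
  have "Lp_norm p M f \<le> Lp_norm p M (\<lambda>x. B)"
    using assms by (intro Lp_norm_mono) (auto elim: AE_mp)
  also have "\<dots> = B" using assms by (simp add: Lp_norm_def prob_space powr_powr)
  finally show ?thesis .
qed

text \<open>Hoelder's inequality against the constant 1, whose conjugate norm is at most 1 because
  the total mass is 1.\<close>

lemma Lp_integrable:
  assumes p: "1 \<le> p" and f: "f \<in> Lp_space p M"
  shows "integrable M f" "(LINT x|M. cmod (f x)) \<le> Lp_norm p M f"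
proof -
  have "integrable M f \<and> (LINT x|M. cmod (f x)) \<le> Lp_norm p M f"
  proof (cases "p = 1")
    case True
    then show ?thesis using f by (auto simp: Lp_space_def Lp_norm_def intro: integrable_norm_cancel)
  next
    case False
    define q where "q = p / (p - 1)"
    have pq: "1 < p" "1 < q" "1 / p + 1 / q = 1" using False p by (auto simp: q_def field_simps)
    have "(\<lambda>x. 1) \<in> Lp_space q M" using pq by (intro bounded_in_Lp_space[where B=1]) auto
    note H = Holder[OF pq f this]
    have "Lp_norm q M (\<lambda>x. 1::complex) \<le> 1" using pq by (intro Lp_norm_bounded) auto
    then have "Lp_norm p M f * Lp_norm q M (\<lambda>x. 1::complex) \<le> Lp_norm p M f * 1"
      by (intro mult_left_mono) auto
    with H show ?thesis by auto
  qed
  then show "integrable M f" "(LINT x|M. cmod (f x)) \<le> Lp_norm p M f" by auto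
qed

end

section \<open>The nuclear trace\<close>

abbreviation Lp_dual :: "real \<Rightarrow> 'a measure \<Rightarrow> (('a \<Rightarrow> complex) \<Rightarrow> complex) set" where
  "Lp_dual p M \<equiv> dual_space (Lp_space p M) (Lp_norm p M)"

abbreviation Lp_dual_norm :: "real \<Rightarrow> 'a measure \<Rightarrow> (('a \<Rightarrow> complex) \<Rightarrow> complex) \<Rightarrow> real" where
  "Lp_dual_norm p M \<equiv> dual_norm (Lp_space p M) (Lp_norm p M)"

abbreviation Lp_nuclear_rep ::
    "real \<Rightarrow> real \<Rightarrow> 'a measure \<Rightarrow> (('a \<Rightarrow> complex) \<Rightarrow> ('a \<Rightarrow> complex)) \<Rightarrow>
     (nat \<Rightarrow> ('a \<Rightarrow> complex) \<Rightarrow> complex) \<Rightarrow> (nat \<Rightarrow> 'a \<Rightarrow> complex) \<Rightarrow> bool" where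
  "Lp_nuclear_rep r p M \<equiv> nuclear_rep r (Lp_space p M) (Lp_norm p M) (Lp_space p M) (Lp_norm p M)"

lemma dual_spaceD:
  assumes "l \<in> dual_space E N"
  shows "f \<in> E \<Longrightarrow> g \<in> E \<Longrightarrow> l (\<lambda>y. f y + g y) = l f + l g"
    and "f \<in> E \<Longrightarrow> l (\<lambda>y. a * f y) = a * l f"
  using assms by (auto simp: dual_space_def)

text \<open>The operator P given by P f = sum of \<open>\<phi> v f * b v\<close> is described by its
  data, since the trace of P composed with T is read off from \<open>\<phi>\<close> and
  \<open>b\<close>. The norm bound 1 does not depend on the rank.\<close>

definition finite_rank_contraction ::
    "real \<Rightarrow> 'a measure \<Rightarrow> 'v set \<Rightarrow> ('v \<Rightarrow> ('a \<Rightarrow> complex) \<Rightarrow> complex) \<Rightarrow> ('v \<Rightarrow> 'a \<Rightarrow> complex) \<Rightarrow> bool"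
  where
  "finite_rank_contraction p M V \<phi> b \<longleftrightarrow> finite V \<and>
     (\<forall>v\<in>V. \<phi> v \<in> Lp_dual p M \<and> b v \<in> Lp_space p M) \<and>
     (\<forall>f\<in>Lp_space p M. Lp_norm p M (\<lambda>w. \<Sum>v\<in>V. \<phi> v f * b v w) \<le> Lp_norm p M f)"

context
  fixes p :: real and M :: "'a measure"
  assumes p: "1 \<le> p"
begin

lemma dual_diff:
  assumes "l \<in> dual_space (Lp_space p M) N" "f \<in> Lp_space p M" "g \<in> Lp_space p M"
  shows "l (\<lambda>y. f y - g y) = l f - l g"
  using dual_spaceD(1)[OF assms(1,2) Lp_space_scale[OF assms(3), of "-1"]]
    dual_spaceD(2)[OF assms(1,3), of "-1"] by simp

lemma dual_zero:
  assumes "l \<in> dual_space (Lp_space p M) N"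
  shows "l (\<lambda>y. 0) = 0"
  using dual_spaceD(2)[OF assms Lp_space_zero, of 0] by simp

lemma dual_sum:
  assumes l: "l \<in> dual_space (Lp_space p M) N" and "finite I" "\<And>i. i \<in> I \<Longrightarrow> f i \<in> Lp_space p M"
  shows "l (\<lambda>y. \<Sum>i\<in>I. c i * f i y) = (\<Sum>i\<in>I. c i * l (f i))"
  using assms(2,3)
proof (induction I rule: finite_induct)
  case empty
  show ?case using dual_zero[OF l] by simp
next
  case (insert i I)
  then show ?case
    using dual_spaceD(1)[OF l Lp_space_scale[of "f i" p M "c i"] Lp_space_sum[OF p, of I "\<lambda>i y. c i * f i y"]]
      dual_spaceD(2)[OF l, of "f i"]
    by (auto intro: Lp_space_scale)
qed

lemma dual_norm_bdd:
  assumes "l \<in> Lp_dual p M"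
  shows "bdd_above ((\<lambda>f. cmod (l f)) ` {f \<in> Lp_space p M. Lp_norm p M f \<le> 1})"
proof -
  obtain C where C: "\<And>f. f \<in> Lp_space p M \<Longrightarrow> cmod (l f) \<le> C * Lp_norm p M f"
    using assms unfolding dual_space_def by blast
  \<comment> \<open>The constant in \<open>dual_space\<close> may be negative, hence the absolute
    value.\<close>
  have "cmod (l f) \<le> \<bar>C\<bar>" if "f \<in> Lp_space p M" "Lp_norm p M f \<le> 1" for f
  proof -
    have "cmod (l f) \<le> \<bar>C\<bar> * Lp_norm p M f"
      using C[OF that(1)] by (rule order_trans) (intro mult_right_mono, auto)
    also have "\<dots> \<le> \<bar>C\<bar> * 1" using that by (intro mult_left_mono) auto
    finally show ?thesis by simp
  qed
  then show ?thesis by (auto intro!: bdd_aboveI)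
qed

lemma dual_norm_nonneg:
  assumes "l \<in> Lp_dual p M"
  shows "0 \<le> Lp_dual_norm p M l"
  unfolding dual_norm_def
  by (rule cSUP_upper2[OF dual_norm_bdd[OF assms], of "\<lambda>x. 0"]) auto

lemma dual_norm_le:
  assumes "\<And>f. f \<in> Lp_space p M \<Longrightarrow> cmod (l f) \<le> C * Lp_norm p M f" "0 \<le> C"
  shows "Lp_dual_norm p M l \<le> C"
  unfolding dual_norm_def
proof (rule cSUP_least)
  show "{f \<in> Lp_space p M. Lp_norm p M f \<le> 1} \<noteq> {}" by (auto intro!: exI[of _ "\<lambda>x. 0"])
  fix f assume "f \<in> {f \<in> Lp_space p M. Lp_norm p M f \<le> 1}"
  then have "cmod (l f) \<le> C * Lp_norm p M f" "C * Lp_norm p M f \<le> C * 1"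
    using assms(1) by (blast, intro mult_left_mono assms(2)) auto
  then show "cmod (l f) \<le> C" by simp
qed

lemma dual_norm_bound:
  assumes l: "l \<in> Lp_dual p M" and f: "f \<in> Lp_space p M"
  shows "cmod (l f) \<le> Lp_dual_norm p M l * Lp_norm p M f"
proof (cases "Lp_norm p M f = 0")
  case True
  then show ?thesis using l f by (auto simp: dual_space_def)
next
  case False
  let ?c = "complex_of_real (1 / Lp_norm p M f)"
  have "Lp_norm p M (\<lambda>y. ?c * f y) = 1"
    using False by (subst Lp_norm_scale[OF p]) (simp add: norm_divide)
  then have "cmod (l (\<lambda>y. ?c * f y)) \<le> Lp_dual_norm p M l"
    unfolding dual_norm_def
    using Lp_space_scale[OF f, of ?c] by (intro cSUP_upper[OF _ dual_norm_bdd[OF l]]) simp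
  then have "cmod (l f) / Lp_norm p M f \<le> Lp_dual_norm p M l"
    unfolding dual_spaceD(2)[OF l f] by (simp add: norm_mult norm_divide)
  then show ?thesis using False Lp_norm_nonneg[of p M f] by (simp add: divide_le_eq)
qed

text \<open>The factor \<open>C\<close> lets one lemma serve both the vectors \<open>y n\<close>
  (with 1) and their approximation errors under a contraction (with 2).\<close>

lemma nuclear_pairing_summable:
  assumes rep: "Lp_nuclear_rep 1 p M T x y"
    and z: "\<And>n. z n \<in> Lp_space p M" "\<And>n. Lp_norm p M (z n) \<le> C * Lp_norm p M (y n)"
  shows "summable (\<lambda>n. cmod (x n (z n)))"
proof (rule summable_comparison_test')
  let ?dn = "Lp_dual_norm p M"
  have xd: "x n \<in> Lp_dual p M" for n
    using rep by (auto simp: nuclear_rep_def)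
  show "summable (\<lambda>n. C * (?dn (x n) * Lp_norm p M (y n)))"
    using rep dual_norm_nonneg[OF xd] by (intro summable_mult) (simp add: nuclear_rep_def)
  fix n
  have "cmod (x n (z n)) \<le> ?dn (x n) * Lp_norm p M (z n)" by (rule dual_norm_bound[OF xd z(1)])
  also have "\<dots> \<le> ?dn (x n) * (C * Lp_norm p M (y n))"
    using dual_norm_nonneg[OF xd] z(2) by (intro mult_left_mono) auto
  finally show "norm (cmod (x n (z n))) \<le> C * (?dn (x n) * Lp_norm p M (y n))"
    by (simp add: algebra_simps)
qed

text \<open>After exchanging the finite sum with the series, the series of
  \<open>\<phi> v (y n) * x n (b v)\<close> is \<open>\<phi> v\<close> applied to the nuclear series
  of \<open>T (b v)\<close>. The value no longer mentions \<open>x\<close> and \<open>y\<close>, so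
  this trace does not see the representation.\<close>

lemma nuclear_trace_finite_rank:
  assumes rep: "Lp_nuclear_rep 1 p M T x y"
    and T: "\<And>f. f \<in> Lp_space p M \<Longrightarrow> T f \<in> Lp_space p M"
    and V: "finite V" "\<And>v. v \<in> V \<Longrightarrow> \<phi> v \<in> Lp_dual p M"
      "\<And>v. v \<in> V \<Longrightarrow> b v \<in> Lp_space p M"
  shows "(\<lambda>n. x n (\<lambda>w. \<Sum>v\<in>V. \<phi> v (y n) * b v w)) sums (\<Sum>v\<in>V. \<phi> v (T (b v)))"
proof -
  have xd: "x n \<in> Lp_dual p M" and y: "y n \<in> Lp_space p M" for n
    using rep by (auto simp: nuclear_rep_def)
  have "(\<lambda>n. \<phi> v (y n) * x n (b v)) sums \<phi> v (T (b v))" if v: "v \<in> V" for v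
  proof -
    note \<phi> = V(2)[OF v] and b = V(3)[OF v]
    define S where "S k = (\<lambda>w. \<Sum>n<k. x n (b v) * y n w)" for k
    have S: "S k \<in> Lp_space p M" for k
      unfolding S_def by (intro Lp_space_sum[OF p] Lp_space_scale y)
    have lim: "(\<lambda>k. Lp_norm p M (\<lambda>w. T (b v) w - S k w)) \<longlonglongrightarrow> 0"
      using rep b by (auto simp: nuclear_rep_def S_def)
    have "(\<lambda>k. \<phi> v (T (b v)) - \<phi> v (S k)) \<longlonglongrightarrow> 0"
    proof (rule Lim_null_comparison)
      show "(\<lambda>k. Lp_dual_norm p M (\<phi> v) * Lp_norm p M (\<lambda>w. T (b v) w - S k w)) \<longlonglongrightarrow> 0"
        using tendsto_mult_left[OF lim] by simp
      show "\<forall>\<^sub>F k in sequentially. cmod (\<phi> v (T (b v)) - \<phi> v (S k)) \<le>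
          Lp_dual_norm p M (\<phi> v) * Lp_norm p M (\<lambda>w. T (b v) w - S k w)"
        using dual_norm_bound[OF \<phi> Lp_space_diff[OF p T[OF b] S]]
        by (simp add: dual_diff[OF \<phi> T[OF b] S])
    qed
    then have "(\<lambda>k. \<phi> v (S k)) \<longlonglongrightarrow> \<phi> v (T (b v))"
      using tendsto_diff[OF tendsto_const[of "\<phi> v (T (b v))"]] by fastforce
    moreover have "\<phi> v (S k) = (\<Sum>n<k. \<phi> v (y n) * x n (b v))" for k
      unfolding S_def by (subst dual_sum[OF \<phi>]) (auto simp: y mult.commute)
    ultimately show ?thesis by (simp add: sums_def)
  qed
  then have "(\<lambda>n. \<Sum>v\<in>V. \<phi> v (y n) * x n (b v)) sums (\<Sum>v\<in>V. \<phi> v (T (b v)))"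
    by (intro sums_sum)
  then show ?thesis by (simp add: dual_sum[OF xd V(1,3)])
qed

text \<open>The trace is approximated by the traces of \<open>P \<circ> T\<close> for contractions \<open>P\<close> of finite rank, which
  depend on \<open>T\<close> only.\<close>

lemma nuclear_trace_approx:
  assumes rep: "Lp_nuclear_rep 1 p M T x y"
    and T: "\<And>f. f \<in> Lp_space p M \<Longrightarrow> T f \<in> Lp_space p M" and e: "0 < e"
  obtains K \<delta> where "0 < \<delta>"
    "\<And>V (\<phi> :: 'v \<Rightarrow> ('a \<Rightarrow> complex) \<Rightarrow> complex) b.
       finite_rank_contraction p M V \<phi> b \<Longrightarrow>
       \<forall>n<K. Lp_norm p M (\<lambda>w. y n w - (\<Sum>v\<in>V. \<phi> v (y n) * b v w)) \<le> \<delta> \<Longrightarrow>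
       cmod ((\<Sum>n. x n (y n)) - (\<Sum>v\<in>V. \<phi> v (T (b v)))) \<le> e"
proof -
  let ?dn = "Lp_dual_norm p M"
  have xd: "x n \<in> Lp_dual p M" and y: "y n \<in> Lp_space p M" for n
    using rep by (auto simp: nuclear_rep_def)
  define a where "a n = ?dn (x n) * Lp_norm p M (y n)" for n
  have a0: "0 \<le> a n" for n unfolding a_def using dual_norm_nonneg[OF xd] by simp
  have a: "summable a" using rep dual_norm_nonneg[OF xd] by (simp add: nuclear_rep_def a_def[abs_def])
  \<comment> \<open>A contraction P gives a vector y the error norm at most 2 |y|, so a tail below e
    / 4 contributes at most e / 2.\<close>
  obtain K where K: "(\<Sum>n. a (n + K)) < e / 4"
    using suminf_exist_split[OF _ a, of "e / 4"] e a0 by (auto simp: suminf_nonneg a abs_of_nonneg summable_ignore_initial_segment)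
  \<comment> \<open>Errors up to e / (2 * D) on the first \<open>K\<close> vectors add up to at most
    e / 2; the summand 1 keeps \<open>D\<close> positive. Both \<open>K\<close> and the tolerance
    are fixed before the contraction, so one contraction can serve two representations.\<close>
  define D where "D = (\<Sum>n<K. ?dn (x n)) + 1"
  have D: "0 < D" "(\<Sum>n<K. ?dn (x n)) \<le> D"
    using dual_norm_nonneg[OF xd] by (auto simp: D_def sum_nonneg add_nonneg_pos)
  show ?thesis
  proof (rule that[of "e / (2 * D)" K])
    show "0 < e / (2 * D)" using e D by simp
    fix V and \<phi> :: "'v \<Rightarrow> ('a \<Rightarrow> complex) \<Rightarrow> complex" and b
    assume frc: "finite_rank_contraction p M V \<phi> b"
      and close: "\<forall>n<K. Lp_norm p M (\<lambda>w. y n w - (\<Sum>v\<in>V. \<phi> v (y n) * b v w)) \<le> e / (2 * D)"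
    have V: "finite V" "\<And>v. v \<in> V \<Longrightarrow> \<phi> v \<in> Lp_dual p M"
      "\<And>v. v \<in> V \<Longrightarrow> b v \<in> Lp_space p M"
      using frc by (auto simp: finite_rank_contraction_def)
    define P where "P f = (\<lambda>w. \<Sum>v\<in>V. \<phi> v f * b v w)" for f
    have P: "P f \<in> Lp_space p M" for f
      unfolding P_def by (intro Lp_space_sum[OF p] Lp_space_scale V)
    have contr: "Lp_norm p M (P f) \<le> Lp_norm p M f" if "f \<in> Lp_space p M" for f
      using frc that by (simp add: P_def finite_rank_contraction_def)
    define d where "d n = cmod (x n (\<lambda>w. y n w - P (y n) w))" for n
    have yP: "(\<lambda>w. y n w - P (y n) w) \<in> Lp_space p M" for n by (intro Lp_space_diff p y P)
    have norm2: "Lp_norm p M (\<lambda>w. y n w - P (y n) w) \<le> 2 * Lp_norm p M (y n)" for n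
      using Lp_norm_triangle_diff[OF p y[of n] Lp_space_zero P[of "y n"]] contr[OF y[of n]]
        Lp_norm_minus_commute[of p M "\<lambda>x. 0" "P (y n)"]
      by simp
    have d: "summable d"
      unfolding d_def by (rule nuclear_pairing_summable[OF rep yP norm2])
    have s1: "summable (\<lambda>n. x n (y n))"
      by (rule summable_norm_cancel, rule nuclear_pairing_summable[OF rep y, where C=1]) simp
    have s2: "(\<lambda>n. x n (P (y n))) sums (\<Sum>v\<in>V. \<phi> v (T (b v)))"
      unfolding P_def by (rule nuclear_trace_finite_rank[OF rep T V])
    have "(\<Sum>n. x n (y n)) - (\<Sum>v\<in>V. \<phi> v (T (b v))) = (\<Sum>n. x n (y n) - x n (P (y n)))"
      using suminf_diff[OF s1 sums_summable[OF s2]] sums_unique[OF s2] by simp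
    also have "\<dots> = (\<Sum>n. x n (\<lambda>w. y n w - P (y n) w))"
      by (simp add: dual_diff[OF xd y P])
    also have "cmod \<dots> \<le> (\<Sum>n. d n)"
      unfolding d_def by (rule summable_norm) (use d in \<open>simp add: d_def[abs_def]\<close>)
    also have "\<dots> = (\<Sum>n. d (n + K)) + (\<Sum>n<K. d n)"
      by (rule suminf_split_initial_segment[OF d])
    also have "\<dots> \<le> e / 2 + e / 2"
    proof (rule add_mono)
      have "(\<Sum>n. d (n + K)) \<le> (\<Sum>n. 2 * a (n + K))"
      proof (rule suminf_le)
        show "d (n + K) \<le> 2 * a (n + K)" for n
          unfolding d_def a_def
          by (rule order_trans[OF dual_norm_bound[OF xd yP]])
            (use mult_left_mono[OF norm2 dual_norm_nonneg[OF xd], of "n + K" "n + K"] in \<open>simp add: algebra_simps\<close>)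
      qed (use d a in \<open>auto simp: summable_ignore_initial_segment intro: summable_mult\<close>)
      also have "\<dots> = 2 * (\<Sum>n. a (n + K))"
        by (rule suminf_mult) (simp add: a summable_ignore_initial_segment)
      finally show "(\<Sum>n. d (n + K)) \<le> e / 2" using K by simp
      have "(\<Sum>n<K. d n) \<le> (\<Sum>n<K. ?dn (x n) * (e / (2 * D)))"
      proof (rule sum_mono)
        fix n assume n: "n \<in> {..<K}"
        have "d n \<le> ?dn (x n) * Lp_norm p M (\<lambda>w. y n w - P (y n) w)"
          unfolding d_def by (rule dual_norm_bound[OF xd yP])
        also have "\<dots> \<le> ?dn (x n) * (e / (2 * D))"
          using n close dual_norm_nonneg[OF xd] by (intro mult_left_mono) (auto simp: P_def)
        finally show "d n \<le> ?dn (x n) * (e / (2 * D))" .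
      qed
      also have "\<dots> = (\<Sum>n<K. ?dn (x n)) * (e / (2 * D))" by (rule sum_distrib_right[symmetric])
      also have "\<dots> \<le> D * (e / (2 * D))" using D e by (intro mult_right_mono) auto
      also have "\<dots> = e / 2" using D by simp
      finally show "(\<Sum>n<K. d n) \<le> e / 2" .
    qed
    finally show "cmod ((\<Sum>n. x n (y n)) - (\<Sum>v\<in>V. \<phi> v (T (b v)))) \<le> e" by simp
  qed
qed

end

section \<open>Averaging over finite partitions and uniqueness of the nuclear trace\<close>

context prob_space
begin

text \<open>Dominated convergence: the approximating simple functions are bounded by 2 |f|, so the
  errors stay below 3 |f|, which explains the factor \<open>3 powr p\<close>.\<close>

lemma simple_approx_Lp:
  assumes p: "1 \<le> p" and f: "f \<in> Lp_space p M" and e: "0 < e"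
  obtains s where "simple_function M s" "s \<in> Lp_space p M" "Lp_norm p M (\<lambda>x. f x - s x) < e"
proof -
  note [measurable] = Lp_spaceD(1)[OF f]
  obtain F where "\<forall>i. simple_function M (F i)"
    "\<forall>x\<in>space M. (\<lambda>i. F i x) \<longlonglongrightarrow> f x"
    "\<forall>i. \<forall>x\<in>space M. dist (F i x) 0 \<le> 2 * dist (f x) 0"
    using borel_measurable_implies_sequence_metric[OF Lp_spaceD(1)[OF f], of 0] by blast
  then have F: "simple_function M (F i)"
    "x \<in> space M \<Longrightarrow> (\<lambda>i. F i x) \<longlonglongrightarrow> f x"
    "x \<in> space M \<Longrightarrow> cmod (F i x) \<le> 2 * cmod (f x)" for i x
    by auto
  have [measurable]: "F i \<in> borel_measurable M" for i using F(1) by (rule borel_measurable_simple_function)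
  have FL: "F i \<in> Lp_space p M" for i
  proof -
    have "finite (F i ` space M)" using F(1)[of i] by (simp add: simple_function_def)
    then obtain B where "\<And>v. v \<in> F i ` space M \<Longrightarrow> cmod v \<le> B"
      using finite_imp_bounded[of "F i ` space M"] by (auto simp: bounded_iff)
    then show ?thesis using p by (intro bounded_in_Lp_space[where B=B]) auto
  qed
  have "(\<lambda>i. LINT x|M. cmod (f x - F i x) powr p) \<longlonglongrightarrow> (LINT x|M. 0)"
  proof (rule integral_dominated_convergence[where w="\<lambda>x. 3 powr p * cmod (f x) powr p"])
    show "integrable M (\<lambda>x. 3 powr p * cmod (f x) powr p)" using Lp_spaceD(2)[OF f] by simp
    show "AE x in M. (\<lambda>i. cmod (f x - F i x) powr p) \<longlonglongrightarrow> 0"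
    proof (rule AE_I2)
      fix x assume "x \<in> space M"
      then have "(\<lambda>i. cmod (f x - F i x)) \<longlonglongrightarrow> 0"
        using tendsto_norm[OF tendsto_diff[OF tendsto_const F(2)], of x "f x"] by simp
      then have "(\<lambda>i. cmod (f x - F i x) powr p) \<longlonglongrightarrow> 0 powr p"
        using p by (intro tendsto_powr') auto
      then show "(\<lambda>i. cmod (f x - F i x) powr p) \<longlonglongrightarrow> 0" by simp
    qed
    show "AE x in M. norm (cmod (f x - F i x) powr p) \<le> 3 powr p * cmod (f x) powr p" for i
    proof (rule AE_I2)
      fix x assume "x \<in> space M"
      then have "cmod (f x - F i x) \<le> 3 * cmod (f x)"
        using F(3)[of x i] norm_triangle_ineq4[of "f x" "F i x"] by simp
      then have "cmod (f x - F i x) powr p \<le> (3 * cmod (f x)) powr p"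
        using p by (intro powr_mono2) auto
      then show "norm (cmod (f x - F i x) powr p) \<le> 3 powr p * cmod (f x) powr p"
        by (simp add: powr_mult)
    qed
  qed auto
  then have "(\<lambda>i. Lp_norm p M (\<lambda>x. f x - F i x)) \<longlonglongrightarrow> 0 powr (1 / p)"
    unfolding Lp_norm_def using p by (intro tendsto_powr') auto
  then have "\<forall>\<^sub>F i in sequentially. Lp_norm p M (\<lambda>x. f x - F i x) < e"
    using e by (auto dest: order_tendstoD(2))
  then obtain i where "Lp_norm p M (\<lambda>x. f x - F i x) < e" by (auto simp: eventually_sequentially)
  with F(1) FL that show ?thesis by blast
qed

text \<open>Hoelder's inequality against the indicator of \<open>B\<close>, whose q-norm is
  \<open>prob B powr (1 / q)\<close>; raised to the power p this becomes the exponent p / q = p -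
  1.\<close>

lemma integral_set_powr_le:
  assumes p: "1 \<le> p" and f: "f \<in> Lp_space p M" and B: "B \<in> sets M"
  shows "cmod (LINT x|M. f x * indicator B x) powr p \<le>
      prob B powr (p - 1) * (LINT x|M. cmod (f x) powr p * indicator B x)"
proof (cases "p = 1")
  case True
  have "cmod (LINT x|M. f x * indicator B x) \<le> (LINT x|M. cmod (f x * indicator B x))"
    by (rule integral_norm_bound)
  also have "(\<lambda>x. cmod (f x * indicator B x)) = (\<lambda>x. cmod (f x) * indicator B x)"
    by (auto simp: norm_mult split: split_indicator)
  finally have le: "cmod (LINT x|M. f x * indicator B x) \<le> (LINT x|M. cmod (f x) * indicator B x)" .
  \<comment> \<open>For p = 1 the factor is \<open>prob B powr 0\<close>, which is 0 and not 1 on a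
    null set, so null sets need an argument of their own.\<close>
  show ?thesis
  proof (cases "prob B = 0")
    case True
    then have "AE x in M. x \<notin> B" using B by (simp add: AE_iff_measurable emeasure_eq_measure prob_eq_0)
    then have "AE x in M. cmod (f x) * indicator B x = 0" by eventually_elim simp
    then have "(LINT x|M. cmod (f x) * indicator B x) = (LINT x|M. 0)"
      using Lp_spaceD(1)[OF f] B by (intro integral_cong_AE) auto
    with le True \<open>p = 1\<close> show ?thesis by simp
  next
    case False
    with le \<open>p = 1\<close> show ?thesis by simp
  qed
next
  case False
  define q where "q = p / (p - 1)"
  have pq: "1 < p" "1 < q" "1 / p + 1 / q = 1" using False p by (auto simp: q_def field_simps)
  note [measurable] = Lp_spaceD(1)[OF f] B
  define g where "g x = f x * indicator B x" for x
  have pw: "cmod (g x) powr p = cmod (f x) powr p * indicator B x" for x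
    by (auto simp: g_def split: split_indicator)
  have g: "g \<in> Lp_space p M"
  proof -
    have "g \<in> borel_measurable M" unfolding g_def by measurable
    moreover have "integrable M (\<lambda>x. cmod (g x) powr p)"
      unfolding pw using integrable_mult_indicator[OF B Lp_spaceD(2)[OF f]] by (simp add: mult.commute)
    ultimately show ?thesis by (simp add: Lp_space_def)
  qed
  have i: "(\<lambda>x. indicator B x) \<in> Lp_space q M"
    using pq by (intro bounded_in_Lp_space[where B=1]) (auto split: split_indicator)
  have "cmod (LINT x|M. g x * indicator B x) \<le> Lp_norm p M g * Lp_norm q M (\<lambda>x. indicator B x :: complex)"
    by (rule order_trans[OF integral_norm_bound Holder(2)[OF pq g i]])
  then have "cmod (LINT x|M. g x * indicator B x) powr p \<le>
      (Lp_norm p M g * Lp_norm q M (\<lambda>x. indicator B x :: complex)) powr p"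
    using p by (intro powr_mono2) auto
  also have "\<dots> = Lp_norm p M g powr p * Lp_norm q M (\<lambda>x. indicator B x :: complex) powr p"
    by (rule powr_mult)
  also have "Lp_norm q M (\<lambda>x. indicator B x :: complex) = prob B powr (1 / q)"
  proof -
    have "(\<lambda>x. cmod (indicator B x :: complex) powr q) = indicator B"
      using pq by (auto split: split_indicator)
    then show ?thesis by (simp add: Lp_norm_def)
  qed
  also have "(prob B powr (1 / q)) powr p = prob B powr (p - 1)"
    using pq by (simp add: powr_powr q_def)
  also have "(\<lambda>x. g x * indicator B x) = (\<lambda>x. f x * indicator B x)"
    by (auto simp: g_def split: split_indicator)
  finally show ?thesis using p by (simp add: Lp_norm_powr pw mult.commute)
qed

text \<open>The value on the fibre of \<open>v\<close> of the conditional expectation of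
  \<open>f\<close> given \<open>t\<close>. On a null fibre it is 0, by the convention for division
  by 0.\<close>

definition simple_avg :: "('a \<Rightarrow> 'b) \<Rightarrow> 'b \<Rightarrow> ('a \<Rightarrow> complex) \<Rightarrow> complex" where
  "simple_avg t v f = (LINT x|M. f x * indicator (t -` {v} \<inter> space M) x) / prob (t -` {v} \<inter> space M)"

lemma sum_fibre_indicator:
  fixes c :: "'b \<Rightarrow> 'c::semiring_1"
  assumes "finite (t ` space M)" "x \<in> space M"
  shows "(\<Sum>v\<in>t ` space M. c v * indicator (t -` {v} \<inter> space M) x) = c (t x)"
proof -
  have "(\<Sum>v\<in>t ` space M. c v * indicator (t -` {v} \<inter> space M) x) = (\<Sum>v\<in>t ` space M. if v = t x then c v else 0)"
    using assms by (intro sum.cong) (auto split: split_indicator)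
  then show ?thesis using assms by simp
qed

text \<open>On a fibre of positive measure, \<open>integral_set_powr_le\<close> divided by the power
  p - 1 of that measure is Jensen's inequality; null fibres contribute 0. Summing over the fibres
  gives the norm bound.\<close>

lemma simple_avg_contraction:
  assumes p: "1 \<le> p" and t: "simple_function M t" and f: "f \<in> Lp_space p M"
  shows "Lp_norm p M (\<lambda>x. \<Sum>v\<in>t ` space M. simple_avg t v f * indicator (t -` {v} \<inter> space M) x) \<le> Lp_norm p M f"
proof -
  have fin: "finite (t ` space M)" and meas: "t -` {v} \<inter> space M \<in> sets M" for v
    using t simple_functionD by auto
  let ?B = "\<lambda>v. t -` {v} \<inter> space M"
  note [measurable] = Lp_spaceD(1)[OF f] meas
  have int: "integrable M (\<lambda>x. cmod (f x) powr p * indicator (?B v) x)" for v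
    using integrable_mult_indicator[OF meas Lp_spaceD(2)[OF f]] by (simp add: mult.commute)
  have int1: "integrable M (indicat_real (?B v))" for v
    using meas[of v] by (intro integrable_real_indicator) (auto simp: less_top[symmetric])
  have "(LINT x|M. cmod (\<Sum>v\<in>t ` space M. simple_avg t v f * indicator (?B v) x) powr p)
      = (LINT x|M. (\<Sum>v\<in>t ` space M. cmod (simple_avg t v f) powr p * indicator (?B v) x))"
    by (intro Bochner_Integration.integral_cong refl) (simp add: sum_fibre_indicator[OF fin])
  also have "\<dots> = (\<Sum>v\<in>t ` space M. cmod (simple_avg t v f) powr p * prob (?B v))"
    using int1 by (subst Bochner_Integration.integral_sum) (auto simp: meas)
  also have "\<dots> \<le> (\<Sum>v\<in>t ` space M. (LINT x|M. cmod (f x) powr p * indicator (?B v) x))"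
  proof (rule sum_mono)
    fix v
    show "cmod (simple_avg t v f) powr p * prob (?B v) \<le> (LINT x|M. cmod (f x) powr p * indicator (?B v) x)"
    proof (cases "prob (?B v) = 0")
      case True
      then show ?thesis by (simp add: integral_nonneg_AE)
    next
      case False
      then have pos: "0 < prob (?B v)" by (simp add: zero_less_measure_iff)
      have "cmod (simple_avg t v f) powr p * prob (?B v) =
          cmod (LINT x|M. f x * indicator (?B v) x) powr p / prob (?B v) powr (p - 1)"
        using pos unfolding simple_avg_def by (simp add: norm_divide powr_divide powr_diff)
      also have "\<dots> \<le> (LINT x|M. cmod (f x) powr p * indicator (?B v) x)"
        using integral_set_powr_le[OF p f meas[of v]] pos by (simp add: divide_le_eq mult.commute)
      finally show ?thesis .
    qed
  qed
  also have "\<dots> = (LINT x|M. (\<Sum>v\<in>t ` space M. cmod (f x) powr p * indicator (?B v) x))"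
    using int by (subst Bochner_Integration.integral_sum) auto
  also have "\<dots> = (LINT x|M. cmod (f x) powr p)"
  proof (intro Bochner_Integration.integral_cong refl)
    fix x assume "x \<in> space M"
    then show "(\<Sum>v\<in>t ` space M. cmod (f x) powr p * indicator (?B v) x) = cmod (f x) powr p"
      using sum_fibre_indicator[OF fin, of x "\<lambda>_. cmod (f x) powr p"] by simp
  qed
  finally show ?thesis using p by (subst Lp_norm_le_iff) (auto simp: Lp_norm_powr)
qed

lemma simple_avg_dual:
  assumes p: "1 \<le> p" and t: "simple_function M t"
  shows "simple_avg t v \<in> Lp_dual p M"
proof -
  let ?B = "t -` {v} \<inter> space M"
  have meas [measurable]: "?B \<in> sets M" using t simple_functionD by auto
  have int: "integrable M (\<lambda>x. f x * indicator ?B x)" if "f \<in> Lp_space p M" for f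
    using integrable_mult_indicator[OF meas Lp_integrable(1)[OF p that]]
    by (rule Bochner_Integration.integrable_cong[THEN iffD1, rotated 2]) (auto split: split_indicator)
  have bd: "cmod (simple_avg t v f) \<le> inverse (prob ?B) * Lp_norm p M f" if f: "f \<in> Lp_space p M" for f
  proof -
    have "cmod (LINT x|M. f x * indicator ?B x) \<le> (LINT x|M. cmod (f x * indicator ?B x))"
      by (rule integral_norm_bound)
    also have "\<dots> \<le> (LINT x|M. cmod (f x))"
      using int[OF f] Lp_integrable(1)[OF p f] by (intro integral_mono) (auto split: split_indicator)
    also have "\<dots> \<le> Lp_norm p M f" by (rule Lp_integrable(2)[OF p f])
    finally have "cmod (LINT x|M. f x * indicator ?B x) / prob ?B \<le> Lp_norm p M f / prob ?B"
      by (intro divide_right_mono) auto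
    then show ?thesis
      by (simp add: simple_avg_def norm_divide norm_mult norm_inverse divide_inverse_commute)
  qed
  show ?thesis
    unfolding dual_space_def
  proof (intro CollectI conjI ballI allI exI[of _ "inverse (prob ?B)"] bd)
    fix f g assume f: "f \<in> Lp_space p M" and g: "g \<in> Lp_space p M"
    show "simple_avg t v (\<lambda>y. f y + g y) = simple_avg t v f + simple_avg t v g"
      using int[OF f] int[OF g] by (simp add: simple_avg_def distrib_right add_divide_distrib)
  next
    fix a f
    show "simple_avg t v (\<lambda>y. a * f y) = a * simple_avg t v f"
      by (simp add: simple_avg_def mult.assoc)
  qed
qed

text \<open>A function that factors through \<open>t\<close> is constant on each fibre and is
  reproduced by averaging, except on null fibres, where the average is 0; hence only a seminorm
  vanishes.\<close>

lemma simple_avg_fixes: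
  assumes p: "1 \<le> p" and t: "simple_function M t" and s: "s \<in> Lp_space p M"
    and fac: "\<And>x. x \<in> space M \<Longrightarrow> s x = h (t x)"
  shows "Lp_norm p M (\<lambda>x. s x - (\<Sum>v\<in>t ` space M. simple_avg t v s * indicator (t -` {v} \<inter> space M) x)) = 0"
proof -
  have fin: "finite (t ` space M)" and meas [measurable]: "t -` {v} \<inter> space M \<in> sets M" for v
    using t simple_functionD by auto
  let ?B = "\<lambda>v. t -` {v} \<inter> space M"
  have "AE x in M. \<forall>v\<in>t ` space M. x \<in> ?B v \<longrightarrow> prob (?B v) \<noteq> 0"
  proof (rule AE_finite_allI[OF fin])
    fix v
    show "AE x in M. x \<in> ?B v \<longrightarrow> prob (?B v) \<noteq> 0"
    proof (cases "prob (?B v) = 0")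
      case True
      then have "AE x in M. x \<notin> ?B v"
        using meas[of v] by (simp add: AE_iff_measurable emeasure_eq_measure prob_eq_0)
      then show ?thesis by eventually_elim blast
    qed simp
  qed
  then have "AE x in M. s x - (\<Sum>v\<in>t ` space M. simple_avg t v s * indicator (?B v) x) = 0"
  proof (rule AE_mp, intro AE_I2 impI)
    fix x assume x: "x \<in> space M" and "\<forall>v\<in>t ` space M. x \<in> ?B v \<longrightarrow> prob (?B v) \<noteq> 0"
    then have nz: "prob (?B (t x)) \<noteq> 0" by auto
    have "(LINT y|M. s y * indicator (?B (t x)) y) = (LINT y|M. h (t x) * indicator (?B (t x)) y)"
      by (intro Bochner_Integration.integral_cong refl) (auto simp: fac split: split_indicator)
    moreover have "(indicator (?B (t x)) :: 'a \<Rightarrow> complex) = (\<lambda>y. complex_of_real (indicator (?B (t x)) y))"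
      by (auto split: split_indicator)
    ultimately have "simple_avg t (t x) s = h (t x)"
      using nz by (simp add: simple_avg_def)
    then show "s x - (\<Sum>v\<in>t ` space M. simple_avg t v s * indicator (?B v) x) = 0"
      using x by (simp add: sum_fibre_indicator[OF fin] fac)
  qed
  then have "Lp_norm p M (\<lambda>x. s x - (\<Sum>v\<in>t ` space M. simple_avg t v s * indicator (?B v) x)) \<le> 0"
    using p by (intro Lp_norm_bounded) auto
  then show ?thesis using Lp_norm_nonneg antisym by blast
qed

text \<open>Averaging over a finite partition gives the contractions of finite rank that witness the
  metric approximation property of \<open>L\<^sup>p\<close>.\<close>

lemma Lp_metric_approximation:
  fixes z :: "nat \<Rightarrow> 'a \<Rightarrow> complex"
  assumes p: "1 \<le> p" and z: "\<And>n. z n \<in> Lp_space p M" and e: "0 < e"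
  obtains V and \<phi> :: "complex list \<Rightarrow> ('a \<Rightarrow> complex) \<Rightarrow> complex" and b where
    "finite_rank_contraction p M V \<phi> b"
    "\<And>n. n < K \<Longrightarrow> Lp_norm p M (\<lambda>w. z n w - (\<Sum>v\<in>V. \<phi> v (z n) * b v w)) \<le> e"
proof -
  have "\<exists>s. simple_function M s \<and> s \<in> Lp_space p M \<and> Lp_norm p M (\<lambda>x. z n x - s x) < e / 2" for n
    using simple_approx_Lp[OF p z, of "e / 2"] e by (metis half_gt_zero)
  then obtain s where s: "\<And>n. simple_function M (s n)" "\<And>n. s n \<in> Lp_space p M"
    "\<And>n. Lp_norm p M (\<lambda>x. z n x - s n x) < e / 2"
    by metis
  \<comment> \<open>The fibres of this tuple are the common refinement of the partitions belonging
    to \<open>s 0\<close>, ..., \<open>s (K - 1)\<close>, so averaging over them fixes each of these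
    functions up to a null set. Values in \<open>complex list\<close> allow any length.\<close>
  define t where "t x = map (\<lambda>n. s n x) [0..<K]" for x
  have tt: "simple_function M (\<lambda>x. map (\<lambda>n. s n x) [0..<k])" for k
  proof (induction k)
    case 0
    show ?case by simp
  next
    case (Suc k)
    from simple_function_compose2[OF this s(1)[of k], of "\<lambda>l a. l @ [a]"]
    show ?case by simp
  qed
  then have t: "simple_function M t" unfolding t_def[abs_def] .
  have fin: "finite (t ` space M)" and meas [measurable]: "t -` {v} \<inter> space M \<in> sets M" for v
    using t simple_functionD by auto
  let ?b = "\<lambda>v. indicator (t -` {v} \<inter> space M) :: 'a \<Rightarrow> complex"
  define P where "P f = (\<lambda>w. \<Sum>v\<in>t ` space M. simple_avg t v f * ?b v w)" for f
  have b: "?b v \<in> Lp_space p M" for v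
    using p by (intro bounded_in_Lp_space[where B=1]) (auto split: split_indicator)
  have P: "P f \<in> Lp_space p M" for f
    unfolding P_def by (intro Lp_space_sum[OF p] Lp_space_scale b)
  have Pdiff: "P (\<lambda>w. f w - g w) = (\<lambda>w. P f w - P g w)" if "f \<in> Lp_space p M" "g \<in> Lp_space p M" for f g
    using dual_diff[OF p simple_avg_dual[OF p t] that]
    by (simp add: P_def left_diff_distrib sum_subtractf)
  show ?thesis
  proof (rule that[of "t ` space M" "simple_avg t" ?b])
    fix n assume n: "n < K"
    \<comment> \<open>As P fixes \<open>s n\<close> and is a contraction, the error is at most twice
      the distance of \<open>z n\<close> from \<open>s n\<close>, which is below e / 2.\<close>
    have "Lp_norm p M (\<lambda>w. z n w - P (z n) w)
        \<le> Lp_norm p M (\<lambda>w. z n w - s n w) + Lp_norm p M (\<lambda>w. s n w - P (z n) w)"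
      by (intro Lp_norm_triangle_diff p z s P)
    also have "Lp_norm p M (\<lambda>w. s n w - P (z n) w)
        \<le> Lp_norm p M (\<lambda>w. s n w - P (s n) w) + Lp_norm p M (\<lambda>w. P (s n) w - P (z n) w)"
      by (intro Lp_norm_triangle_diff p z s P)
    also have "Lp_norm p M (\<lambda>w. s n w - P (s n) w) = 0"
      unfolding P_def by (rule simple_avg_fixes[OF p t s(2), of _ "\<lambda>v. v ! n"]) (use n in \<open>simp add: t_def\<close>)
    also have "Lp_norm p M (\<lambda>w. P (s n) w - P (z n) w) \<le> Lp_norm p M (\<lambda>w. s n w - z n w)"
      unfolding Pdiff[OF s(2) z, symmetric] unfolding P_def
      by (rule simple_avg_contraction[OF p t Lp_space_diff[OF p s(2) z]])
    also have "\<dots> = Lp_norm p M (\<lambda>w. z n w - s n w)" by (rule Lp_norm_minus_commute)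
    finally show "Lp_norm p M (\<lambda>w. z n w - (\<Sum>v\<in>t ` space M. simple_avg t v (z n) * ?b v w)) \<le> e"
      using s(3)[of n] unfolding P_def by linarith
  qed (use fin b simple_avg_dual[OF p t] simple_avg_contraction[OF p t] in \<open>auto simp: finite_rank_contraction_def\<close>)
qed

text \<open>Both sums are within e / 2 of one and the same number, the trace of P composed with
  \<open>T\<close>, for a single finite-rank contraction P chosen after both
  representations.\<close>

theorem nuclear_trace_unique:
  assumes p: "1 \<le> p"
    and T: "\<And>f. f \<in> Lp_space p M \<Longrightarrow> T f \<in> Lp_space p M"
    and rep: "Lp_nuclear_rep 1 p M T x y"
    and rep': "Lp_nuclear_rep 1 p M T x' y'"
  shows "(\<lambda>n. x' n (y' n)) sums (\<Sum>n. x n (y n))"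
proof -
  have y: "y n \<in> Lp_space p M" "y' n \<in> Lp_space p M" for n
    using rep rep' by (auto simp: nuclear_rep_def)
  have "cmod ((\<Sum>n. x n (y n)) - (\<Sum>n. x' n (y' n))) \<le> e" if e: "0 < e" for e
  proof -
    have e2: "0 < e / 2" using e by simp
    obtain K d where K: "0 < d"
      "\<And>V (\<phi> :: complex list \<Rightarrow> ('a \<Rightarrow> complex) \<Rightarrow> complex) b.
       finite_rank_contraction p M V \<phi> b \<Longrightarrow>
       \<forall>n<K. Lp_norm p M (\<lambda>w. y n w - (\<Sum>v\<in>V. \<phi> v (y n) * b v w)) \<le> d \<Longrightarrow>
       cmod ((\<Sum>n. x n (y n)) - (\<Sum>v\<in>V. \<phi> v (T (b v)))) \<le> e / 2"
      by (rule nuclear_trace_approx[OF p rep _ e2, where 'v = "complex list"], erule T, rule that)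
    obtain K' d' where K': "0 < d'"
      "\<And>V (\<phi> :: complex list \<Rightarrow> ('a \<Rightarrow> complex) \<Rightarrow> complex) b.
       finite_rank_contraction p M V \<phi> b \<Longrightarrow>
       \<forall>n<K'. Lp_norm p M (\<lambda>w. y' n w - (\<Sum>v\<in>V. \<phi> v (y' n) * b v w)) \<le> d' \<Longrightarrow>
       cmod ((\<Sum>n. x' n (y' n)) - (\<Sum>v\<in>V. \<phi> v (T (b v)))) \<le> e / 2"
      by (rule nuclear_trace_approx[OF p rep' _ e2, where 'v = "complex list"], erule T, rule that)
    \<comment> \<open>Interleaving the two sequences makes one contraction close to the identity on
      \<open>y n\<close> for n < K and on \<open>y' n\<close> for n < K'; the positions 2n and 2n +
      1 stay below 2 (K + K').\<close>
    define z where "z n = (if even n then y (n div 2) else y' (n div 2))" for n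
    have z: "z n \<in> Lp_space p M" for n using y by (simp add: z_def)
    have d: "0 < min d d'" using K(1) K'(1) by simp
    obtain V and \<phi> :: "complex list \<Rightarrow> ('a \<Rightarrow> complex) \<Rightarrow> complex" and b where V:
      "finite_rank_contraction p M V \<phi> b"
      and close: "\<And>n. n < 2 * (K + K') \<Longrightarrow> Lp_norm p M (\<lambda>w. z n w - (\<Sum>v\<in>V. \<phi> v (z n) * b v w)) \<le> min d d'"
      by (rule Lp_metric_approximation[OF p _ d, of z "2 * (K + K')"], rule z, rule that)
    have "cmod ((\<Sum>n. x n (y n)) - (\<Sum>v\<in>V. \<phi> v (T (b v)))) \<le> e / 2"
    proof (rule K(2)[OF V], intro allI impI)
      fix n assume "n < K"
      then show "Lp_norm p M (\<lambda>w. y n w - (\<Sum>v\<in>V. \<phi> v (y n) * b v w)) \<le> d"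
        using close[of "2 * n"] by (simp add: z_def)
    qed
    moreover have "cmod ((\<Sum>n. x' n (y' n)) - (\<Sum>v\<in>V. \<phi> v (T (b v)))) \<le> e / 2"
    proof (rule K'(2)[OF V], intro allI impI)
      fix n assume "n < K'"
      then show "Lp_norm p M (\<lambda>w. y' n w - (\<Sum>v\<in>V. \<phi> v (y' n) * b v w)) \<le> d'"
        using close[of "2 * n + 1"] by (simp add: z_def)
    qed
    ultimately show ?thesis
      using norm_triangle_ineq4[of "(\<Sum>n. x n (y n)) - (\<Sum>v\<in>V. \<phi> v (T (b v)))"
          "(\<Sum>n. x' n (y' n)) - (\<Sum>v\<in>V. \<phi> v (T (b v)))"] by simp
  qed
  then have "cmod ((\<Sum>n. x n (y n)) - (\<Sum>n. x' n (y' n))) \<le> 0"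
    by (rule field_le_epsilon) simp
  moreover have "summable (\<lambda>n. x' n (y' n))"
    by (rule summable_norm_cancel, rule nuclear_pairing_summable[OF p rep' y(2), where C=1]) simp
  ultimately show ?thesis by (simp add: sums_iff)
qed

end

section \<open>Continuous functions on a compact group\<close>

lemma compact_Urysohn:
  fixes S T :: "'g::t2_space set"
  assumes "compact (UNIV :: 'g set)" "closed S" "closed T" "S \<inter> T = {}"
  obtains f :: "'g \<Rightarrow> real" where "continuous_on UNIV f" "\<And>x. 0 \<le> f x" "\<And>x. f x \<le> 1"
    "\<And>x. x \<in> S \<Longrightarrow> f x = 0" "\<And>x. x \<in> T \<Longrightarrow> f x = 1"
proof -
  have "Hausdorff_space (euclidean :: 'g topology)"
    unfolding Hausdorff_space_def disjnt_def by simp (meson hausdorff)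
  moreover have "compact_space (euclidean :: 'g topology)"
    using assms(1) by (simp add: compact_space_def)
  ultimately have "normal_space (euclidean :: 'g topology)"
    using compact_Hausdorff_or_regular_imp_normal_space by blast
  then obtain f :: "'g \<Rightarrow> real" where f: "continuous_map euclidean (top_of_set {0..1}) f" "f ` S \<subseteq> {0}" "f ` T \<subseteq> {1}"
    using Urysohn_lemma[of euclidean S T 0 1] assms by (auto simp: disjnt_def)
  then have "continuous_on UNIV f" "\<And>x. f x \<in> {0..1}"
    by (auto simp: continuous_map_in_subtopology)
  with f show ?thesis by (intro that[of f]) auto
qed

text \<open>Every point of \<open>U\<close> lies in a basic open set whose closure stays in
  \<open>U\<close>: take one inside {f < 1/2} for a Urysohn function f that is 0 at the point and 1
  off \<open>U\<close>. The increasing closed sets provide inner regularity of open sets.\<close>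

lemma open_countable_union_closed:
  fixes U :: "'g::{t2_space, second_countable_topology} set"
  assumes "compact (UNIV :: 'g set)" "open U"
  obtains K :: "nat \<Rightarrow> 'g set" where "\<And>i. closed (K i)" "incseq K" "(\<Union>i. K i) = U"
proof -
  obtain \<B> :: "'g set set" where \<B>: "countable \<B>" "topological_basis \<B>"
    using ex_countable_basis by blast
  \<comment> \<open>The empty set is inserted so that the family is nonempty and can be enumerated
    as a range.\<close>
  define \<C> where "\<C> = insert {} {B \<in> \<B>. closure B \<subseteq> U}"
  have "countable \<C>" "\<C> \<noteq> {}" using \<B>(1) by (auto simp: \<C>_def)
  then obtain B :: "nat \<Rightarrow> 'g set" where B: "range B = \<C>" by (metis uncountable_def)
  have cov: "\<exists>i. x \<in> B i" if x: "x \<in> U" for x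
  proof -
    have cl: "closed {x}" "closed (- U)" "{x} \<inter> - U = {}" using x assms(2) by (auto simp: closed_Compl)
    obtain f :: "'g \<Rightarrow> real" where f: "continuous_on UNIV f" "\<And>y. 0 \<le> f y" "\<And>y. f y \<le> 1"
      "\<And>y. y \<in> {x} \<Longrightarrow> f y = 0" "\<And>y. y \<in> - U \<Longrightarrow> f y = 1"
      by (rule compact_Urysohn[OF assms(1) cl], rule that)
    have "open {y. f y < 1/2}" using f(1) by (intro open_Collect_less) auto
    moreover have "x \<in> {y. f y < 1/2}" using f(4) by simp
    ultimately obtain W where W: "W \<in> \<B>" "x \<in> W" "W \<subseteq> {y. f y < 1/2}"
      using topological_basisE[OF \<B>(2)] by metis
    have "closed {y. f y \<le> 1/2}" using f(1) by (intro closed_Collect_le) auto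
    then have "closure W \<subseteq> {y. f y \<le> 1/2}" using W(3) by (intro closure_minimal) auto
    also have "\<dots> \<subseteq> U" using f(5) by fastforce
    finally have "W \<in> \<C>" using W(1) by (simp add: \<C>_def)
    with B W(2) show ?thesis by (metis rangeE)
  qed
  have clB: "closure (B i) \<subseteq> U" for i
  proof -
    have "B i \<in> \<C>" using B by blast
    then show ?thesis by (auto simp: \<C>_def)
  qed
  have un: "(\<Union>n. \<Union>i\<le>n. closure (B i)) = U"
  proof (intro equalityI subsetI)
    fix x assume "x \<in> U"
    then obtain i where "x \<in> B i" using cov by blast
    then have "x \<in> closure (B i)" by (rule subsetD[OF closure_subset])
    then show "x \<in> (\<Union>n. \<Union>i\<le>n. closure (B i))" by auto
  next
    fix x assume "x \<in> (\<Union>n. \<Union>i\<le>n. closure (B i))"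
    then show "x \<in> U" using clB by auto
  qed
  show ?thesis
  proof (rule that[OF _ _ un])
    show "incseq (\<lambda>n. \<Union>i\<le>n. closure (B i))"
      unfolding incseq_def by (intro allI impI UN_mono) auto
  qed auto
qed

section \<open>Haar measure on a compact group: full support and density of continuous
  functions\<close>

locale haar_group = group G + prob_space M
  for G :: "'g::{t2_space, second_countable_topology} monoid" (structure) and M :: "'g measure" +
  assumes carrier_UNIV [simp]: "carrier G = UNIV"
    and compact_UNIV: "compact (UNIV :: 'g set)"
    and continuous_mult: "continuous_on UNIV (\<lambda>(x, y). x \<otimes> y)"
    and continuous_inv: "continuous_on UNIV (\<lambda>x. inv x)"
    and sets_M [measurable_cong]: "sets M = sets borel"
    and left_invariant: "distr M borel (\<lambda>x. g \<otimes> x) = M"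
begin

lemma space_M [simp]: "space M = UNIV"
  using sets_eq_imp_space_eq[OF sets_M] by simp

lemma cont_mult [continuous_intros]:
  fixes f g :: "'c::topological_space \<Rightarrow> 'g"
  assumes "continuous_on S f" "continuous_on S g"
  shows "continuous_on S (\<lambda>x. f x \<otimes> g x)"
  using continuous_on_compose2[OF continuous_mult continuous_on_Pair[OF assms]] by simp

lemma cont_inv [continuous_intros]:
  fixes f :: "'c::topological_space \<Rightarrow> 'g"
  assumes "continuous_on S f"
  shows "continuous_on S (\<lambda>x. inv (f x))"
  using continuous_on_compose2[OF continuous_inv assms] by simp

lemma continuous_translate:
  fixes f :: "'g \<Rightarrow> 'b::topological_space"
  assumes "continuous_on UNIV f"
  shows "continuous_on UNIV (\<lambda>x. f (g \<otimes> x))"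
  by (intro continuous_on_compose2[OF assms] continuous_intros) auto

lemma translate_measurable [measurable]: "(\<lambda>x. g \<otimes> x) \<in> measurable M borel"
  using borel_measurable_continuous_onI[of "\<lambda>x. g \<otimes> x"] cont_mult[of UNIV "\<lambda>_. g" "\<lambda>x. x"]
  by (simp add: measurable_cong_sets[OF sets_M refl])

lemma continuous_measurable:
  fixes f :: "'g \<Rightarrow> 'b::topological_space"
  assumes "continuous_on UNIV f"
  shows "f \<in> borel_measurable M"
  using borel_measurable_continuous_onI[OF assms] by (simp add: measurable_cong_sets[OF sets_M refl])

lemma continuous_bounded:
  fixes f :: "'g \<Rightarrow> 'b::real_normed_vector"
  assumes "continuous_on UNIV f"
  obtains B where "0 < B" "\<And>x. norm (f x) \<le> B"
proof -
  have "bounded (f ` UNIV)"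
    using compact_continuous_image[OF assms compact_UNIV] by (rule compact_imp_bounded)
  then show ?thesis using that unfolding bounded_pos by auto
qed

lemma continuous_integrable:
  fixes f :: "'g \<Rightarrow> 'b::{second_countable_topology, banach}"
  assumes "continuous_on UNIV f"
  shows "integrable M f"
proof -
  obtain B where "0 < B" "\<And>x. norm (f x) \<le> B" by (rule continuous_bounded[OF assms], rule that)
  then show ?thesis using continuous_measurable[OF assms] by (intro integrable_const_bound[where B=B]) auto
qed

lemma continuous_Lp:
  assumes "1 \<le> p" "continuous_on UNIV f"
  shows "f \<in> Lp_space p M"
proof -
  obtain B where "0 < B" "\<And>x. norm (f x) \<le> B" by (rule continuous_bounded[OF assms(2)], rule that)
  then show ?thesis using continuous_measurable[OF assms(2)] assms(1) by (intro bounded_in_Lp_space[where B=B]) auto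
qed

lemma integral_translate:
  fixes f :: "'g \<Rightarrow> 'b::{second_countable_topology, banach}"
  assumes "f \<in> borel_measurable borel"
  shows "(LINT x|M. f (g \<otimes> x)) = (LINT x|M. f x)"
  using integral_distr[OF translate_measurable assms, of g] by (simp add: left_invariant)

text \<open>If \<open>U\<close> were null, so would be all its translates by invariance, and by
  compactness finitely many of them cover the group, which has mass 1.\<close>

lemma emeasure_open_pos:
  assumes "open U" "x0 \<in> U"
  shows "0 < prob U"
proof (rule ccontr)
  assume "\<not> 0 < prob U"
  then have 0: "prob U = 0" by (simp add: zero_less_measure_iff)
  have U: "U \<in> sets M" using assms(1) by (simp add: sets_M)
  define V where "V g = (\<lambda>x. g \<otimes> x) -` U" for g
  have openV: "open (V g)" for g
    unfolding V_def by (rule open_vimage[OF assms(1)]) (intro continuous_intros)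
  have V0: "prob (V g) = 0" for g
  proof -
    have "prob U = measure (distr M borel (\<lambda>x. g \<otimes> x)) U" by (simp add: left_invariant)
    also have "\<dots> = prob (V g)" using assms(1) by (subst measure_distr) (auto simp: V_def)
    finally show ?thesis using 0 by simp
  qed
  have "UNIV \<subseteq> (\<Union>g\<in>UNIV. V g)"
  proof
    fix x
    \<comment> \<open>Left multiplication by \<open>x0 \<otimes> inv x\<close> carries
      \<open>x\<close> to \<open>x0\<close>.\<close>
    have "x \<in> V (x0 \<otimes> inv x)" using assms(2) by (simp add: V_def m_assoc)
    then show "x \<in> (\<Union>g\<in>UNIV. V g)" by blast
  qed
  then obtain I where I: "finite I" "UNIV \<subseteq> (\<Union>g\<in>I. V g)"
    using compactE_image[OF compact_UNIV, of UNIV V] openV by metis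
  have "prob UNIV \<le> prob (\<Union>g\<in>I. V g)"
    using I openV by (intro finite_measure_mono) (auto simp: sets_M)
  also have "\<dots> \<le> (\<Sum>g\<in>I. prob (V g))"
    using I openV by (intro finite_measure_subadditive_finite) (auto simp: sets_M)
  also have "\<dots> = 0" by (simp add: V0)
  finally show False using prob_space by simp
qed

lemma continuous_ae_zero:
  fixes f :: "'g \<Rightarrow> complex"
  assumes "continuous_on UNIV f" "AE x in M. f x = 0"
  shows "f x = 0"
proof (rule ccontr)
  assume "f x \<noteq> 0"
  have o: "open {y. f y \<noteq> 0}" using assms(1) by (intro open_Collect_neq) auto
  with \<open>f x \<noteq> 0\<close> have "0 < prob {y. f y \<noteq> 0}" by (intro emeasure_open_pos[of _ x]) auto
  moreover have "prob {y. f y \<noteq> 0} = 0"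
    using assms(2) o by (subst (asm) AE_iff_measurable[OF _ refl]) (auto simp: sets_M measure_def)
  ultimately show False by simp
qed

text \<open>Sets with this property form a Dynkin system that contains the open sets, an
  intersection-stable generator of the Borel sets. The bounds 0 and 1 on \<open>f\<close> are
  carried along because they later turn closeness in L1 into closeness in Lp.\<close>

lemma indicator_approx:
  assumes "B \<in> sets borel" "0 < e"
  shows "\<exists>f. continuous_on UNIV f \<and> (\<forall>x. 0 \<le> f x \<and> f x \<le> 1) \<and> (LINT x|M. \<bar>f x - indicator B x\<bar>) < (e::real)"
proof -
  define P where "P B \<longleftrightarrow> (\<forall>e>0. \<exists>f. continuous_on UNIV f \<and> (\<forall>x. 0 \<le> f x \<and> f x \<le> 1) \<and>
      (LINT x|M. \<bar>f x - indicator B x\<bar>) < (e::real))" for B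
  have "Int_stable {S :: 'g set. open S}" by (auto simp: Int_stable_def)
  moreover have "{S :: 'g set. open S} \<subseteq> Pow UNIV" by simp
  moreover have "B \<in> sigma_sets UNIV {S. open S}" using assms(1) by (simp add: borel_def)
  ultimately have "P B"
  proof (induction rule: sigma_sets_induct_disjoint)
    case (basic U)
    then have U: "open U" by simp
    obtain K :: "nat \<Rightarrow> 'g set" where K: "\<And>i. closed (K i)" "incseq K" "(\<Union>i. K i) = U"
      by (rule open_countable_union_closed[OF compact_UNIV U], rule that)
    show "P U"
      unfolding P_def
    proof (intro allI impI)
      fix e :: real assume e: "0 < e"
      have "(\<lambda>i. prob (K i)) \<longlonglongrightarrow> prob (\<Union>i. K i)"
        using K by (intro finite_Lim_measure_incseq) (auto simp: sets_M)
      then have "\<forall>\<^sub>F i in sequentially. prob U - e < prob (K i)"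
        using e by (intro order_tendstoD(1)) (auto simp: K)
      then obtain i where i: "prob U - e < prob (K i)" by (auto simp: eventually_sequentially)
      have KU: "K i \<subseteq> U" using K(3) by blast
      have cl: "closed (- U)" "closed (K i)" "- U \<inter> K i = {}" using U K(1) KU by (auto simp: closed_Compl)
      obtain f :: "'g \<Rightarrow> real" where f: "continuous_on UNIV f" "\<And>x. 0 \<le> f x" "\<And>x. f x \<le> 1"
        "\<And>x. x \<in> - U \<Longrightarrow> f x = 0" "\<And>x. x \<in> K i \<Longrightarrow> f x = 1"
        by (rule compact_Urysohn[OF compact_UNIV cl], rule that)
      have [measurable]: "f \<in> borel_measurable M" "U \<in> sets M" "K i \<in> sets M"
        using f(1) U K(1) by (auto simp: sets_M intro: continuous_measurable)
      have "(LINT x|M. \<bar>f x - indicator U x\<bar>) \<le> (LINT x|M. indicator (U - K i) x)"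
      proof (rule integral_mono)
        show "integrable M (\<lambda>x. \<bar>f x - indicator U x\<bar>)"
          using f(2,3) by (intro integrable_const_bound[where B=1]) (auto split: split_indicator)
        show "integrable M (indicat_real (U - K i))"
          by (intro integrable_real_indicator) (auto simp: less_top[symmetric])
        show "\<bar>f x - indicator U x\<bar> \<le> indicator (U - K i) x" for x
          using f(2,3)[of x] f(4,5)[of x] by (auto split: split_indicator)
      qed
      also have "\<dots> = prob (U - K i)" by simp
      also have "\<dots> = prob U - prob (K i)" using KU by (intro finite_measure_Diff) auto
      finally show "\<exists>f. continuous_on UNIV f \<and> (\<forall>x. 0 \<le> f x \<and> f x \<le> 1) \<and> (LINT x|M. \<bar>f x - indicator U x\<bar>) < e"
        using f i by (intro exI[of _ f]) auto
    qed
  next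
    case empty
    show "P {}" unfolding P_def by (auto intro!: exI[of _ "\<lambda>x. 0"])
  next
    case (compl A)
    show "P (UNIV - A)"
      unfolding P_def
    proof (intro allI impI)
      fix e :: real assume "0 < e"
      with compl obtain f where f: "continuous_on UNIV f" "\<forall>x. 0 \<le> f x \<and> f x \<le> 1"
        "(LINT x|M. \<bar>f x - indicator A x\<bar>) < e" unfolding P_def by blast
      have "\<bar>(1 - f x) - indicator (UNIV - A) x\<bar> = \<bar>f x - indicator A x\<bar>" for x
        by (auto split: split_indicator)
      with f show "\<exists>f. continuous_on UNIV f \<and> (\<forall>x. 0 \<le> f x \<and> f x \<le> 1) \<and> (LINT x|M. \<bar>f x - indicator (UNIV - A) x\<bar>) < e"
        by (intro exI[of _ "\<lambda>x. 1 - f x"]) (auto intro!: continuous_intros)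
    qed
  next
    case (union A)
    have [measurable]: "A i \<in> sets M" for i using union(2) by (auto simp: sets_M borel_def)
    define U where "U = (\<Union>i. A i)"
    have [measurable]: "U \<in> sets M" by (auto simp: U_def)
    have "P U"
      unfolding P_def
    proof (intro allI impI)
      fix e :: real assume e: "0 < e"
      have "incseq (\<lambda>n. \<Union>i<n. A i)" unfolding incseq_def by (intro allI impI UN_mono) auto
      then have "(\<lambda>n. prob (\<Union>i<n. A i)) \<longlonglongrightarrow> prob (\<Union>n. \<Union>i<n. A i)"
        by (intro finite_Lim_measure_incseq) auto
      moreover have "(\<Union>n. \<Union>i<n. A i) = U" by (auto simp: U_def)
      ultimately have "\<forall>\<^sub>F n in sequentially. prob U - e / 2 < prob (\<Union>i<n. A i)"
        using e by (intro order_tendstoD(1)) auto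
      then obtain n where n: "prob U - e / 2 < prob (\<Union>i<n. A i)" by (auto simp: eventually_sequentially)
      define W where "W = (\<Union>i<n. A i)"
      have W [measurable]: "W \<in> sets M" and WU: "W \<subseteq> U" by (auto simp: W_def U_def)
      \<comment> \<open>Error budget: e / 2 for cutting the union off after \<open>n\<close> sets
        and at most e / 2 for the \<open>n\<close> approximations together; n + 1 avoids a division
        by 0.\<close>
      have "\<forall>i. \<exists>f. continuous_on UNIV f \<and> (\<forall>x. 0 \<le> f x \<and> f x \<le> 1) \<and>
          (LINT x|M. \<bar>f x - indicator (A i) x\<bar>) < e / (2 * (real n + 1))"
        using union(3) e unfolding P_def by simp
      then obtain f where f: "\<And>i. continuous_on UNIV (f i)" "\<And>i x. 0 \<le> f i x" "\<And>i x. f i x \<le> 1"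
        "\<And>i. (LINT x|M. \<bar>f i x - indicator (A i) x\<bar>) < e / (2 * (real n + 1))"
        by metis
      define h where "h x = min 1 (\<Sum>i<n. f i x)" for x
      have [measurable]: "f i \<in> borel_measurable M" for i using f(1) by (rule continuous_measurable)
      have int: "integrable M (\<lambda>x. \<bar>f i x - indicator (A i) x\<bar>)" for i
      proof (rule integrable_const_bound[where B=1])
        have "\<bar>f i x - indicator (A i) x\<bar> \<le> 1" for x
          using f(2)[of i x] f(3)[of i x] by (auto split: split_indicator)
        then show "AE x in M. norm \<bar>f i x - indicator (A i) x\<bar> \<le> 1" by simp
      qed simp
      have hc: "continuous_on UNIV h" unfolding h_def using f(1) by (intro continuous_intros)
      have h01: "0 \<le> h x" "h x \<le> 1" for x using f(2) by (auto simp: h_def sum_nonneg)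
      have [measurable]: "h \<in> borel_measurable M" using hc by (rule continuous_measurable)
      \<comment> \<open>Truncation at 1 does not increase distances, so writing the indicator in the
        same truncated form as \<open>h\<close> reduces their difference to the differences of the
        summands.\<close>
      have indW: "indicator W x = min 1 (\<Sum>i<n. indicat_real (A i) x)" for x
      proof (cases "x \<in> W")
        case True
        then obtain i where i: "i < n" "x \<in> A i" by (auto simp: W_def)
        then have "1 \<le> (\<Sum>i<n. indicat_real (A i) x)"
          using member_le_sum[of i "{..<n}" "\<lambda>i. indicat_real (A i) x"] by simp
        with True show ?thesis by simp
      next
        case False
        then have "(\<Sum>i<n. indicat_real (A i) x) = 0" by (intro sum.neutral) (auto simp: W_def)
        with False show ?thesis by simp
      qed
      have "(LINT x|M. \<bar>h x - indicator U x\<bar>)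
          \<le> (LINT x|M. (\<Sum>i<n. \<bar>f i x - indicator (A i) x\<bar>) + indicator (U - W) x)"
      proof (rule integral_mono)
        show "integrable M (\<lambda>x. \<bar>h x - indicator U x\<bar>)"
          using h01 by (intro integrable_const_bound[where B=1]) (auto split: split_indicator)
        show "integrable M (\<lambda>x. (\<Sum>i<n. \<bar>f i x - indicator (A i) x\<bar>) + indicat_real (U - W) x)"
          using int by (intro Bochner_Integration.integrable_add Bochner_Integration.integrable_sum integrable_real_indicator)
            (auto simp: less_top[symmetric])
        fix x
        have "\<bar>h x - indicator W x\<bar> \<le> \<bar>(\<Sum>i<n. f i x) - (\<Sum>i<n. indicat_real (A i) x)\<bar>"
          unfolding indW h_def by linarith
        also have "\<dots> \<le> (\<Sum>i<n. \<bar>f i x - indicator (A i) x\<bar>)"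
          unfolding sum_subtractf[symmetric] by (rule sum_abs)
        finally have "\<bar>h x - indicator W x\<bar> \<le> (\<Sum>i<n. \<bar>f i x - indicator (A i) x\<bar>)" .
        moreover have "\<bar>indicator W x - indicat_real U x\<bar> = indicator (U - W) x"
          using WU by (auto split: split_indicator)
        ultimately show "\<bar>h x - indicator U x\<bar> \<le> (\<Sum>i<n. \<bar>f i x - indicator (A i) x\<bar>) + indicator (U - W) x"
          by linarith
      qed
      also have "\<dots> = (\<Sum>i<n. (LINT x|M. \<bar>f i x - indicator (A i) x\<bar>)) + prob (U - W)"
        using int by (subst Bochner_Integration.integral_add)
          (auto intro!: Bochner_Integration.integrable_sum integrable_real_indicator simp: less_top[symmetric])
      also have "\<dots> \<le> (\<Sum>i<n. e / (2 * (real n + 1))) + prob (U - W)"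
        using f(4) by (intro add_right_mono sum_mono) (simp add: less_imp_le)
      also have "prob (U - W) = prob U - prob W" using WU by (intro finite_measure_Diff) auto
      also have "(\<Sum>i<n. e / (2 * (real n + 1))) \<le> e / 2"
        using e by (simp add: field_simps)
      finally have "(LINT x|M. \<bar>h x - indicator U x\<bar>) < e" using n unfolding W_def by linarith
      with hc h01 show "\<exists>f. continuous_on UNIV f \<and> (\<forall>x. 0 \<le> f x \<and> f x \<le> 1) \<and> (LINT x|M. \<bar>f x - indicator U x\<bar>) < e"
        by blast
    qed
    then show "P (\<Union>i. A i)" by (simp add: U_def)
  qed
  with assms(2) show ?thesis by (simp add: P_def)
qed

lemma continuous_dense_Lp:
  assumes p: "1 \<le> p" and f: "f \<in> Lp_space p M" and e: "0 < e"
  obtains h where "continuous_on UNIV h" "Lp_norm p M (\<lambda>x. f x - h x) < e"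
proof -
  obtain s where s: "simple_function M s" "s \<in> Lp_space p M" "Lp_norm p M (\<lambda>x. f x - s x) < e / 2"
    using simple_approx_Lp[OF p f, of "e / 2"] e by auto
  define V where "V = s ` space M"
  define B where "B v = s -` {v} \<inter> space M" for v
  have V: "finite V" and B [measurable]: "B v \<in> sets M" for v
    unfolding V_def B_def using simple_functionD[OF s(1)] by blast+
  define D where "D = (\<Sum>v\<in>V. cmod v) + 1"
  have D: "0 < D" unfolding D_def by (intro add_nonneg_pos sum_nonneg) auto
  \<comment> \<open>Since |g - 1_B| is at most 1, its p-th power is at most |g - 1_B| itself. An L1
    error below this bound is therefore an Lp error of at most e / (2 D), and \<open>D\<close>
    dominates the sum of the |v| with which these errors are weighted.\<close>
  define \<delta> where "\<delta> = (e / (2 * D)) powr p"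
  have "\<delta> > 0" using e D by (simp add: \<delta>_def)
  then have "\<forall>v. \<exists>g. continuous_on UNIV g \<and> (\<forall>x. 0 \<le> g x \<and> g x \<le> 1) \<and> (LINT x|M. \<bar>g x - indicator (B v) x\<bar>) < \<delta>"
    using indicator_approx B sets_M by blast
  then obtain g where g: "\<And>v. continuous_on UNIV (g v)" "\<And>v x. 0 \<le> g v x" "\<And>v x. g v x \<le> 1"
    "\<And>v. (LINT x|M. \<bar>g v x - indicator (B v) x\<bar>) < \<delta>"
    by metis
  have [measurable]: "g v \<in> borel_measurable M" for v using g(1) by (rule continuous_measurable)
  define h where "h x = (\<Sum>v\<in>V. v * complex_of_real (g v x))" for x
  have hc: "continuous_on UNIV h" unfolding h_def using g(1) by (intro continuous_intros)
  have diff_Lp: "(\<lambda>x. complex_of_real (indicator (B v) x - g v x)) \<in> Lp_space p M" for v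
  proof (rule bounded_in_Lp_space[where B=1])
    show "cmod (complex_of_real (indicator (B v) x - g v x)) \<le> 1" for x
      unfolding norm_of_real using g(2)[of v x] g(3)[of v x] by (auto split: split_indicator)
  qed (use p in simp_all)
  have small: "Lp_norm p M (\<lambda>x. complex_of_real (indicator (B v) x - g v x)) \<le> e / (2 * D)" for v
  proof (subst Lp_norm_le_iff[OF p])
    have ab: "\<bar>g v x - indicator (B v) x\<bar> \<le> 1" for x
      using g(2)[of v x] g(3)[of v x] by (auto split: split_indicator)
    have "(LINT x|M. cmod (complex_of_real (indicator (B v) x - g v x)) powr p)
        \<le> (LINT x|M. \<bar>g v x - indicator (B v) x\<bar>)"
    proof (rule integral_mono)
      show "integrable M (\<lambda>x. cmod (complex_of_real (indicator (B v) x - g v x)) powr p)"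
        using Lp_spaceD(2)[OF diff_Lp] .
      show "integrable M (\<lambda>x. \<bar>g v x - indicator (B v) x\<bar>)"
        using ab by (intro integrable_const_bound[where B=1]) auto
      fix x
      have "cmod (complex_of_real (indicator (B v) x - g v x)) = \<bar>g v x - indicator (B v) x\<bar>"
        by (simp only: norm_of_real abs_minus_commute)
      moreover have "\<bar>g v x - indicator (B v) x\<bar> powr p \<le> \<bar>g v x - indicator (B v) x\<bar>"
        using ab[of x] p powr_mono'[of 1 p "\<bar>g v x - indicator (B v) x\<bar>"]
        by (cases "\<bar>g v x - indicator (B v) x\<bar> = 0") auto
      ultimately show "cmod (complex_of_real (indicator (B v) x - g v x)) powr p \<le> \<bar>g v x - indicator (B v) x\<bar>"
        by simp
    qed
    also have "\<dots> \<le> \<delta>" using g(4) by (rule less_imp_le)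
    finally show "(LINT x|M. cmod (complex_of_real (indicator (B v) x - g v x)) powr p) \<le> (e / (2 * D)) powr p"
      by (simp add: \<delta>_def)
  qed (use e D in auto)
  have eq: "s x - h x = (\<Sum>v\<in>V. v * complex_of_real (indicator (B v) x - g v x))" for x
  proof -
    have "(\<Sum>v\<in>V. v * complex_of_real (indicator (B v) x)) = (\<Sum>v\<in>V. v * indicator (B v) x)"
      by (intro sum.cong) (auto split: split_indicator)
    also have "\<dots> = s x" unfolding V_def B_def using V by (intro sum_fibre_indicator) (auto simp: V_def)
    finally show ?thesis by (simp add: h_def algebra_simps sum_subtractf)
  qed
  have "Lp_norm p M (\<lambda>x. s x - h x) \<le> (\<Sum>v\<in>V. Lp_norm p M (\<lambda>x. v * complex_of_real (indicator (B v) x - g v x)))"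
    unfolding eq by (intro Lp_norm_sum p Lp_space_scale diff_Lp)
  also have "\<dots> \<le> (\<Sum>v\<in>V. cmod v * (e / (2 * D)))"
    unfolding Lp_norm_scale[OF p] by (intro sum_mono mult_left_mono small) auto
  also have "\<dots> = (\<Sum>v\<in>V. cmod v) * (e / (2 * D))" by (rule sum_distrib_right[symmetric])
  also have "\<dots> \<le> D * (e / (2 * D))" using D e by (intro mult_right_mono) (auto simp: D_def)
  also have "\<dots> = e / 2" using D by simp
  finally have "Lp_norm p M (\<lambda>x. f x - h x) < e"
    using Lp_norm_triangle_diff[OF p f s(2) continuous_Lp[OF p hc]] s(3) by linarith
  with hc that show ?thesis by blast
qed

end

section \<open>Convolution operators\<close>

text \<open>Arzela-Ascoli without a metric on the domain: a diagonal subsequence converges on a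
  countable dense set, and equicontinuity carries this to a finite cover, which makes the
  subsequence uniformly Cauchy.\<close>

lemma equicontinuous_subsequence:
  fixes F :: "nat \<Rightarrow> 'g::second_countable_topology \<Rightarrow> complex"
  assumes compact: "compact (UNIV :: 'g set)" and bound: "\<And>n x. cmod (F n x) \<le> B"
    and cont: "\<And>n. continuous_on UNIV (F n)"
    and equi: "\<And>x e. 0 < e \<Longrightarrow> \<exists>U. open U \<and> x \<in> U \<and> (\<forall>y\<in>U. \<forall>n. cmod (F n y - F n x) \<le> e)"
  obtains r h where "strict_mono r" "continuous_on UNIV h" "uniform_limit UNIV (\<lambda>n. F (r n)) h sequentially"
proof -
  obtain D :: "'g set" where D: "countable D" "\<And>X. open X \<Longrightarrow> X \<noteq> {} \<Longrightarrow> \<exists>d\<in>D. d \<in> X"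
    using countable_dense_exists by blast
  obtain r where r: "strict_mono r" "\<And>x. x \<in> D \<Longrightarrow> \<exists>l. (\<lambda>n. F (r n) x) \<longlonglongrightarrow> l"
    by (rule function_convergent_subsequence[OF D(1) bound], rule that)
  have "uniformly_Cauchy_on UNIV (\<lambda>n. F (r n))"
    unfolding uniformly_Cauchy_on_def
  proof (intro allI impI)
    fix e :: real assume e: "0 < e"
    then have "0 < e / 6" by simp
    then have "\<forall>x. \<exists>U. open U \<and> x \<in> U \<and> (\<forall>y\<in>U. \<forall>n. cmod (F n y - F n x) \<le> e / 6)"
      by (intro allI equi)
    then obtain U where U: "\<And>x. open (U x)" "\<And>x. x \<in> U x" "\<And>x y n. y \<in> U x \<Longrightarrow> cmod (F n y - F n x) \<le> e / 6"
      by metis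
    have cov: "UNIV \<subseteq> (\<Union>x\<in>UNIV. U x)" using U(2) by blast
    obtain I where I: "finite I" "UNIV \<subseteq> (\<Union>x\<in>I. U x)"
      using compactE_image[OF compact U(1) cov] by metis
    have "\<forall>x. \<exists>d\<in>D. d \<in> U x"
    proof
      fix x
      show "\<exists>d\<in>D. d \<in> U x" using U(2)[of x] by (intro D(2) U(1)) auto
    qed
    then obtain d where d: "\<And>x. d x \<in> D" "\<And>x. d x \<in> U x" by metis
    have "\<forall>x. \<exists>N. \<forall>m\<ge>N. \<forall>n\<ge>N. cmod (F (r m) (d x) - F (r n) (d x)) < e / 6"
    proof
      fix x
      have "Cauchy (\<lambda>n. F (r n) (d x))" using r(2)[OF d(1)] by (auto intro: LIMSEQ_imp_Cauchy)
      then show "\<exists>N. \<forall>m\<ge>N. \<forall>n\<ge>N. cmod (F (r m) (d x) - F (r n) (d x)) < e / 6"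
        unfolding Cauchy_def dist_norm using \<open>0 < e / 6\<close> by blast
    qed
    then obtain N where N: "\<And>x m n. N x \<le> m \<Longrightarrow> N x \<le> n \<Longrightarrow> cmod (F (r m) (d x) - F (r n) (d x)) < e / 6"
      by metis
    show "\<exists>K. \<forall>x\<in>UNIV. \<forall>m\<ge>K. \<forall>n\<ge>K. dist (F (r m) x) (F (r n) x) < e"
    proof (intro exI ballI allI impI)
      fix y m n assume mn: "Max (N ` I) \<le> m" "Max (N ` I) \<le> n"
      obtain x where x: "x \<in> I" "y \<in> U x" using I(2) by blast
      have "N x \<le> m" "N x \<le> n" using mn x(1) I(1) by (meson Max_ge finite_imageI image_eqI order_trans)+
      then have 1: "cmod (F (r m) (d x) - F (r n) (d x)) < e / 6" by (rule N)
      \<comment> \<open>Both \<open>y\<close> and the dense point \<open>d x\<close> lie in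
        \<open>U x\<close>, so the distance is at most twice e / 6. The total is e / 3 + e / 6 + e /
        3 < e.\<close>
      have 2: "cmod (F (r k) y - F (r k) (d x)) \<le> e / 3" for k
        using U(3)[OF x(2), of "r k"] U(3)[OF d(2)[of x], of "r k"]
          norm_triangle_ineq4[of "F (r k) y - F (r k) x" "F (r k) (d x) - F (r k) x"] by simp
      have "F (r m) y - F (r n) y = (F (r m) y - F (r m) (d x)) + (F (r m) (d x) - F (r n) (d x))
          + - (F (r n) y - F (r n) (d x))" by simp
      also have "cmod \<dots> \<le> cmod (F (r m) y - F (r m) (d x)) + cmod (F (r m) (d x) - F (r n) (d x))
          + cmod (- (F (r n) y - F (r n) (d x)))"
        by (intro order_trans[OF norm_triangle_ineq] add_right_mono norm_triangle_ineq)
      also have "\<dots> < e" using 1 2[of m] 2[of n] e unfolding norm_minus_cancel by linarith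
      finally show "dist (F (r m) y) (F (r n) y) < e" by (simp add: dist_norm)
    qed
  qed
  then obtain h where h: "uniform_limit UNIV (\<lambda>n. F (r n)) h sequentially"
    using Cauchy_uniformly_convergent unfolding uniformly_convergent_on_def by blast
  then have "continuous_on UNIV h" using cont by (intro uniform_limit_theorem[OF _ h]) auto
  with r(1) h that show ?thesis by blast
qed

section \<open>The L2 inner product of continuous functions\<close>

context haar_group
begin

definition L2_inner :: "('g \<Rightarrow> complex) \<Rightarrow> ('g \<Rightarrow> complex) \<Rightarrow> complex" where
  "L2_inner f g = (LINT x|M. f x * cnj (g x))"

abbreviation L2_norm :: "('g \<Rightarrow> complex) \<Rightarrow> real" where
  "L2_norm f \<equiv> Lp_norm 2 M f"

lemma L2_integrable:
  fixes f g :: "'g \<Rightarrow> complex"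
  assumes "continuous_on UNIV f" "continuous_on UNIV g"
  shows "integrable M (\<lambda>x. f x * cnj (g x))"
  using assms by (intro continuous_integrable continuous_intros)

lemma L2_inner_add_left:
  assumes "continuous_on UNIV f" "continuous_on UNIV g" "continuous_on UNIV h"
  shows "L2_inner (\<lambda>x. f x + g x) h = L2_inner f h + L2_inner g h"
  using L2_integrable[OF assms(1,3)] L2_integrable[OF assms(2,3)]
  by (simp add: L2_inner_def distrib_right)

lemma L2_inner_scale_left: "L2_inner (\<lambda>x. a * f x) h = a * L2_inner f h"
  by (simp add: L2_inner_def mult.assoc)

lemma L2_inner_scale_right: "L2_inner f (\<lambda>x. a * h x) = cnj a * L2_inner f h"
  by (simp add: L2_inner_def mult.left_commute)

lemma L2_inner_diff_left:
  assumes "continuous_on UNIV f" "continuous_on UNIV g" "continuous_on UNIV h"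
  shows "L2_inner (\<lambda>x. f x - g x) h = L2_inner f h - L2_inner g h"
  using L2_integrable[OF assms(1,3)] L2_integrable[OF assms(2,3)]
  by (simp add: L2_inner_def left_diff_distrib)

lemma L2_inner_cnj: "cnj (L2_inner f g) = L2_inner g f"
  unfolding L2_inner_def by (subst Bochner_Integration.integral_cnj[symmetric]) (simp add: mult.commute)

lemma L2_inner_add_right:
  assumes "continuous_on UNIV f" "continuous_on UNIV g" "continuous_on UNIV h"
  shows "L2_inner h (\<lambda>x. f x + g x) = L2_inner h f + L2_inner h g"
  using L2_inner_add_left[OF assms] by (metis L2_inner_cnj complex_cnj_add)

lemma L2_inner_zero_left [simp]: "L2_inner (\<lambda>x. 0) h = 0"
  by (simp add: L2_inner_def)

lemma L2_inner_zero_right [simp]: "L2_inner h (\<lambda>x. 0) = 0"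
  by (simp add: L2_inner_def)

lemma L2_inner_sum_left:
  assumes "\<And>i. i \<in> I \<Longrightarrow> continuous_on UNIV (f i)" "continuous_on UNIV h"
  shows "L2_inner (\<lambda>x. \<Sum>i\<in>I. a i * f i x) h = (\<Sum>i\<in>I. a i * L2_inner (f i) h)"
  using assms
proof (induction I rule: infinite_finite_induct)
  case (insert i I)
  have "L2_inner (\<lambda>x. a i * f i x + (\<Sum>i\<in>I. a i * f i x)) h =
      L2_inner (\<lambda>x. a i * f i x) h + L2_inner (\<lambda>x. \<Sum>i\<in>I. a i * f i x) h"
    using insert by (intro L2_inner_add_left continuous_intros) auto
  with insert show ?case by (simp add: L2_inner_scale_left)
qed auto

lemma L2_inner_sum_right:
  assumes "\<And>i. i \<in> I \<Longrightarrow> continuous_on UNIV (f i)" "continuous_on UNIV h"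
  shows "L2_inner h (\<lambda>x. \<Sum>i\<in>I. a i * f i x) = (\<Sum>i\<in>I. cnj (a i) * L2_inner h (f i))"
  using arg_cong[where f=cnj, OF L2_inner_sum_left[where I=I and f=f and h=h and a=a, OF assms]]
  by (simp add: L2_inner_cnj)

lemma L2_norm_sq: "(L2_norm f)\<^sup>2 = (LINT x|M. (cmod (f x))\<^sup>2)"
  using Lp_norm_powr[of 2 M f] by (simp add: powr_numeral)

lemma L2_inner_self: "L2_inner f f = complex_of_real ((L2_norm f)\<^sup>2)"
  by (simp add: L2_norm_sq L2_inner_def complex_norm_square[symmetric] flip: integral_complex_of_real of_real_power)

lemma L2_norm_cnj: "L2_norm (\<lambda>x. cnj (f x)) = L2_norm f"
  by (simp add: Lp_norm_def)

lemma L2_cauchy_schwarz: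
  assumes "f \<in> Lp_space 2 M" "g \<in> Lp_space 2 M"
  shows "cmod (L2_inner f g) \<le> L2_norm f * L2_norm g"
proof -
  have g: "(\<lambda>x. cnj (g x)) \<in> Lp_space 2 M"
    using assms(2) borel_measurable_continuous_on[of cnj g M] by (auto simp: Lp_space_def intro: continuous_intros)
  have "cmod (L2_inner f g) \<le> (LINT x|M. cmod (f x * cnj (g x)))"
    unfolding L2_inner_def by (rule integral_norm_bound)
  also have "\<dots> \<le> L2_norm f * L2_norm (\<lambda>x. cnj (g x))"
    by (rule Holder(2)[OF _ _ _ assms(1) g]) auto
  finally show ?thesis by (simp add: L2_norm_cnj)
qed

lemma L2_norm_zero:
  assumes "continuous_on UNIV f" "L2_norm f = 0"
  shows "f x = 0"
  by (rule continuous_ae_zero[OF assms(1) Lp_norm_eq_0_AE[OF _ continuous_Lp[OF _ assms(1)] assms(2)]]) auto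

lemma L2_norm_diff_sq:
  assumes "continuous_on UNIV f" "continuous_on UNIV g"
  shows "(L2_norm (\<lambda>x. f x - g x))\<^sup>2 = (L2_norm f)\<^sup>2 - 2 * Re (L2_inner f g) + (L2_norm g)\<^sup>2"
proof -
  define w where "w x = f x * cnj (g x)" for x
  have eq: "(cmod (f x - g x))\<^sup>2 = (cmod (f x))\<^sup>2 - 2 * Re (w x) + (cmod (g x))\<^sup>2" for x
    unfolding cmod_power2 w_def by (simp add: power2_eq_square algebra_simps)
  have "integrable M (\<lambda>x. (cmod (f x))\<^sup>2)" "integrable M (\<lambda>x. (cmod (g x))\<^sup>2)"
    by (intro continuous_integrable continuous_intros assms)+
  moreover have "integrable M w" unfolding w_def by (rule L2_integrable[OF assms])
  moreover have "L2_inner f g = (LINT x|M. w x)" by (simp add: L2_inner_def w_def)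
  ultimately show ?thesis unfolding L2_norm_sq eq by simp
qed

lemma L2_inner_translate:
  assumes "continuous_on UNIV f" "continuous_on UNIV h"
  shows "L2_inner (\<lambda>x. f (g \<otimes> x)) (\<lambda>x. h (g \<otimes> x)) = L2_inner f h"
  unfolding L2_inner_def
  by (rule integral_translate, rule borel_measurable_continuous_onI) (intro continuous_intros assms)

text \<open>The kernel \<open>\<phi> (inv x \<otimes> y)\<close> does not change when
  \<open>x\<close> and \<open>y\<close> are multiplied by the same element from the left. The
  operator therefore commutes with left translations, and its eigenspaces are
  left-invariant.\<close>

definition conv :: "('g \<Rightarrow> real) \<Rightarrow> ('g \<Rightarrow> complex) \<Rightarrow> 'g \<Rightarrow> complex" where
  "conv \<phi> f x = (LINT y|M. complex_of_real (\<phi> (inv x \<otimes> y)) * f y)"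

lemma conv_eq_inner: "conv \<phi> f x = L2_inner f (\<lambda>y. complex_of_real (\<phi> (inv x \<otimes> y)))"
  by (simp add: conv_def L2_inner_def mult.commute)

lemma conv_alt:
  assumes "continuous_on UNIV \<phi>" "continuous_on UNIV f"
  shows "conv \<phi> f x = (LINT y|M. complex_of_real (\<phi> y) * f (x \<otimes> y))"
proof -
  have "continuous_on UNIV (\<lambda>y. complex_of_real (\<phi> (inv x \<otimes> y)) * f y)"
    by (intro continuous_intros continuous_translate assms)
  from integral_translate[OF borel_measurable_continuous_onI[OF this], of x]
  show ?thesis by (simp add: conv_def m_assoc[symmetric])
qed

end

section \<open>Convolution with a symmetric kernel as a compact self-adjoint operator\<close>

locale conv_kernel = haar_group +
  fixes \<phi> :: "'a \<Rightarrow> real"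
  assumes kernel_cont: "continuous_on UNIV \<phi>"
    and kernel_sym: "\<phi> (inv x) = \<phi> x"
begin

lemma kernel_cont2: "continuous_on UNIV (\<lambda>(x, y). complex_of_real (\<phi> (inv x \<otimes> y)))"
  unfolding case_prod_beta
  by (intro continuous_intros continuous_on_compose2[OF kernel_cont]) auto

lemma kernel_cont_right: "continuous_on UNIV (\<lambda>y. complex_of_real (\<phi> (inv x \<otimes> y)))"
  by (intro continuous_intros continuous_translate kernel_cont)

text \<open>Cauchy-Schwarz against a bounded kernel: convolution turns L2 bounds into uniform
  bounds, which is how limits are recovered without completing the space.\<close>

lemma conv_bounded:
  obtains B where "0 < B" "\<And>f x. continuous_on UNIV f \<Longrightarrow> cmod (conv \<phi> f x) \<le> B * L2_norm f"
proof -
  obtain B where B: "0 < B" "\<And>x. norm (\<phi> x) \<le> B" by (rule continuous_bounded[OF kernel_cont], rule that)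
  show ?thesis
  proof (rule that[OF B(1)])
    fix f :: "'a \<Rightarrow> complex" and x assume f: "continuous_on UNIV f"
    have "cmod (conv \<phi> f x) \<le> L2_norm f * L2_norm (\<lambda>y. complex_of_real (\<phi> (inv x \<otimes> y)))"
      unfolding conv_eq_inner by (intro L2_cauchy_schwarz continuous_Lp f kernel_cont_right) auto
    also have "\<dots> \<le> L2_norm f * B"
      using B by (intro mult_left_mono Lp_norm_bounded) auto
    finally show "cmod (conv \<phi> f x) \<le> B * L2_norm f" by (simp add: mult.commute)
  qed
qed

text \<open>By compactness the kernel is continuous in \<open>x\<close> uniformly in
  \<open>y\<close>, so the neighbourhood does not depend on \<open>f\<close>. Images of an
  L2-bounded sequence are thus equicontinuous.\<close>

lemma conv_equicontinuous:
  assumes "0 < e"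
  obtains U where "open U" "x0 \<in> U"
    "\<And>x f. x \<in> U \<Longrightarrow> continuous_on UNIV f \<Longrightarrow> cmod (conv \<phi> f x - conv \<phi> f x0) \<le> e * L2_norm f"
proof -
  let ?k = "\<lambda>x y. complex_of_real (\<phi> (inv x \<otimes> y))"
  have "continuous_on (UNIV \<times> UNIV) (\<lambda>(x, y). ?k x y)" using kernel_cont2 by simp
  then obtain U where U: "x0 \<in> U" "open U" "\<forall>x\<in>U \<inter> UNIV. \<forall>t\<in>UNIV. dist ((\<lambda>(x, y). ?k x y) (x, t)) ((\<lambda>(x, y). ?k x y) (x0, t)) \<le> e"
    by (rule continuous_on_prod_compactE[OF _ compact_UNIV UNIV_I[of x0] assms]) (rule that)
  show ?thesis
  proof (rule that[OF U(2,1)])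
    fix x and f :: "'a \<Rightarrow> complex" assume x: "x \<in> U" and f: "continuous_on UNIV f"
    have "conv \<phi> f x - conv \<phi> f x0 = (LINT y|M. f y * cnj (?k x y)) - (LINT y|M. f y * cnj (?k x0 y))"
      by (simp add: conv_eq_inner L2_inner_def)
    also have "\<dots> = (LINT y|M. f y * cnj (?k x y) - f y * cnj (?k x0 y))"
      by (intro Bochner_Integration.integral_diff[symmetric] L2_integrable f kernel_cont_right)
    also have "\<dots> = L2_inner f (\<lambda>y. ?k x y - ?k x0 y)"
      by (simp add: L2_inner_def right_diff_distrib)
    also have "cmod \<dots> \<le> L2_norm f * L2_norm (\<lambda>y. ?k x y - ?k x0 y)"
      by (intro L2_cauchy_schwarz continuous_Lp f continuous_intros kernel_cont_right[simplified]) auto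
    also have "\<dots> \<le> L2_norm f * e"
      using U(3) x assms by (intro mult_left_mono Lp_norm_bounded) (auto simp: dist_norm)
    finally show "cmod (conv \<phi> f x - conv \<phi> f x0) \<le> e * L2_norm f" by (simp add: mult.commute)
  qed
qed

lemma conv_cont:
  assumes "continuous_on UNIV f"
  shows "continuous_on UNIV (conv \<phi> f)"
  unfolding continuous_on_def
proof (intro ballI tendstoI)
  fix x0 and e :: real assume e: "0 < e"
  define d where "d = e / (2 * (L2_norm f + 1))"
  have d: "0 < d" using e Lp_norm_nonneg[of 2 M f] by (simp add: d_def add_nonneg_pos)
  obtain U where U: "open U" "x0 \<in> U"
    "\<And>x f. x \<in> U \<Longrightarrow> continuous_on UNIV f \<Longrightarrow> cmod (conv \<phi> f x - conv \<phi> f x0) \<le> d * L2_norm f"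
    by (rule conv_equicontinuous[OF d, of x0], rule that)
  have "d * L2_norm f \<le> d * (L2_norm f + 1)" using d by (intro mult_left_mono) auto
  also have "\<dots> = e / 2" using Lp_norm_nonneg[of 2 M f] unfolding d_def by (simp add: field_simps add_nonneg_eq_0_iff)
  finally have "dist (conv \<phi> f x) (conv \<phi> f x0) < e" if "x \<in> U" for x
    using U(3)[OF that assms] e unfolding dist_norm by linarith
  then show "\<forall>\<^sub>F x in at x0. dist (conv \<phi> f x) (conv \<phi> f x0) < e"
    using U(1,2) unfolding eventually_at_topological by blast
qed

lemma conv_add:
  assumes "continuous_on UNIV f" "continuous_on UNIV g"
  shows "conv \<phi> (\<lambda>y. f y + g y) x = conv \<phi> f x + conv \<phi> g x"
  unfolding conv_eq_inner using assms kernel_cont_right by (intro L2_inner_add_left)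

lemma conv_diff:
  assumes "continuous_on UNIV f" "continuous_on UNIV g"
  shows "conv \<phi> (\<lambda>y. f y - g y) x = conv \<phi> f x - conv \<phi> g x"
  unfolding conv_eq_inner using assms kernel_cont_right by (intro L2_inner_diff_left)

lemma conv_scale: "conv \<phi> (\<lambda>y. a * f y) x = a * conv \<phi> f x"
  unfolding conv_eq_inner by (rule L2_inner_scale_left)

lemma conv_translate:
  assumes "continuous_on UNIV f"
  shows "conv \<phi> (\<lambda>y. f (g \<otimes> y)) x = conv \<phi> f (g \<otimes> x)"
  using assms by (simp add: conv_alt[OF kernel_cont] continuous_translate m_assoc)

text \<open>Fubini's theorem, together with the symmetry of the real kernel in \<open>x\<close> and
  \<open>y\<close> that follows from \<open>kernel_sym\<close>.\<close>

lemma conv_symmetric: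
  assumes f: "continuous_on UNIV f" and g: "continuous_on UNIV g"
  shows "L2_inner (conv \<phi> f) g = L2_inner f (conv \<phi> g)"
proof -
  interpret P: pair_prob_space M M ..
  let ?k = "\<lambda>x y. complex_of_real (\<phi> (inv x \<otimes> y))"
  define F where "F x y = ?k x y * f y * cnj (g x)" for x y
  have Fc: "continuous_on UNIV (\<lambda>(x, y). F x y)"
    unfolding F_def case_prod_beta
    by (intro continuous_intros continuous_on_compose2[OF f] continuous_on_compose2[OF g]
        continuous_on_compose2[OF kernel_cont]) auto
  have "compact (UNIV :: ('a \<times> 'a) set)" using compact_Times[OF compact_UNIV compact_UNIV] by simp
  then have "bounded (range (\<lambda>(x, y). F x y))"
    using compact_continuous_image[OF Fc] by (intro compact_imp_bounded) simp
  then obtain B where B: "\<And>x y. cmod (F x y) \<le> B" by (auto simp: bounded_iff)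
  \<comment> \<open>By second countability the Borel sets of the product are the product
    sigma-algebra, so the continuous integrand is jointly measurable.\<close>
  have sets2: "sets (M \<Otimes>\<^sub>M M) = sets (borel :: ('a \<times> 'a) measure)"
    by (subst borel_prod[symmetric]) (intro sets_pair_measure_cong sets_M)
  have meas: "(\<lambda>(x, y). F x y) \<in> borel_measurable (M \<Otimes>\<^sub>M M)"
    by (subst measurable_cong_sets[OF sets2 refl]) (rule borel_measurable_continuous_onI[OF Fc])
  have int: "integrable (M \<Otimes>\<^sub>M M) (\<lambda>(x, y). F x y)"
    by (rule P.P.integrable_const_bound[where B=B, OF _ meas]) (simp add: case_prod_beta B)
  have sym: "?k x y = ?k y x" for x y
    using kernel_sym[of "inv x \<otimes> y"] by (simp add: inv_mult_group)
  have "L2_inner (conv \<phi> f) g = (LINT x|M. LINT y|M. F x y)"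
    by (simp add: L2_inner_def conv_def F_def)
  also have "\<dots> = (LINT y|M. LINT x|M. F x y)" by (rule P.Fubini_integral[OF int, symmetric])
  also have "\<dots> = (LINT y|M. LINT x|M. f y * cnj (?k y x * g x))"
    unfolding F_def by (subst sym) (simp add: mult_ac)
  also have "\<dots> = L2_inner f (conv \<phi> g)"
    unfolding L2_inner_def conv_def Bochner_Integration.integral_cnj[symmetric] by simp
  finally show ?thesis .
qed

lemma conv_uniform_limit:
  assumes F: "\<And>n. continuous_on UNIV (F n)" and h: "uniform_limit UNIV F h sequentially"
  shows "continuous_on UNIV h" "uniform_limit UNIV (\<lambda>n. conv \<phi> (F n)) (conv \<phi> h) sequentially"
proof -
  show hc: "continuous_on UNIV h" using F by (intro uniform_limit_theorem[OF _ h]) auto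
  obtain B where B: "0 < B" "\<And>f x. continuous_on UNIV f \<Longrightarrow> cmod (conv \<phi> f x) \<le> B * L2_norm f"
    by (rule conv_bounded, rule that)
  show "uniform_limit UNIV (\<lambda>n. conv \<phi> (F n)) (conv \<phi> h) sequentially"
  proof (rule uniform_limitI)
    fix e :: real assume e: "0 < e"
    then have "\<forall>\<^sub>F n in sequentially. \<forall>x\<in>UNIV. dist (F n x) (h x) < e / (2 * B)"
      using B(1) by (intro uniform_limitD[OF h]) auto
    then show "\<forall>\<^sub>F n in sequentially. \<forall>x\<in>UNIV. dist (conv \<phi> (F n) x) (conv \<phi> h x) < e"
    proof eventually_elim
      case (elim n)
      have "L2_norm (\<lambda>y. F n y - h y) \<le> e / (2 * B)"
        using elim e B(1) by (intro Lp_norm_bounded) (auto simp: dist_norm less_imp_le)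
      then have "B * L2_norm (\<lambda>y. F n y - h y) \<le> B * (e / (2 * B))" using B(1) by (intro mult_left_mono) auto
      also have "\<dots> = e / 2" using B(1) by simp
      finally have le: "B * L2_norm (\<lambda>y. F n y - h y) < e" using e by simp
      show ?case
      proof
        fix x
        have "cmod (conv \<phi> (\<lambda>y. F n y - h y) x) \<le> B * L2_norm (\<lambda>y. F n y - h y)"
          by (intro B continuous_intros F hc)
        then show "dist (conv \<phi> (F n) x) (conv \<phi> h x) < e"
          using le by (simp add: dist_norm conv_diff[OF F hc])
      qed
    qed
  qed
qed

end

section \<open>Finite-dimensional invariant subspaces\<close>

lemma mat_adjoint_carrier:
  fixes A :: "complex mat"
  assumes "A \<in> carrier_mat d d"
  shows "mat_adjoint A \<in> carrier_mat d d"
  using assms by (simp add: mat_adjoint_def mat_of_rows_def)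

lemma mat_adjoint_index:
  fixes A :: "complex mat"
  assumes "A \<in> carrier_mat d d" "i < d" "j < d"
  shows "mat_adjoint A $$ (i, j) = cnj (A $$ (j, i))"
  using assms by (simp add: mat_adjoint_def mat_of_rows_index)

lemma adjoint_mult_index:
  fixes A B :: "complex mat"
  assumes "A \<in> carrier_mat d d" "B \<in> carrier_mat d d" "i < d" "j < d"
  shows "(mat_adjoint A * B) $$ (i, j) = (\<Sum>k<d. cnj (A $$ (k, i)) * B $$ (k, j))"
  using assms mat_adjoint_carrier[OF assms(1)]
  by (simp add: scalar_prod_def atLeast0LessThan mat_adjoint_index[OF assms(1)])

lemma mat_mult_index:
  fixes A B :: "complex mat"
  assumes "A \<in> carrier_mat a b" "B \<in> carrier_mat b c" "i < a" "j < c"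
  shows "(A * B) $$ (i, j) = (\<Sum>k<b. A $$ (i, k) * B $$ (k, j))"
  using assms by (simp add: scalar_prod_def atLeast0LessThan)

context haar_group
begin

definition left_invariant_subspace :: "('g \<Rightarrow> complex) set \<Rightarrow> bool" where
  "left_invariant_subspace W \<longleftrightarrow> (\<forall>f\<in>W. continuous_on UNIV f) \<and> (\<lambda>x. 0) \<in> W \<and>
     (\<forall>f\<in>W. \<forall>g\<in>W. (\<lambda>x. f x + g x) \<in> W) \<and> (\<forall>a. \<forall>f\<in>W. (\<lambda>x. a * f x) \<in> W) \<and>
     (\<forall>g. \<forall>f\<in>W. (\<lambda>x. f (g \<otimes> x)) \<in> W)"

text \<open>These families take the place of a dimension: \<open>W\<close> has dimension
  \<open>n\<close> if it admits such a family of length \<open>n\<close> and none of length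
  \<open>Suc n\<close>.\<close>

definition orthonormal :: "('g \<Rightarrow> complex) set \<Rightarrow> nat \<Rightarrow> (nat \<Rightarrow> 'g \<Rightarrow> complex) \<Rightarrow> bool" where
  "orthonormal W n f \<longleftrightarrow> (\<forall>i<n. f i \<in> W) \<and>
     (\<forall>i<n. \<forall>j<n. L2_inner (f i) (f j) = (if i = j then 1 else 0))"

lemma left_invariant_subspaceD:
  assumes "left_invariant_subspace W"
  shows "f \<in> W \<Longrightarrow> continuous_on UNIV f" "(\<lambda>x. 0) \<in> W"
    "f \<in> W \<Longrightarrow> g \<in> W \<Longrightarrow> (\<lambda>x. f x + g x) \<in> W" "f \<in> W \<Longrightarrow> (\<lambda>x. a * f x) \<in> W"
    "f \<in> W \<Longrightarrow> (\<lambda>x. f (b \<otimes> x)) \<in> W"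
  using assms by (auto simp: left_invariant_subspace_def)

lemma left_invariant_subspace_sum:
  assumes W: "left_invariant_subspace W" and "\<And>i. i \<in> I \<Longrightarrow> f i \<in> W"
  shows "(\<lambda>x. \<Sum>i\<in>I. a i * f i x) \<in> W"
  using assms(2)
  by (induction I rule: infinite_finite_induct) (auto intro!: left_invariant_subspaceD(2-4)[OF W])

lemma left_invariant_subspace_diff:
  assumes W: "left_invariant_subspace W" and "f \<in> W" "g \<in> W"
  shows "(\<lambda>x. f x - g x) \<in> W"
  using left_invariant_subspaceD(3)[OF W assms(2) left_invariant_subspaceD(4)[OF W assms(3), of "-1"]]
  by simp

lemma orthonormal_mono: "orthonormal W n f \<Longrightarrow> W \<subseteq> W' \<Longrightarrow> orthonormal W' n f"
  by (auto simp: orthonormal_def)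

lemma orthonormal_coeff:
  assumes "orthonormal W n f" "left_invariant_subspace W" "j < n"
  shows "L2_inner (\<lambda>x. \<Sum>i<n. a i * f i x) (f j) = a j"
proof -
  have "L2_inner (\<lambda>x. \<Sum>i<n. a i * f i x) (f j) = (\<Sum>i<n. a i * L2_inner (f i) (f j))"
    using assms by (intro L2_inner_sum_left) (auto simp: orthonormal_def left_invariant_subspace_def)
  also have "\<dots> = (\<Sum>i<n. if i = j then a i else 0)"
    using assms by (intro sum.cong) (auto simp: orthonormal_def)
  finally show ?thesis using assms(3) by simp
qed

lemma bessel:
  assumes f: "orthonormal W n f" "left_invariant_subspace W" and h: "continuous_on UNIV h"
  shows "(\<Sum>i<n. (cmod (L2_inner h (f i)))\<^sup>2) \<le> (L2_norm h)\<^sup>2"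
proof -
  define a where "a i = L2_inner h (f i)" for i
  define s where "s x = (\<Sum>i<n. a i * f i x)" for x
  have fc: "continuous_on UNIV (f i)" if "i < n" for i
    using f that by (auto simp: orthonormal_def left_invariant_subspace_def)
  have sc: "continuous_on UNIV s" unfolding s_def by (intro continuous_intros fc) auto
  have hs: "L2_inner h s = (\<Sum>i<n. complex_of_real ((cmod (a i))\<^sup>2))"
    unfolding s_def using fc h
    by (subst L2_inner_sum_right) (auto simp: a_def[symmetric] complex_norm_square mult.commute simp del: of_real_power)
  have "L2_inner s s = (\<Sum>i<n. cnj (a i) * L2_inner s (f i))"
    unfolding s_def by (rule L2_inner_sum_right) (use fc in \<open>auto intro!: continuous_intros\<close>)
  also have "\<dots> = (\<Sum>i<n. complex_of_real ((cmod (a i))\<^sup>2))"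
    unfolding s_def using orthonormal_coeff[OF f]
    by (intro sum.cong) (auto simp: complex_norm_square mult.commute simp del: of_real_power)
  finally have "complex_of_real ((L2_norm s)\<^sup>2) = complex_of_real (\<Sum>i<n. (cmod (a i))\<^sup>2)"
    by (simp add: L2_inner_self)
  then have ss: "(L2_norm s)\<^sup>2 = (\<Sum>i<n. (cmod (a i))\<^sup>2)" using of_real_eq_iff by blast
  have "0 \<le> (L2_norm (\<lambda>x. h x - s x))\<^sup>2" by simp
  also have "\<dots> = (L2_norm h)\<^sup>2 - (\<Sum>i<n. (cmod (a i))\<^sup>2)"
    unfolding L2_norm_diff_sq[OF h sc] ss hs by (simp flip: of_real_sum del: of_real_power)
  finally show ?thesis by (simp add: a_def)
qed

lemma normalise:
  assumes W: "left_invariant_subspace W" and h: "h \<in> W" "h x \<noteq> 0"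
  obtains c where "c \<noteq> 0" "L2_inner (\<lambda>x. c * h x) (\<lambda>x. c * h x) = 1"
proof -
  have "L2_norm h \<noteq> 0" using L2_norm_zero[OF left_invariant_subspaceD(1)[OF W h(1)]] h(2) by blast
  define c where "c = complex_of_real (inverse (L2_norm h))"
  have "L2_inner (\<lambda>x. c * h x) (\<lambda>x. c * h x) = c * (cnj c * complex_of_real ((L2_norm h)\<^sup>2))"
    by (simp only: L2_inner_scale_left L2_inner_scale_right L2_inner_self)
  also have "\<dots> = 1" using \<open>L2_norm h \<noteq> 0\<close> by (simp add: c_def power2_eq_square field_simps)
  finally show ?thesis using \<open>L2_norm h \<noteq> 0\<close> by (intro that[of c]) (auto simp: c_def)
qed

text \<open>A remainder that is nonzero somewhere has positive norm, because it is continuous and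
  the measure has full support. Normalised, it would extend the family to length
  \<open>Suc n\<close>.\<close>

lemma orthonormal_expansion:
  assumes W: "left_invariant_subspace W" and f: "orthonormal W n f"
    and max: "\<And>g. \<not> orthonormal W (Suc n) g" and h: "h \<in> W"
  shows "h x = (\<Sum>i<n. L2_inner h (f i) * f i x)"
proof (rule ccontr)
  assume neq: "h x \<noteq> (\<Sum>i<n. L2_inner h (f i) * f i x)"
  define s where "s x = (\<Sum>i<n. L2_inner h (f i) * f i x)" for x
  define r where "r x = h x - s x" for x
  have sW: "s \<in> W" unfolding s_def using f by (intro left_invariant_subspace_sum[OF W]) (auto simp: orthonormal_def)
  have r: "r \<in> W" "r x \<noteq> 0" unfolding r_def using left_invariant_subspace_diff[OF W h sW] neq by (auto simp: s_def)
  obtain c where c: "c \<noteq> 0" "L2_inner (\<lambda>x. c * r x) (\<lambda>x. c * r x) = 1" by (rule normalise[OF W r], rule that)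
  have rf: "L2_inner r (f j) = 0" if "j < n" for j
  proof -
    have "L2_inner r (f j) = L2_inner h (f j) - L2_inner s (f j)"
      unfolding r_def using f W h sW that by (intro L2_inner_diff_left) (auto simp: orthonormal_def left_invariant_subspace_def)
    also have "L2_inner s (f j) = L2_inner h (f j)" unfolding s_def by (rule orthonormal_coeff[OF f W that])
    finally show ?thesis by simp
  qed
  then have fr: "L2_inner (f j) r = 0" if "j < n" for j
    using that by (metis L2_inner_cnj complex_cnj_zero)
  have "orthonormal W (Suc n) (f(n := \<lambda>x. c * r x))"
    using f c(2) left_invariant_subspaceD(4)[OF W r(1)] rf fr
    by (auto simp: orthonormal_def less_Suc_eq L2_inner_scale_left L2_inner_scale_right mult_ac)
  with max show False by blast
qed

text \<open>Descent on the dimension: \<open>m\<close> is the least bound on orthonormal families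
  that holds in some nonzero invariant subspace, and \<open>W\<close> attains it. A nonzero
  invariant part of \<open>W\<close> without a family of length \<open>m\<close> would satisfy the
  bound m - 1.\<close>

lemma minimal_subspace:
  assumes E: "left_invariant_subspace E" "e \<in> E" "e x0 \<noteq> 0"
    and bound: "\<And>n f. orthonormal E n f \<Longrightarrow> n \<le> N"
  obtains W m f where "left_invariant_subspace W" "W \<subseteq> E" "0 < m" "orthonormal W m f"
    "\<And>g. \<not> orthonormal W (Suc m) g"
    "\<And>W' w x. left_invariant_subspace W' \<Longrightarrow> W' \<subseteq> W \<Longrightarrow> w \<in> W' \<Longrightarrow> w x \<noteq> 0 \<Longrightarrow> \<exists>g. orthonormal W' m g"
proof -
  define Q where "Q n \<longleftrightarrow> (\<exists>W. left_invariant_subspace W \<and> W \<subseteq> E \<and> (\<exists>w\<in>W. \<exists>x. w x \<noteq> 0) \<and>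
      (\<forall>k f. orthonormal W k f \<longrightarrow> k \<le> n))" for n
  have "Q N" unfolding Q_def using E bound by blast
  define m where "m = (LEAST n. Q n)"
  have "Q m" unfolding m_def using \<open>Q N\<close> by (rule LeastI)
  then obtain W where W: "left_invariant_subspace W" "W \<subseteq> E" "\<exists>w\<in>W. \<exists>x. w x \<noteq> 0"
    "\<And>k f. orthonormal W k f \<Longrightarrow> k \<le> m" unfolding Q_def by blast
  have full: "\<exists>g. orthonormal W' m g" and pos: "0 < m"
    if W': "left_invariant_subspace W'" "W' \<subseteq> W" "w \<in> W'" "w x \<noteq> 0" for W' w x
  proof -
    obtain c where "c \<noteq> 0" "L2_inner (\<lambda>x. c * w x) (\<lambda>x. c * w x) = 1" by (rule normalise[OF W'(1,3,4)], rule that)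
    then have "orthonormal W' 1 (\<lambda>_ x. c * w x)"
      using left_invariant_subspaceD(4)[OF W'(1,3)] by (simp add: orthonormal_def)
    then show pos: "0 < m" using W(4)[OF orthonormal_mono[OF _ W'(2)]] by fastforce
    show "\<exists>g. orthonormal W' m g"
    proof (rule ccontr)
      assume none: "\<nexists>g. orthonormal W' m g"
      have "k \<le> m - 1" if "orthonormal W' k f" for k f
      proof -
        have "k \<le> m" using W(4)[OF orthonormal_mono[OF that W'(2)]] .
        moreover have "k \<noteq> m" using none that by blast
        ultimately show ?thesis by simp
      qed
      then have "Q (m - 1)" unfolding Q_def using W' W(2) by (intro exI[of _ W']) blast
      then have "m \<le> m - 1" unfolding m_def by (rule Least_le)
      with pos show False by simp
    qed
  qed
  obtain w x where w: "w \<in> W" "w x \<noteq> 0" using W(3) by blast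
  obtain f where "orthonormal W m f" using full[OF W(1) order_refl w] by blast
  moreover have "\<not> orthonormal W (Suc m) g" for g using W(4)[of "Suc m" g] by auto
  ultimately show ?thesis using that[OF W(1,2) pos[OF W(1) order_refl w]] full by blast
qed

text \<open>Supplies the continuity of the matrix entries of the representation constructed
  next.\<close>

lemma continuous_integral:
  fixes F :: "'g \<Rightarrow> 'g \<Rightarrow> complex"
  assumes F: "continuous_on UNIV (\<lambda>(x, y). F x y)"
  shows "continuous_on UNIV (\<lambda>x. LINT y|M. F x y)"
  unfolding continuous_on_def
proof (intro ballI tendstoI)
  fix x0 and e :: real assume e: "0 < e"
  have Fx: "continuous_on UNIV (F x)" for x
    using continuous_on_compose2[OF F, of UNIV "\<lambda>y. (x, y)"] by (simp add: continuous_on_Pair)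
  have "continuous_on (UNIV \<times> UNIV) (\<lambda>(x, y). F x y)" using F by simp
  moreover have "0 < e / 2" using e by simp
  ultimately obtain U where U: "x0 \<in> U" "open U"
    "\<forall>x\<in>U \<inter> UNIV. \<forall>t\<in>UNIV. dist ((\<lambda>(x, y). F x y) (x, t)) ((\<lambda>(x, y). F x y) (x0, t)) \<le> e / 2"
    by (rule continuous_on_prod_compactE[OF _ compact_UNIV UNIV_I[of x0]]) (rule that)
  have "dist (LINT y|M. F x y) (LINT y|M. F x0 y) < e" if "x \<in> U" for x
  proof -
    have "(LINT y|M. F x y) - (LINT y|M. F x0 y) = (LINT y|M. F x y - F x0 y)"
      by (intro Bochner_Integration.integral_diff[symmetric] continuous_integrable Fx)
    also have "cmod \<dots> \<le> (LINT y|M. cmod (F x y - F x0 y))" by (rule integral_norm_bound)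
    also have "\<dots> \<le> (LINT y|M. e / 2)"
      using U(3) that by (intro integral_mono continuous_integrable continuous_intros Fx) (auto simp: dist_norm)
    also have "\<dots> < e" using e using prob_space by simp
    finally show ?thesis by (simp add: dist_norm)
  qed
  then show "\<forall>\<^sub>F x in at x0. dist (LINT y|M. F x y) (LINT y|M. F x0 y) < e"
    using U(1,2) unfolding eventually_at_topological by blast
qed

text \<open>\<open>\<pi>\<close> is the complex conjugate of the matrix of left translation in the
  basis \<open>f\<close>. Conjugation keeps the homomorphism property, unitarity and irreducibility,
  and it makes \<open>f j\<close> a combination of entries of \<open>\<pi>\<close> itself rather
  than of their conjugates.\<close>

lemma minimal_subspace_irrep:
  assumes W: "left_invariant_subspace W" and m: "0 < m" and f: "orthonormal W m f"
    and max: "\<And>g. \<not> orthonormal W (Suc m) g"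
    and minimal: "\<And>W' w x. left_invariant_subspace W' \<Longrightarrow> W' \<subseteq> W \<Longrightarrow> w \<in> W' \<Longrightarrow> w x \<noteq> 0 \<Longrightarrow> \<exists>g. orthonormal W' m g"
  obtains \<pi> where "\<pi> \<in> irreps G" "unitary_rep G \<pi> m"
    "\<And>j x. j < m \<Longrightarrow> f j x = (\<Sum>i<m. f i \<one> * \<pi> x $$ (j, i))"
proof -
  define p where "p x i j = L2_inner (f i) (\<lambda>y. f j (inv x \<otimes> y))" for x i j
  define \<pi> where "\<pi> x = mat m m (\<lambda>(i, j). p x i j)" for x
  have \<pi>c: "\<pi> x \<in> carrier_mat m m" for x by (simp add: \<pi>_def)
  have fW: "f i \<in> W" and fc: "continuous_on UNIV (f i)" if "i < m" for i
    using f W that by (auto simp: orthonormal_def left_invariant_subspace_def)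
  have fo: "L2_inner (f i) (f j) = (if i = j then 1 else 0)" if "i < m" "j < m" for i j
    using f that by (auto simp: orthonormal_def)
  have tr: "f j (inv x \<otimes> y) = (\<Sum>k<m. cnj (p x k j) * f k y)" if "j < m" for x j y
    using orthonormal_expansion[OF W f max left_invariant_subspaceD(5)[OF W fW[OF that]], of "inv x" y]
    by (simp add: p_def L2_inner_cnj)
  have mult: "p (x \<otimes> y) i j = (\<Sum>k<m. p x i k * p y k j)" if "i < m" "j < m" for x y i j
  proof -
    have "p (x \<otimes> y) i j = L2_inner (f i) (\<lambda>z. f j (inv y \<otimes> (inv x \<otimes> z)))"
      by (simp add: p_def inv_mult_group m_assoc)
    also have "\<dots> = L2_inner (f i) (\<lambda>z. \<Sum>k<m. cnj (p y k j) * f k (inv x \<otimes> z))"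
      by (simp add: tr[OF that(2)])
    also have "\<dots> = (\<Sum>k<m. p y k j * p x i k)"
      using that fc by (subst L2_inner_sum_right) (auto simp: p_def intro: continuous_translate)
    finally show ?thesis by (simp add: mult.commute)
  qed
  have unit: "(\<Sum>k<m. cnj (p x k i) * p x k j) = (if i = j then 1 else 0)" if "i < m" "j < m" for x i j
  proof -
    have "(if i = j then 1 else 0) = L2_inner (\<lambda>y. f i (inv x \<otimes> y)) (\<lambda>y. f j (inv x \<otimes> y))"
      using that by (simp add: L2_inner_translate fc fo)
    also have "\<dots> = L2_inner (\<lambda>y. \<Sum>k<m. cnj (p x k i) * f k y) (\<lambda>y. f j (inv x \<otimes> y))"
      by (simp add: tr[OF that(1)])
    also have "\<dots> = (\<Sum>k<m. cnj (p x k i) * p x k j)"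
      using that fc by (subst L2_inner_sum_left) (auto simp: p_def intro: continuous_translate)
    finally show ?thesis by simp
  qed
  have cont: "continuous_on UNIV (\<lambda>x. p x i j)" if "i < m" "j < m" for i j
    unfolding p_def L2_inner_def
    by (rule continuous_integral, unfold case_prod_beta)
      (intro continuous_intros continuous_on_compose2[OF fc[OF that(1)]] continuous_on_compose2[OF fc[OF that(2)]]; simp)
  have rep: "unitary_rep G \<pi> m"
    unfolding unitary_rep_def
  proof (intro conjI allI impI)
    fix x
    show "\<pi> x \<in> carrier_mat m m" by (rule \<pi>c)
    show "mat_adjoint (\<pi> x) * \<pi> x = 1\<^sub>m m"
    proof (rule eq_matI)
      fix i j assume "i < dim_row (1\<^sub>m m :: complex mat)" "j < dim_col (1\<^sub>m m :: complex mat)"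
      then have ij: "i < m" "j < m" by auto
      then show "(mat_adjoint (\<pi> x) * \<pi> x) $$ (i, j) = 1\<^sub>m m $$ (i, j)"
        unfolding adjoint_mult_index[OF \<pi>c \<pi>c ij] using unit[OF ij, of x] by (simp add: \<pi>_def)
    qed (use mat_adjoint_carrier[OF \<pi>c[of x]] \<pi>c[of x] in auto)
    fix y
    show "\<pi> (x \<otimes> y) = \<pi> x * \<pi> y"
      by (intro eq_matI) (auto simp: \<pi>_def scalar_prod_def mult atLeast0LessThan)
  next
    fix i j assume "i < m" "j < m"
    then show "continuous_on UNIV (\<lambda>x. \<pi> x $$ (i, j))" using cont by (simp add: \<pi>_def)
  qed
  have irr: "U = {0\<^sub>v m} \<or> U = carrier_vec m"
    if U: "linear_subspace m U" and inv: "\<And>x u. u \<in> U \<Longrightarrow> \<pi> x *\<^sub>v u \<in> U" for U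
  proof (rule disjCI)
    assume "U \<noteq> carrier_vec m"
    \<comment> \<open>Conjugate-linear in \<open>u\<close> to undo the conjugation in
      \<open>\<pi>\<close>: applying \<open>\<pi> (inv g)\<close> to \<open>u\<close> becomes left
      translation of \<open>F u\<close> by \<open>g\<close>. So \<open>F\<close> maps
      \<open>\<pi>\<close>-invariant subspaces to left-invariant subspaces of
      \<open>W\<close>.\<close>
    define F where "F u y = (\<Sum>i<m. cnj (u $ i) * f i y)" for u :: "complex vec" and y
    have Uc: "u \<in> carrier_vec m" if "u \<in> U" for u using U that by (auto simp: linear_subspace_def)
    have FW: "F u \<in> W" for u unfolding F_def using fW by (intro left_invariant_subspace_sum[OF W]) auto
    have Fcoeff: "L2_inner (F u) (f j) = cnj (u $ j)" if "j < m" for u j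
      unfolding F_def by (rule orthonormal_coeff[OF f W that])
    define W' where "W' = F ` U"
    have W'W: "W' \<subseteq> W" using FW by (auto simp: W'_def)
    have W': "left_invariant_subspace W'"
      unfolding left_invariant_subspace_def
    proof (intro conjI ballI allI)
      fix h assume "h \<in> W'" then show "continuous_on UNIV h" using W'W left_invariant_subspaceD(1)[OF W] by blast
    next
      have "0\<^sub>v m \<in> U" using U by (simp add: linear_subspace_def)
      moreover have "F (0\<^sub>v m) = (\<lambda>x. 0)" by (auto simp: F_def)
      ultimately show "(\<lambda>x. 0) \<in> W'" unfolding W'_def by (metis imageI)
    next
      fix h k assume "h \<in> W'" "k \<in> W'"
      then obtain u v where uv: "u \<in> U" "v \<in> U" "h = F u" "k = F v" by (auto simp: W'_def)
      have "F (u + v) = (\<lambda>x. h x + k x)"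
        using Uc[OF uv(1)] Uc[OF uv(2)] by (auto simp: F_def uv distrib_right sum.distrib)
      moreover have "u + v \<in> U" using U uv by (simp add: linear_subspace_def)
      ultimately show "(\<lambda>x. h x + k x) \<in> W'" unfolding W'_def by (metis imageI)
    next
      fix a h assume "h \<in> W'"
      then obtain u where u: "u \<in> U" "h = F u" by (auto simp: W'_def)
      have "F (cnj a \<cdot>\<^sub>v u) = (\<lambda>x. a * h x)"
        using Uc[OF u(1)] by (auto simp: F_def u sum_distrib_left mult.assoc)
      moreover have "cnj a \<cdot>\<^sub>v u \<in> U" using U u by (simp add: linear_subspace_def)
      ultimately show "(\<lambda>x. a * h x) \<in> W'" unfolding W'_def by (metis imageI)
    next
      fix g h assume "h \<in> W'"
      then obtain u where u: "u \<in> U" "h = F u" by (auto simp: W'_def)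
      have "F (\<pi> (inv g) *\<^sub>v u) = (\<lambda>x. h (g \<otimes> x))"
      proof
        fix y
        have "h (g \<otimes> y) = (\<Sum>i<m. cnj (u $ i) * (\<Sum>k<m. cnj (p (inv g) k i) * f k y))"
          using tr[of _ "inv g" y] by (simp add: u F_def)
        also have "\<dots> = (\<Sum>k<m. \<Sum>i<m. cnj (u $ i) * (cnj (p (inv g) k i) * f k y))"
          unfolding sum_distrib_left by (rule sum.swap)
        also have "\<dots> = (\<Sum>k<m. cnj ((\<pi> (inv g) *\<^sub>v u) $ k) * f k y)"
          using Uc[OF u(1)]
          by (intro sum.cong refl) (auto simp: \<pi>_def scalar_prod_def atLeast0LessThan sum_distrib_left sum_distrib_right mult_ac intro!: sum.cong)
        finally show "F (\<pi> (inv g) *\<^sub>v u) y = h (g \<otimes> y)" by (simp add: F_def)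
      qed
      moreover have "\<pi> (inv g) *\<^sub>v u \<in> U" using inv u by blast
      ultimately show "(\<lambda>x. h (g \<otimes> x)) \<in> W'" unfolding W'_def by (metis imageI)
    qed
    show "U = {0\<^sub>v m}"
    proof (rule ccontr)
      assume "U \<noteq> {0\<^sub>v m}"
      then obtain u where u: "u \<in> U" "u \<noteq> 0\<^sub>v m" using U by (auto simp: linear_subspace_def)
      then obtain j where j: "j < m" "u $ j \<noteq> 0" using Uc[OF u(1)] by (metis carrier_vecD eq_vecI index_zero_vec)
      have "\<exists>x. F u x \<noteq> 0"
      proof (rule ccontr)
        assume "\<nexists>x. F u x \<noteq> 0"
        then have "F u = (\<lambda>x. 0)" by auto
        then show False using Fcoeff[OF j(1), of u] j(2) by simp
      qed
      then obtain x where "F u x \<noteq> 0" ..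
      then obtain h where h: "orthonormal W' m h" using minimal[OF W' W'W, of "F u" x] u by (auto simp: W'_def)
      have "v \<in> U" if v: "v \<in> carrier_vec m" for v
      proof -
        have "F v = (\<lambda>x. \<Sum>i<m. L2_inner (F v) (h i) * h i x)"
          using orthonormal_expansion[OF W orthonormal_mono[OF h W'W] max FW] by blast
        moreover have "(\<lambda>x. \<Sum>i<m. L2_inner (F v) (h i) * h i x) \<in> W'"
          using h by (intro left_invariant_subspace_sum[OF W']) (auto simp: orthonormal_def)
        ultimately have "F v \<in> W'" by simp
        then obtain w where w: "w \<in> U" "F v = F w" by (auto simp: W'_def)
        have "v = w"
          using v Uc[OF w(1)] Fcoeff[of _ v] Fcoeff[of _ w] w(2) by (intro eq_vecI) auto
        with w show ?thesis by simp
      qed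
      then have "U = carrier_vec m" using Uc by blast
      with \<open>U \<noteq> carrier_vec m\<close> show False by simp
    qed
  qed
  have fj: "f j x = (\<Sum>i<m. f i \<one> * \<pi> x $$ (j, i))" if j: "j < m" for j x
  proof -
    \<comment> \<open>The translation formula \<open>tr\<close> for \<open>inv x\<close>, evaluated
      at \<open>\<one>\<close>. The identity \<open>cnj (p (inv x) k j) = p x j k\<close> used next
      says that the inverse is represented by the adjoint.\<close>
    have "f j x = (\<Sum>k<m. cnj (p (inv x) k j) * f k \<one>)" using tr[OF j, of "inv x" \<one>] by simp
    also have "\<dots> = (\<Sum>k<m. f k \<one> * \<pi> x $$ (j, k))"
    proof (intro sum.cong refl)
      fix k assume "k \<in> {..<m}"
      then have k: "k < m" by simp
      have "cnj (p (inv x) k j) = L2_inner (\<lambda>y. f j (x \<otimes> y)) (f k)" by (simp add: p_def L2_inner_cnj)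
      also have "\<dots> = L2_inner (\<lambda>y. f j (x \<otimes> y)) (\<lambda>y. f k (inv x \<otimes> (x \<otimes> y)))"
        by (simp add: m_assoc[symmetric])
      also have "\<dots> = p x j k"
        unfolding p_def using j k fc L2_inner_translate[of "f j" "\<lambda>y. f k (inv x \<otimes> y)" x]
        by (simp add: continuous_translate)
      finally show "cnj (p (inv x) k j) * f k \<one> = f k \<one> * \<pi> x $$ (j, k)"
        using j k by (simp add: \<pi>_def)
    qed
    finally show ?thesis .
  qed
  have "\<pi> \<in> irreps G"
    unfolding irreps_def using m rep irr by (intro CollectI exI[of _ m] conjI allI impI) auto
  then show ?thesis by (rule that[OF _ rep fj])
qed

end

section \<open>The Peter--Weyl theorem\<close>

context conv_kernel
begin

text \<open>The square norm of the convolution is maximised over the unit ball of \<open>V\<close>.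
  A maximising sequence need not converge, but its images do so uniformly along a subsequence, and
  their limit is the eigenfunction. The squared operator has the supremum \<open>s\<close> itself as
  eigenvalue, so no choice between the two square roots of \<open>s\<close> arises.\<close>

lemma eigenfunction:
  assumes V: "left_invariant_subspace V" and conv: "\<And>f. f \<in> V \<Longrightarrow> conv \<phi> f \<in> V"
    and closed: "\<And>F h. (\<And>n. F n \<in> V) \<Longrightarrow> uniform_limit UNIV F h sequentially \<Longrightarrow> h \<in> V"
    and f0: "f0 \<in> V" "conv \<phi> f0 x0 \<noteq> 0"
  obtains u s x where "u \<in> V" "0 < s" "\<And>x. conv \<phi> (conv \<phi> u) x = complex_of_real s * u x" "u x \<noteq> 0"
proof -
  note Vc = left_invariant_subspaceD(1)[OF V]
  obtain B where B: "0 < B" "\<And>f x. continuous_on UNIV f \<Longrightarrow> cmod (conv \<phi> f x) \<le> B * L2_norm f"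
    by (rule conv_bounded, rule that)
  define S where "S = (\<lambda>f. (L2_norm (conv \<phi> f))\<^sup>2) ` {f \<in> V. L2_norm f \<le> 1}"
  have Bn: "cmod (conv \<phi> f x) \<le> B" if "f \<in> V" "L2_norm f \<le> 1" for f x
  proof -
    have "B * L2_norm f \<le> B * 1" using B(1) that by (intro mult_left_mono) auto
    with B(2)[OF Vc[OF that(1)], of x] show ?thesis by simp
  qed
  have bdd: "bdd_above S"
  proof (rule bdd_aboveI)
    fix t assume "t \<in> S"
    then obtain f where f: "f \<in> V" "L2_norm f \<le> 1" "t = (L2_norm (conv \<phi> f))\<^sup>2" by (auto simp: S_def)
    have "L2_norm (conv \<phi> f) \<le> B" using Bn[OF f(1,2)] B(1) by (intro Lp_norm_bounded) auto
    then show "t \<le> B\<^sup>2" unfolding f(3) by (intro power_mono) auto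
  qed
  define s where "s = Sup S"
  have upper: "(L2_norm (conv \<phi> g))\<^sup>2 \<le> s * (L2_norm g)\<^sup>2" if g: "g \<in> V" for g
  proof (cases "L2_norm g = 0")
    case True
    then have "conv \<phi> g x = 0" for x using B(2)[OF Vc[OF g], of x] by simp
    then have "conv \<phi> g = (\<lambda>x. 0)" by auto
    then show ?thesis using True by simp
  next
    case False
    define c where "c = complex_of_real (inverse (L2_norm g))"
    have cn: "cmod c = inverse (L2_norm g)" unfolding c_def norm_of_real by simp
    have "(\<lambda>x. c * g x) \<in> {f \<in> V. L2_norm f \<le> 1}"
      using left_invariant_subspaceD(4)[OF V g] False by (simp add: Lp_norm_scale cn)
    then have "(L2_norm (conv \<phi> (\<lambda>x. c * g x)))\<^sup>2 \<in> S" unfolding S_def by (rule imageI)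
    then have "(L2_norm (conv \<phi> (\<lambda>x. c * g x)))\<^sup>2 \<le> s"
      unfolding s_def by (rule cSup_upper[OF _ bdd])
    moreover have "conv \<phi> (\<lambda>x. c * g x) = (\<lambda>x. c * conv \<phi> g x)" using conv_scale by blast
    ultimately have "(L2_norm (conv \<phi> g))\<^sup>2 / (L2_norm g)\<^sup>2 \<le> s"
      by (simp add: Lp_norm_scale cn power_mult_distrib divide_inverse mult.commute power_inverse)
    then show ?thesis using False Lp_norm_nonneg[of 2 M g] by (simp add: divide_le_eq)
  qed
  have "0 < L2_norm (conv \<phi> f0)"
    using L2_norm_zero[OF conv_cont[OF Vc[OF f0(1)]]] f0(2) Lp_norm_nonneg[of 2 M "conv \<phi> f0"]
    by (metis less_eq_real_def)
  then have "0 < s * (L2_norm f0)\<^sup>2" using upper[OF f0(1)] by (meson less_le_trans zero_less_power)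
  then have s: "0 < s" using zero_less_mult_pos2 by (metis not_less zero_le_power2 mult_nonpos_nonneg)
  have Sne: "S \<noteq> {}" unfolding S_def using left_invariant_subspaceD(2)[OF V] by (auto intro!: exI[of _ "\<lambda>x. 0"])
  have "\<exists>f. f \<in> V \<and> L2_norm f \<le> 1 \<and> s - 1 / (real n + 1) < (L2_norm (conv \<phi> f))\<^sup>2" for n
  proof -
    have "s - 1 / (real n + 1) < Sup S" by (simp add: s_def)
    then show ?thesis using less_cSupD[OF Sne] unfolding S_def by blast
  qed
  then obtain f where f: "\<And>n. f n \<in> V" "\<And>n. L2_norm (f n) \<le> 1"
    "\<And>n. s - 1 / (real n + 1) < (L2_norm (conv \<phi> (f n)))\<^sup>2" by metis
  define g where "g n = conv \<phi> (f n)" for n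
  have gV: "g n \<in> V" for n unfolding g_def by (intro conv f)
  have fc: "continuous_on UNIV (f n)" and gc: "continuous_on UNIV (g n)" for n using Vc f(1) gV by auto
  have equi: "\<exists>U. open U \<and> x \<in> U \<and> (\<forall>y\<in>U. \<forall>n. cmod (g n y - g n x) \<le> e)" if e: "0 < e" for x e
  proof -
    obtain U where U: "open U" "x \<in> U"
      "\<And>y f. y \<in> U \<Longrightarrow> continuous_on UNIV f \<Longrightarrow> cmod (conv \<phi> f y - conv \<phi> f x) \<le> e * L2_norm f"
      by (rule conv_equicontinuous[OF e, of x], rule that)
    have "cmod (g n y - g n x) \<le> e" if "y \<in> U" for n y
    proof -
      have "cmod (g n y - g n x) \<le> e * L2_norm (f n)" unfolding g_def by (rule U(3)[OF that fc])
      also have "\<dots> \<le> e * 1" using e f(2) by (intro mult_left_mono) auto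
      finally show ?thesis by simp
    qed
    with U show ?thesis by blast
  qed
  have gB: "cmod (g n x) \<le> B" for n x unfolding g_def by (rule Bn[OF f(1,2)])
  obtain r u where r: "strict_mono r" "continuous_on UNIV u" "uniform_limit UNIV (\<lambda>n. g (r n)) u sequentially"
    by (rule equicontinuous_subsequence[OF compact_UNIV gB gc equi], assumption, rule that)
  have uV: "u \<in> V" using closed[OF _ r(3)] gV by blast
  \<comment> \<open>By symmetry the square norm of \<open>d\<close> is |conv g|^2 - 2 s |g|^2 + s^2
    |f|^2, which by maximality of \<open>s\<close> is at most s (s - |g|^2), hence at most s / (n +
    1). One more convolution makes this L2 estimate uniform.\<close>
  have small: "cmod (conv \<phi> (conv \<phi> (g n)) x - complex_of_real s * g n x) \<le> B * sqrt (s / (real n + 1))" for n x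
  proof -
    define d where "d y = conv \<phi> (g n) y - complex_of_real s * f n y" for y
    have cgc: "continuous_on UNIV (conv \<phi> (g n))" by (rule conv_cont[OF gc])
    have sfc: "continuous_on UNIV (\<lambda>y. complex_of_real s * f n y)" by (intro continuous_intros fc)
    have dc: "continuous_on UNIV d" unfolding d_def by (intro continuous_intros cgc fc)
    have "L2_inner (conv \<phi> (g n)) (f n) = complex_of_real ((L2_norm (g n))\<^sup>2)"
      unfolding conv_symmetric[OF gc fc] by (simp only: g_def[symmetric] L2_inner_self)
    then have "Re (L2_inner (conv \<phi> (g n)) (\<lambda>y. complex_of_real s * f n y)) = s * (L2_norm (g n))\<^sup>2"
      by (simp add: L2_inner_scale_right)
    then have "(L2_norm d)\<^sup>2 = (L2_norm (conv \<phi> (g n)))\<^sup>2 - 2 * (s * (L2_norm (g n))\<^sup>2) + s\<^sup>2 * (L2_norm (f n))\<^sup>2"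
      unfolding d_def L2_norm_diff_sq[OF cgc sfc] using s by (simp add: Lp_norm_scale power_mult_distrib)
    also have "\<dots> \<le> s * (L2_norm (g n))\<^sup>2 - 2 * (s * (L2_norm (g n))\<^sup>2) + s\<^sup>2 * 1"
      using f(2)[of n] s by (intro add_mono diff_mono upper gV mult_left_mono) (auto simp: power_le_one)
    also have "\<dots> = s * (s - (L2_norm (g n))\<^sup>2)" by (simp add: algebra_simps power2_eq_square)
    also have "\<dots> \<le> s * (1 / (real n + 1))"
      using f(3)[of n] s by (intro mult_left_mono) (auto simp: g_def)
    finally have "L2_norm d \<le> sqrt (s / (real n + 1))" by (intro real_le_rsqrt) simp
    then have "B * L2_norm d \<le> B * sqrt (s / (real n + 1))" using B(1) by (intro mult_left_mono) auto
    moreover have "conv \<phi> d x = conv \<phi> (conv \<phi> (g n)) x - conv \<phi> (\<lambda>y. complex_of_real s * f n y) x"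
      unfolding d_def by (rule conv_diff[OF cgc sfc])
    moreover have "conv \<phi> (\<lambda>y. complex_of_real s * f n y) x = complex_of_real s * g n x"
      by (simp add: conv_scale g_def)
    ultimately show ?thesis using B(2)[OF dc, of x] by simp
  qed
  have ru: "uniform_limit UNIV (\<lambda>n. conv \<phi> (conv \<phi> (g (r n)))) (conv \<phi> (conv \<phi> u)) sequentially"
    by (intro conv_uniform_limit(2) conv_cont gc r(3))
  have eig: "conv \<phi> (conv \<phi> u) x = complex_of_real s * u x" for x
  proof -
    have "(\<lambda>n. conv \<phi> (conv \<phi> (g (r n))) x - complex_of_real s * g (r n) x)
        \<longlonglongrightarrow> conv \<phi> (conv \<phi> u) x - complex_of_real s * u x"
      by (intro tendsto_intros tendsto_uniform_limitI[OF ru] tendsto_uniform_limitI[OF r(3)]) auto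
    moreover have "(\<lambda>n. conv \<phi> (conv \<phi> (g (r n))) x - complex_of_real s * g (r n) x) \<longlonglongrightarrow> 0"
    proof (rule Lim_null_comparison)
      show "\<forall>\<^sub>F n in sequentially. cmod (conv \<phi> (conv \<phi> (g (r n))) x - complex_of_real s * g (r n) x)
          \<le> B * sqrt (s / (real (r n) + 1))" using small by simp
      have "(\<lambda>n. 1 / (real n + 1)) \<longlonglongrightarrow> 0" using LIMSEQ_Suc[OF lim_1_over_n] by (simp add: add.commute)
      then have "(\<lambda>n. B * sqrt (s * (1 / (real n + 1)))) \<longlonglongrightarrow> B * sqrt (s * 0)" by (intro tendsto_intros)
      then have "(\<lambda>n. B * sqrt (s / (real n + 1))) \<longlonglongrightarrow> 0" by simp
      from LIMSEQ_subseq_LIMSEQ[OF this r(1)] show "(\<lambda>n. B * sqrt (s / (real (r n) + 1))) \<longlonglongrightarrow> 0"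
        by (simp add: o_def)
    qed
    ultimately have "conv \<phi> (conv \<phi> u) x - complex_of_real s * u x = 0" by (rule LIMSEQ_unique)
    then show ?thesis by simp
  qed
  \<comment> \<open>Otherwise the square norms of the \<open>g (r n)\<close> would eventually be at
    most s / 2, although they approach \<open>s\<close>.\<close>
  have "\<exists>x. u x \<noteq> 0"
  proof (rule ccontr)
    assume "\<nexists>x. u x \<noteq> 0"
    then have u0: "u x = 0" for x by blast
    define e where "e = sqrt (s / 2)"
    have e: "0 < e" using s by (simp add: e_def)
    have "\<forall>\<^sub>F n in sequentially. \<forall>x\<in>UNIV. dist (g (r n) x) (u x) < e" by (rule uniform_limitD[OF r(3) e])
    moreover have "\<forall>\<^sub>F n in sequentially. 2 / s < real n" using filterlim_real_sequentially by (simp add: filterlim_at_top_dense)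
    ultimately have "\<forall>\<^sub>F n in sequentially. False"
    proof eventually_elim
      case (elim n)
      have "L2_norm (g (r n)) \<le> e"
        using elim(1) e by (intro Lp_norm_bounded) (auto simp: u0 less_imp_le)
      then have "(L2_norm (g (r n)))\<^sup>2 \<le> e\<^sup>2" by (intro power_mono) auto
      also have "e\<^sup>2 = s / 2" using s by (simp add: e_def)
      finally have "s - 1 / (real (r n) + 1) < s / 2" using f(3)[of "r n"] by (simp add: g_def)
      then have "s / 2 < 1 / (real (r n) + 1)" by simp
      moreover have "2 / s < real (r n) + 1" using elim(2) seq_suble[OF r(1), of n] by linarith
      then have "1 / (real (r n) + 1) < s / 2" using s by (simp add: field_simps)
      ultimately show False by simp
    qed
    then show False by simp
  qed
  with that[OF uV s eig] show ?thesis by blast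
qed

text \<open>The eigenvalue equation turns s f(x) into the inner product of f with the convolved
  kernel at x. Bessel's inequality then bounds the sum of s^2 |f_i(x)|^2 at every point, and
  integration over x bounds s^2 n.\<close>

lemma eigenspace_finite_dim:
  assumes s: "0 < s" and W: "left_invariant_subspace W"
    and eig: "\<And>f x. f \<in> W \<Longrightarrow> conv \<phi> (conv \<phi> f) x = complex_of_real s * f x"
  obtains N where "\<And>n f. orthonormal W n f \<Longrightarrow> n \<le> N"
proof -
  obtain B where B: "0 < B" "\<And>f x. continuous_on UNIV f \<Longrightarrow> cmod (conv \<phi> f x) \<le> B * L2_norm f"
    by (rule conv_bounded, rule that)
  obtain K where K: "0 < K" "\<And>x. norm (\<phi> x) \<le> K" by (rule continuous_bounded[OF kernel_cont], rule that)
  let ?k = "\<lambda>x y. complex_of_real (\<phi> (inv x \<otimes> y))"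
  have kn: "L2_norm (conv \<phi> (?k x)) \<le> B * K" for x
  proof (rule Lp_norm_bounded)
    have "L2_norm (?k x) \<le> K" using K by (intro Lp_norm_bounded) auto
    then have "B * L2_norm (?k x) \<le> B * K" using B(1) by (intro mult_left_mono) auto
    then have "cmod (conv \<phi> (?k x) y) \<le> B * K" for y
      using B(2)[OF kernel_cont_right, of x y] by simp
    then show "AE y in M. cmod (conv \<phi> (?k x) y) \<le> B * K" by simp
  qed (use B K in auto)
  have bound: "s\<^sup>2 * real n \<le> (B * K)\<^sup>2" if f: "orthonormal W n f" for n f
  proof -
    have fW: "f i \<in> W" and fc: "continuous_on UNIV (f i)" if "i < n" for i
      using f W that by (auto simp: orthonormal_def left_invariant_subspace_def)
    have pt: "(\<Sum>i<n. s\<^sup>2 * (cmod (f i x))\<^sup>2) \<le> (B * K)\<^sup>2" for x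
    proof -
      have "s\<^sup>2 * (cmod (f i x))\<^sup>2 = (cmod (L2_inner (conv \<phi> (?k x)) (f i)))\<^sup>2" if "i < n" for i
      proof -
        have "complex_of_real s * f i x = L2_inner (conv \<phi> (f i)) (?k x)"
          using eig[OF fW[OF that], of x] by (simp add: conv_eq_inner[of \<phi> "conv \<phi> (f i)"])
        also have "\<dots> = L2_inner (f i) (conv \<phi> (?k x))"
          by (rule conv_symmetric[OF fc[OF that] kernel_cont_right])
        also have "\<dots> = cnj (L2_inner (conv \<phi> (?k x)) (f i))" by (simp add: L2_inner_cnj)
        finally have "cmod (complex_of_real s * f i x) = cmod (L2_inner (conv \<phi> (?k x)) (f i))" by simp
        then have "(cmod (complex_of_real s * f i x))\<^sup>2 = (cmod (L2_inner (conv \<phi> (?k x)) (f i)))\<^sup>2" by simp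
        then show ?thesis by (simp add: norm_mult power_mult_distrib)
      qed
      then have "(\<Sum>i<n. s\<^sup>2 * (cmod (f i x))\<^sup>2) = (\<Sum>i<n. (cmod (L2_inner (conv \<phi> (?k x)) (f i)))\<^sup>2)"
        by (intro sum.cong) auto
      also have "\<dots> \<le> (L2_norm (conv \<phi> (?k x)))\<^sup>2"
        by (rule bessel[OF f W conv_cont[OF kernel_cont_right]])
      also have "\<dots> \<le> (B * K)\<^sup>2" using kn by (intro power_mono) auto
      finally show ?thesis .
    qed
    have one: "(LINT x|M. (cmod (f i x))\<^sup>2) = 1" if "i < n" for i
    proof -
      have "complex_of_real ((L2_norm (f i))\<^sup>2) = complex_of_real 1"
        using f that unfolding L2_inner_self[symmetric] orthonormal_def by simp
      then show ?thesis unfolding L2_norm_sq using of_real_eq_iff by blast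
    qed
    have int: "integrable M (\<lambda>x. s\<^sup>2 * (cmod (f i x))\<^sup>2)" if "i < n" for i
      by (intro continuous_integrable continuous_intros fc that)
    have "s\<^sup>2 * real n = (\<Sum>i<n. s\<^sup>2 * (LINT x|M. (cmod (f i x))\<^sup>2))" by (simp add: one)
    also have "\<dots> = (LINT x|M. (\<Sum>i<n. s\<^sup>2 * (cmod (f i x))\<^sup>2))"
      using int by (subst Bochner_Integration.integral_sum) auto
    also have "\<dots> \<le> (LINT x|M. (B * K)\<^sup>2)"
      using int pt by (intro integral_mono Bochner_Integration.integrable_sum) auto
    also have "\<dots> = (B * K)\<^sup>2" using prob_space by simp
    finally show ?thesis .
  qed
  show ?thesis
  proof (rule that[of "nat \<lceil>(B * K)\<^sup>2 / s\<^sup>2\<rceil>"])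
    fix n f assume "orthonormal W n f"
    then have "real n \<le> (B * K)\<^sup>2 / s\<^sup>2" using bound s by (simp add: le_divide_eq mult.commute)
    then show "n \<le> nat \<lceil>(B * K)\<^sup>2 / s\<^sup>2\<rceil>" by linarith
  qed
qed

end

section \<open>Matrix coefficients and their orthogonal complement\<close>

context haar_group
begin

definition matrix_coeffs :: "('g \<Rightarrow> complex) set" where
  "matrix_coeffs = {\<lambda>x. \<xi> x $$ (i, j) | \<xi> d i j. \<xi> \<in> irreps G \<and> unitary_rep G \<xi> d \<and> i < d \<and> j < d}"

inductive_set trig_polys :: "('g \<Rightarrow> complex) set" where
  coeff: "m \<in> matrix_coeffs \<Longrightarrow> m \<in> trig_polys"
| zero: "(\<lambda>x. 0) \<in> trig_polys"
| add: "f \<in> trig_polys \<Longrightarrow> g \<in> trig_polys \<Longrightarrow> (\<lambda>x. f x + g x) \<in> trig_polys"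
| scale: "f \<in> trig_polys \<Longrightarrow> (\<lambda>x. a * f x) \<in> trig_polys"

lemma trig_polys_sum: "(\<And>i. i \<in> I \<Longrightarrow> f i \<in> trig_polys) \<Longrightarrow> (\<lambda>x. \<Sum>i\<in>I. f i x) \<in> trig_polys"
  by (induction I rule: infinite_finite_induct) (auto intro: trig_polys.zero trig_polys.add)

lemma unitary_repD:
  assumes "unitary_rep G \<xi> d"
  shows "\<xi> x \<in> carrier_mat d d" "\<xi> (x \<otimes> y) = \<xi> x * \<xi> y"
    "i < d \<Longrightarrow> j < d \<Longrightarrow> continuous_on UNIV (\<lambda>x. \<xi> x $$ (i, j))"
    "i < d \<Longrightarrow> j < d \<Longrightarrow> \<xi> (x \<otimes> y) $$ (i, j) = (\<Sum>k<d. \<xi> x $$ (i, k) * \<xi> y $$ (k, j))"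
proof -
  show 1: "\<xi> x \<in> carrier_mat d d" for x using assms by (auto simp: unitary_rep_def)
  show 2: "\<xi> (x \<otimes> y) = \<xi> x * \<xi> y" using assms by (auto simp: unitary_rep_def)
  show "i < d \<Longrightarrow> j < d \<Longrightarrow> continuous_on UNIV (\<lambda>x. \<xi> x $$ (i, j))"
    using assms by (auto simp: unitary_rep_def)
  show "i < d \<Longrightarrow> j < d \<Longrightarrow> \<xi> (x \<otimes> y) $$ (i, j) = (\<Sum>k<d. \<xi> x $$ (i, k) * \<xi> y $$ (k, j))"
    unfolding 2 by (rule mat_mult_index[OF 1 1])
qed

lemma matrix_coeffsI:
  "\<xi> \<in> irreps G \<Longrightarrow> unitary_rep G \<xi> d \<Longrightarrow> i < d \<Longrightarrow> j < d \<Longrightarrow> (\<lambda>x. \<xi> x $$ (i, j)) \<in> matrix_coeffs"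
  unfolding matrix_coeffs_def by blast

lemma trig_polys_cont: "f \<in> trig_polys \<Longrightarrow> continuous_on UNIV f"
  by (induction rule: trig_polys.induct)
    (auto simp: matrix_coeffs_def intro: unitary_repD(3) continuous_intros)

definition coeff_perp :: "('g \<Rightarrow> complex) set" where
  "coeff_perp = {f. continuous_on UNIV f \<and> (\<forall>m\<in>matrix_coeffs. L2_inner f m = 0)}"

lemma L2_inner_uniform_limit:
  assumes F: "\<And>n. continuous_on UNIV (F n)" and h: "uniform_limit UNIV F h sequentially"
    and m: "continuous_on UNIV m"
  shows "(\<lambda>n. L2_inner (F n) m) \<longlonglongrightarrow> L2_inner h m"
proof -
  have hc: "continuous_on UNIV h" using F by (intro uniform_limit_theorem[OF _ h]) auto
  have "(\<lambda>n. L2_inner (F n) m - L2_inner h m) \<longlonglongrightarrow> 0"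
  proof (rule tendstoI)
    fix e :: real assume e: "0 < e"
    have pos: "0 < L2_norm m + 1" using Lp_norm_nonneg[of 2 M m] by linarith
    define d where "d = e / (L2_norm m + 1)"
    have d: "0 < d" using e pos by (simp add: d_def)
    have "\<forall>\<^sub>F n in sequentially. \<forall>x\<in>UNIV. dist (F n x) (h x) < d" by (rule uniform_limitD[OF h d])
    then show "\<forall>\<^sub>F n in sequentially. dist (L2_inner (F n) m - L2_inner h m) 0 < e"
    proof eventually_elim
      case (elim n)
      have "L2_norm (\<lambda>x. F n x - h x) \<le> d"
        using elim d by (intro Lp_norm_bounded) (auto simp: dist_norm less_imp_le)
      then have "L2_norm (\<lambda>x. F n x - h x) * L2_norm m \<le> d * L2_norm m" by (intro mult_right_mono) auto
      moreover have "cmod (L2_inner (\<lambda>x. F n x - h x) m) \<le> L2_norm (\<lambda>x. F n x - h x) * L2_norm m"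
        by (intro L2_cauchy_schwarz continuous_Lp continuous_intros F hc m) auto
      moreover have "d * L2_norm m < d * (L2_norm m + 1)" using d by simp
      moreover have "d * (L2_norm m + 1) = e" using pos by (simp add: d_def)
      ultimately show ?case using L2_inner_diff_left[OF F hc m, of n] by simp
    qed
  qed
  then show ?thesis using Lim_null by blast
qed

text \<open>By invariance of the measure a translation passes from \<open>f\<close> to the
  coefficient, and a translated coefficient is a combination of coefficients of the same
  representation.\<close>

lemma coeff_perp_subspace: "left_invariant_subspace coeff_perp"
  unfolding left_invariant_subspace_def
proof (intro conjI ballI allI)
  fix f h a g
  assume f: "f \<in> coeff_perp"
  then have fc: "continuous_on UNIV f" and f0: "\<And>m. m \<in> matrix_coeffs \<Longrightarrow> L2_inner f m = 0"
    by (auto simp: coeff_perp_def)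
  show "continuous_on UNIV f" by (rule fc)
  show "(\<lambda>x. a * f x) \<in> coeff_perp"
    using fc f0 by (auto simp: coeff_perp_def L2_inner_scale_left intro: continuous_intros)
  show "(\<lambda>x. f x + h x) \<in> coeff_perp" if "h \<in> coeff_perp"
    using fc f0 that trig_polys_cont[OF trig_polys.coeff]
    by (auto simp: coeff_perp_def L2_inner_add_left intro: continuous_intros)
  show "(\<lambda>x. f (g \<otimes> x)) \<in> coeff_perp"
    unfolding coeff_perp_def
  proof (intro CollectI conjI ballI)
    show "continuous_on UNIV (\<lambda>x. f (g \<otimes> x))" by (rule continuous_translate[OF fc])
    fix m assume "m \<in> matrix_coeffs"
    then obtain \<xi> d i j where \<xi>: "\<xi> \<in> irreps G" "unitary_rep G \<xi> d" "i < d" "j < d" "m = (\<lambda>x. \<xi> x $$ (i, j))"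
      unfolding matrix_coeffs_def by blast
    have mc: "continuous_on UNIV m" unfolding \<xi>(5) by (rule unitary_repD(3)[OF \<xi>(2-4)])
    have "L2_inner (\<lambda>x. f (g \<otimes> x)) m = L2_inner (\<lambda>x. f (g \<otimes> x)) (\<lambda>x. m (inv g \<otimes> (g \<otimes> x)))"
      by (simp add: m_assoc[symmetric])
    also have "\<dots> = L2_inner f (\<lambda>x. m (inv g \<otimes> x))"
      using L2_inner_translate[OF fc continuous_translate[OF mc, of "inv g"], of g] by simp
    also have "\<dots> = L2_inner f (\<lambda>x. \<Sum>k<d. \<xi> (inv g) $$ (i, k) * \<xi> x $$ (k, j))"
      by (simp add: \<xi>(5) unitary_repD(4)[OF \<xi>(2-4)])
    also have "\<dots> = (\<Sum>k<d. cnj (\<xi> (inv g) $$ (i, k)) * L2_inner f (\<lambda>x. \<xi> x $$ (k, j)))"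
      using unitary_repD(3)[OF \<xi>(2) _ \<xi>(4)] fc by (intro L2_inner_sum_right) auto
    also have "\<dots> = 0"
      using f0[OF matrix_coeffsI[OF \<xi>(1,2) _ \<xi>(4)]] by simp
    finally show "L2_inner (\<lambda>x. f (g \<otimes> x)) m = 0" .
  qed
next
  show "(\<lambda>x. 0) \<in> coeff_perp" by (auto simp: coeff_perp_def)
qed

lemma coeff_perp_closed:
  assumes "\<And>n. F n \<in> coeff_perp" "uniform_limit UNIV F h sequentially"
  shows "h \<in> coeff_perp"
proof -
  have F: "continuous_on UNIV (F n)" for n using assms(1) by (simp add: coeff_perp_def)
  have hc: "continuous_on UNIV h" using F by (intro uniform_limit_theorem[OF _ assms(2)]) auto
  have "L2_inner h m = 0" if m: "m \<in> matrix_coeffs" for m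
  proof -
    have "(\<lambda>n. L2_inner (F n) m) \<longlonglongrightarrow> L2_inner h m"
      by (rule L2_inner_uniform_limit[OF F assms(2) trig_polys_cont[OF trig_polys.coeff[OF m]]])
    moreover have "L2_inner (F n) m = 0" for n using assms(1) m by (simp add: coeff_perp_def)
    ultimately show ?thesis by (simp add: LIMSEQ_const_iff)
  qed
  with hc show ?thesis by (simp add: coeff_perp_def)
qed

end

context conv_kernel
begin

text \<open>Since \<open>\<xi> (x \<otimes> y)\<close> is a product, convolution mixes the entries
  of a row only. Hence the span of the coefficients is invariant, and by symmetry so is its
  orthogonal complement.\<close>

lemma conv_coeff:
  assumes \<xi>: "unitary_rep G \<xi> d" "i < d" "j < d"
  shows "conv \<phi> (\<lambda>x. \<xi> x $$ (i, j)) x = (\<Sum>k<d. (LINT y|M. complex_of_real (\<phi> y) * \<xi> y $$ (k, j)) * \<xi> x $$ (i, k))"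
proof -
  have "conv \<phi> (\<lambda>x. \<xi> x $$ (i, j)) x = (LINT y|M. complex_of_real (\<phi> y) * (\<Sum>k<d. \<xi> x $$ (i, k) * \<xi> y $$ (k, j)))"
    by (simp add: conv_alt[OF kernel_cont unitary_repD(3)[OF \<xi>]] unitary_repD(4)[OF \<xi>])
  also have "\<dots> = (LINT y|M. (\<Sum>k<d. \<xi> x $$ (i, k) * (complex_of_real (\<phi> y) * \<xi> y $$ (k, j))))"
    by (simp add: sum_distrib_left mult_ac)
  also have "\<dots> = (\<Sum>k<d. (LINT y|M. \<xi> x $$ (i, k) * (complex_of_real (\<phi> y) * \<xi> y $$ (k, j))))"
    by (intro Bochner_Integration.integral_sum continuous_integrable continuous_intros kernel_cont unitary_repD(3)[OF \<xi>(1) _ \<xi>(3)]) auto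
  finally show ?thesis by (simp add: mult.commute)
qed

lemma conv_trig_polys:
  assumes "f \<in> trig_polys"
  shows "conv \<phi> f \<in> trig_polys"
  using assms
proof (induction rule: trig_polys.induct)
  case (coeff m)
  then obtain \<xi> d i j where \<xi>: "\<xi> \<in> irreps G" "unitary_rep G \<xi> d" "i < d" "j < d" "m = (\<lambda>x. \<xi> x $$ (i, j))"
    unfolding matrix_coeffs_def by blast
  have "conv \<phi> m = (\<lambda>x. \<Sum>k<d. (LINT y|M. complex_of_real (\<phi> y) * \<xi> y $$ (k, j)) * \<xi> x $$ (i, k))"
    unfolding \<xi>(5) using conv_coeff[OF \<xi>(2-4)] by blast
  also have "\<dots> \<in> trig_polys"
    by (intro trig_polys_sum trig_polys.scale trig_polys.coeff matrix_coeffsI[OF \<xi>(1-3)]) auto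
  finally show ?case .
next
  case zero
  have "conv \<phi> (\<lambda>x. 0) = (\<lambda>x. 0)" by (auto simp: conv_def)
  then show ?case by (simp add: trig_polys.zero)
next
  case (add f g)
  have "conv \<phi> (\<lambda>x. f x + g x) = (\<lambda>x. conv \<phi> f x + conv \<phi> g x)"
    using conv_add[OF trig_polys_cont[OF add.hyps(1)] trig_polys_cont[OF add.hyps(2)]] by blast
  with add show ?case by (simp add: trig_polys.add)
next
  case (scale f a)
  have "conv \<phi> (\<lambda>x. a * f x) = (\<lambda>x. a * conv \<phi> f x)" using conv_scale by blast
  with scale show ?case by (simp add: trig_polys.scale)
qed

lemma conv_coeff_perp:
  assumes f: "f \<in> coeff_perp"
  shows "conv \<phi> f \<in> coeff_perp"
proof -
  have fc: "continuous_on UNIV f" using f by (simp add: coeff_perp_def)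
  have perp: "L2_inner f m = 0" if "m \<in> trig_polys" for m
    using that
    by (induction rule: trig_polys.induct)
      (use f in \<open>auto simp: coeff_perp_def L2_inner_add_right[OF trig_polys_cont trig_polys_cont fc] L2_inner_scale_right\<close>)
  have "L2_inner (conv \<phi> f) m = 0" if m: "m \<in> matrix_coeffs" for m
    using conv_symmetric[OF fc trig_polys_cont[OF trig_polys.coeff[OF m]]]
      perp[OF conv_trig_polys[OF trig_polys.coeff[OF m]]] by simp
  then show ?thesis using conv_cont[OF fc] by (simp add: coeff_perp_def)
qed

text \<open>An eigenspace of the squared convolution operator inside the orthogonal complement of the
  matrix coefficients would contain an irreducible representation, hence matrix coefficients.\<close>

lemma conv_perp_zero:
  assumes f: "f \<in> coeff_perp"
  shows "conv \<phi> f x = 0"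
proof (rule ccontr)
  assume nz: "conv \<phi> f x \<noteq> 0"
  obtain u s x1 where u: "u \<in> coeff_perp" "0 < s" "\<And>x. conv \<phi> (conv \<phi> u) x = complex_of_real s * u x" "u x1 \<noteq> 0"
    by (rule eigenfunction[OF coeff_perp_subspace conv_coeff_perp coeff_perp_closed f nz], assumption, assumption, assumption, rule that)
  define E where "E = {g \<in> coeff_perp. \<forall>x. conv \<phi> (conv \<phi> g) x = complex_of_real s * g x}"
  note P = left_invariant_subspaceD[OF coeff_perp_subspace]
  have Ec: "continuous_on UNIV g" "continuous_on UNIV (conv \<phi> g)" if "g \<in> E" for g
    using P(1) that conv_cont by (auto simp: E_def)
  have E: "left_invariant_subspace E"
    unfolding left_invariant_subspace_def
  proof (intro conjI ballI allI)
    fix g h a b assume g: "g \<in> E"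
    show "continuous_on UNIV g" using Ec g by blast
    have "conv \<phi> (\<lambda>x. a * g x) = (\<lambda>x. a * conv \<phi> g x)" using conv_scale by blast
    then show "(\<lambda>x. a * g x) \<in> E" using g P(4) by (auto simp: E_def conv_scale)
    have "conv \<phi> (\<lambda>x. g (b \<otimes> x)) = (\<lambda>x. conv \<phi> g (b \<otimes> x))" using conv_translate[OF Ec(1)[OF g]] by blast
    then show "(\<lambda>x. g (b \<otimes> x)) \<in> E" using g P(5) conv_translate[OF Ec(2)[OF g]] by (auto simp: E_def)
    assume h: "h \<in> E"
    have "conv \<phi> (\<lambda>x. g x + h x) = (\<lambda>x. conv \<phi> g x + conv \<phi> h x)"
      using conv_add[OF Ec(1)[OF g] Ec(1)[OF h]] by blast
    then show "(\<lambda>x. g x + h x) \<in> E"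
      using g h P(3) conv_add[OF Ec(2)[OF g] Ec(2)[OF h]] by (auto simp: E_def distrib_left)
  next
    have "conv \<phi> (\<lambda>x. 0) = (\<lambda>x. 0)" by (auto simp: conv_def)
    then show "(\<lambda>x. 0) \<in> E" using P(2) by (auto simp: E_def)
  qed
  have eig: "conv \<phi> (conv \<phi> g) x = complex_of_real s * g x" if "g \<in> E" for g x using that by (simp add: E_def)
  obtain N where N: "\<And>n f. orthonormal E n f \<Longrightarrow> n \<le> N"
    by (rule eigenspace_finite_dim[OF u(2) E eig], assumption, rule that)
  have uE: "u \<in> E" using u by (simp add: E_def)
  obtain W m h where W: "left_invariant_subspace W" "W \<subseteq> E" "0 < m" "orthonormal W m h"
    "\<And>g. \<not> orthonormal W (Suc m) g"
    "\<And>W' w x. left_invariant_subspace W' \<Longrightarrow> W' \<subseteq> W \<Longrightarrow> w \<in> W' \<Longrightarrow> w x \<noteq> 0 \<Longrightarrow> \<exists>g. orthonormal W' m g"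
    by (rule minimal_subspace[OF E uE u(4) N], assumption, rule that)
  obtain \<pi> where \<pi>: "\<pi> \<in> irreps G" "unitary_rep G \<pi> m"
    "\<And>j x. j < m \<Longrightarrow> h j x = (\<Sum>i<m. h i \<one> * \<pi> x $$ (j, i))"
    by (rule minimal_subspace_irrep[OF W(1,3,4,5,6)], assumption, assumption, assumption, assumption, rule that)
  \<comment> \<open>As an element of \<open>E\<close>, \<open>h 0\<close> is orthogonal to all
    coefficients, yet it is a combination of entries of \<open>\<pi>\<close>; its inner product with
    itself, which is 1, would vanish.\<close>
  have h0: "h 0 \<in> coeff_perp" using W(2,3,4) by (auto simp: orthonormal_def E_def)
  have "h 0 = (\<lambda>x. \<Sum>i<m. h i \<one> * \<pi> x $$ (0, i))" using \<pi>(3)[OF W(3)] by blast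
  then have "L2_inner (h 0) (h 0) = L2_inner (h 0) (\<lambda>x. \<Sum>i<m. h i \<one> * \<pi> x $$ (0, i))" by simp
  also have "\<dots> = (\<Sum>i<m. cnj (h i \<one>) * L2_inner (h 0) (\<lambda>x. \<pi> x $$ (0, i)))"
    using unitary_repD(3)[OF \<pi>(2) W(3)] P(1)[OF h0] by (intro L2_inner_sum_right) auto
  also have "\<dots> = 0" using h0 matrix_coeffsI[OF \<pi>(1,2) W(3)] by (simp add: coeff_perp_def)
  finally show False using W(3,4) by (simp add: orthonormal_def)
qed

end

section \<open>Density of trigonometric polynomials\<close>

context haar_group
begin

text \<open>A bump function at \<open>\<one>\<close>, symmetrised by adding its composition with the
  inverse and normalised to integral 1. It lives in a symmetric neighbourhood where, by compactness,
  \<open>f (x \<otimes> y)\<close> is close to \<open>f x\<close> for all \<open>x\<close> at once;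
  full support of the measure makes the normalising constant positive.\<close>

lemma approximate_identity:
  fixes f :: "'g \<Rightarrow> complex"
  assumes f: "continuous_on UNIV f" and e: "0 < e"
  obtains \<phi> where "conv_kernel G M \<phi>" "\<And>x. cmod (conv \<phi> f x - f x) \<le> e"
proof -
  have "continuous_on (UNIV \<times> UNIV) (\<lambda>(y, x). f (x \<otimes> y))"
    unfolding case_prod_beta by (intro continuous_on_compose2[OF f] continuous_intros) auto
  then obtain U where U: "\<one> \<in> U" "open U"
    "\<forall>y\<in>U \<inter> UNIV. \<forall>x\<in>UNIV. dist ((\<lambda>(y, x). f (x \<otimes> y)) (y, x)) ((\<lambda>(y, x). f (x \<otimes> y)) (\<one>, x)) \<le> e"
    by (rule continuous_on_prod_compactE[OF _ compact_UNIV UNIV_I[of \<one>] e]) (rule that)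
  define W where "W = U \<inter> (\<lambda>x. inv x) -` U"
  have "open W" unfolding W_def by (intro open_Int U open_vimage continuous_inv)
  have "\<one> \<in> W" using U(1) by (simp add: W_def)
  have Wsym: "inv y \<in> W \<longleftrightarrow> y \<in> W" for y by (auto simp: W_def)
  have cl: "closed (- W)" "closed {\<one>}" "- W \<inter> {\<one>} = {}" using \<open>open W\<close> \<open>\<one> \<in> W\<close> by (auto simp: closed_Compl)
  obtain \<psi> :: "'g \<Rightarrow> real" where \<psi>: "continuous_on UNIV \<psi>" "\<And>x. 0 \<le> \<psi> x" "\<And>x. \<psi> x \<le> 1"
    "\<And>x. x \<in> - W \<Longrightarrow> \<psi> x = 0" "\<And>x. x \<in> {\<one>} \<Longrightarrow> \<psi> x = 1"
    by (rule compact_Urysohn[OF compact_UNIV cl], rule that)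
  define \<psi>s where "\<psi>s y = \<psi> y + \<psi> (inv y)" for y
  have sc: "continuous_on UNIV \<psi>s"
    unfolding \<psi>s_def by (intro continuous_intros \<psi>(1) continuous_on_compose2[OF \<psi>(1) continuous_inv]) auto
  have s0: "0 \<le> \<psi>s y" for y using \<psi>(2) by (simp add: \<psi>s_def)
  define c where "c = (LINT y|M. \<psi>s y)"
  have c: "0 < c"
  proof (rule ccontr)
    assume "\<not> 0 < c"
    moreover have "0 \<le> c" unfolding c_def using s0 by (intro integral_nonneg_AE) auto
    ultimately have "(LINT y|M. \<psi>s y) = 0" by (simp add: c_def)
    then have "AE y in M. \<psi>s y = 0"
      using s0 continuous_integrable[OF sc] by (subst (asm) integral_nonneg_eq_0_iff_AE) auto
    then have "AE y in M. complex_of_real (\<psi>s y) = 0" by eventually_elim simp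
    then have "complex_of_real (\<psi>s \<one>) = 0"
      by (rule continuous_ae_zero[rotated]) (intro continuous_intros sc)
    then show False using \<psi>(5) by (simp add: \<psi>s_def)
  qed
  define \<phi> where "\<phi> y = \<psi>s y / c" for y
  have \<phi>c: "continuous_on UNIV \<phi>" unfolding \<phi>_def using c by (intro continuous_intros sc) auto
  have \<phi>1: "(LINT y|M. \<phi> y) = 1" unfolding \<phi>_def using c by (simp add: c_def)
  have ker: "conv_kernel G M \<phi>"
    by unfold_locales (auto simp: \<phi>c, simp add: \<phi>_def \<psi>s_def add.commute)
  have "cmod (conv \<phi> f x - f x) \<le> e" for x
  proof -
    have fx: "continuous_on UNIV (\<lambda>y. f (x \<otimes> y))" by (rule continuous_translate[OF f])
    have "f x = (LINT y|M. complex_of_real (\<phi> y) * f x)"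
      using \<phi>1 by simp
    then have "conv \<phi> f x - f x = (LINT y|M. complex_of_real (\<phi> y) * f (x \<otimes> y)) - (LINT y|M. complex_of_real (\<phi> y) * f x)"
      by (simp only: conv_alt[OF \<phi>c f])
    also have "\<dots> = (LINT y|M. complex_of_real (\<phi> y) * f (x \<otimes> y) - complex_of_real (\<phi> y) * f x)"
      by (intro Bochner_Integration.integral_diff[symmetric] continuous_integrable continuous_intros \<phi>c fx)
    also have "cmod \<dots> \<le> (LINT y|M. cmod (complex_of_real (\<phi> y) * f (x \<otimes> y) - complex_of_real (\<phi> y) * f x))"
      by (rule integral_norm_bound)
    also have "\<dots> \<le> (LINT y|M. \<phi> y * e)"
    proof (intro integral_mono)
      fix y
      have "cmod (complex_of_real (\<phi> y) * f (x \<otimes> y) - complex_of_real (\<phi> y) * f x) = \<phi> y * cmod (f (x \<otimes> y) - f x)"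
        using s0[of y] c by (simp add: right_diff_distrib[symmetric] norm_mult \<phi>_def del: of_real_divide)
      also have "\<dots> \<le> \<phi> y * e"
      proof (cases "y \<in> W")
        case True
        then have "cmod (f (x \<otimes> y) - f x) \<le> e" using U(3) by (auto simp: W_def dist_norm)
        then show ?thesis using s0[of y] c by (intro mult_left_mono) (auto simp: \<phi>_def)
      next
        case False
        then have "\<psi>s y = 0" using \<psi>(4) Wsym by (simp add: \<psi>s_def)
        then show ?thesis by (simp add: \<phi>_def)
      qed
      finally show "cmod (complex_of_real (\<phi> y) * f (x \<otimes> y) - complex_of_real (\<phi> y) * f x) \<le> \<phi> y * e" .
    qed (intro continuous_integrable continuous_intros \<phi>c fx)+
    also have "\<dots> = e" using \<phi>1 by simp
    finally show ?thesis .
  qed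
  with ker show ?thesis by (rule that)
qed

text \<open>Such an \<open>f\<close> is a uniform limit of its own convolutions, all of which vanish
  by \<open>conv_perp_zero\<close>.\<close>

lemma coeff_perp_trivial:
  assumes f: "f \<in> coeff_perp"
  shows "f x = 0"
proof -
  have fc: "continuous_on UNIV f" using f by (simp add: coeff_perp_def)
  have "cmod (f x) \<le> 0 + e" if e: "0 < e" for e
  proof -
    obtain \<phi> where \<phi>: "conv_kernel G M \<phi>" "\<And>x. cmod (conv \<phi> f x - f x) \<le> e"
      by (rule approximate_identity[OF fc e], rule that)
    show ?thesis using \<phi>(2)[of x] conv_kernel.conv_perp_zero[OF \<phi>(1) f, of x] by simp
  qed
  then have "cmod (f x) \<le> 0" by (rule field_le_epsilon)
  then show ?thesis by simp
qed

text \<open>Applied to \<open>g = f - m\<close> for a nearly best approximation \<open>m\<close> of \<open>f\<close>.\<close>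

lemma near_orthogonal:
  assumes g: "continuous_on UNIV g" and w: "continuous_on UNIV w" "L2_norm w \<noteq> 0"
    and best: "\<And>t. \<delta> \<le> (L2_norm (\<lambda>x. g x - t * w x))\<^sup>2"
    and near: "(L2_norm g)\<^sup>2 \<le> \<delta> + \<eta>"
  shows "(cmod (L2_inner g w))\<^sup>2 \<le> \<eta> * (L2_norm w)\<^sup>2"
proof -
  \<comment> \<open>The multiple of \<open>w\<close> closest to \<open>g\<close>.\<close>
  define t where "t = L2_inner g w / complex_of_real ((L2_norm w)\<^sup>2)"
  have tw: "continuous_on UNIV (\<lambda>x. t * w x)" by (intro continuous_intros w)
  have pos: "0 < (L2_norm w)\<^sup>2" using w(2) by simp
  have "cnj t * L2_inner g w = complex_of_real ((cmod (L2_inner g w))\<^sup>2 / (L2_norm w)\<^sup>2)"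
    unfolding t_def by (simp add: complex_norm_square mult.commute del: of_real_power)
  then have re: "Re (L2_inner g (\<lambda>x. t * w x)) = (cmod (L2_inner g w))\<^sup>2 / (L2_norm w)\<^sup>2"
    unfolding L2_inner_scale_right by (simp only: Re_complex_of_real)
  have "cmod t = cmod (L2_inner g w) / (L2_norm w)\<^sup>2" unfolding t_def norm_divide norm_of_real by simp
  then have "(cmod t * L2_norm w)\<^sup>2 = (cmod (L2_inner g w))\<^sup>2 / (L2_norm w)\<^sup>2"
    using w(2) by (simp add: power_mult_distrib power_divide power2_eq_square)
  then have "(L2_norm (\<lambda>x. t * w x))\<^sup>2 = (cmod (L2_inner g w))\<^sup>2 / (L2_norm w)\<^sup>2"
    by (simp add: Lp_norm_scale)
  then have "(L2_norm (\<lambda>x. g x - t * w x))\<^sup>2 = (L2_norm g)\<^sup>2 - (cmod (L2_inner g w))\<^sup>2 / (L2_norm w)\<^sup>2"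
    unfolding L2_norm_diff_sq[OF g tw] re by simp
  then have "(cmod (L2_inner g w))\<^sup>2 / (L2_norm w)\<^sup>2 \<le> \<eta>" using best[of t] near by simp
  then show ?thesis using pos by (simp add: divide_le_eq)
qed

lemma L2_parallelogram:
  assumes "continuous_on UNIV a" "continuous_on UNIV b"
  shows "(L2_norm (\<lambda>x. a x - b x))\<^sup>2 + (L2_norm (\<lambda>x. a x + b x))\<^sup>2 = 2 * (L2_norm a)\<^sup>2 + 2 * (L2_norm b)\<^sup>2"
proof -
  have nb: "continuous_on UNIV (\<lambda>x. - b x)" by (intro continuous_intros assms)
  have "L2_inner a (\<lambda>x. - b x) = - L2_inner a b" using L2_inner_scale_right[of a "-1" b] by simp
  moreover have "L2_norm (\<lambda>x. - b x) = L2_norm b" by (simp add: Lp_norm_def)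
  ultimately show ?thesis
    using L2_norm_diff_sq[OF assms] L2_norm_diff_sq[OF assms(1) nb] by simp
qed

end

context conv_kernel
begin

text \<open>The residuals \<open>g n\<close> of nearly best L2 approximations of \<open>f\<close>
  form an L2-Cauchy sequence, which may lack a continuous limit, but their convolutions converge
  uniformly to some \<open>h\<close>. Near-orthogonality and symmetry make \<open>h\<close>
  orthogonal to all coefficients, so it is 0, and the convolution of \<open>f\<close> is uniformly
  close to those of the approximants, which are trigonometric polynomials.\<close>

lemma conv_approx_trig:
  assumes f: "continuous_on UNIV f" and e: "0 < e"
  shows "\<exists>m\<in>trig_polys. \<forall>x. cmod (conv \<phi> f x - m x) \<le> e"
proof -
  note tc = trig_polys_cont
  obtain B where B: "0 < B" "\<And>f x. continuous_on UNIV f \<Longrightarrow> cmod (conv \<phi> f x) \<le> B * L2_norm f"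
    by (rule conv_bounded, rule that)
  define D where "D = (\<lambda>m. (L2_norm (\<lambda>x. f x - m x))\<^sup>2) ` trig_polys"
  define \<delta> where "\<delta> = Inf D"
  have D: "D \<noteq> {}" "bdd_below D" using trig_polys.zero by (auto simp: D_def intro!: bdd_belowI[of _ 0])
  have low: "\<delta> \<le> (L2_norm (\<lambda>x. f x - m x))\<^sup>2" if "m \<in> trig_polys" for m
    unfolding \<delta>_def using that by (intro cInf_lower D) (auto simp: D_def)
  have "\<exists>m. m \<in> trig_polys \<and> (L2_norm (\<lambda>x. f x - m x))\<^sup>2 < \<delta> + 1 / (real n + 1)" for n
  proof -
    have "Inf D < \<delta> + 1 / (real n + 1)" by (simp add: \<delta>_def)
    then show ?thesis using cInf_lessD[OF D(1)] unfolding D_def by blast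
  qed
  then obtain m where m: "\<And>n. m n \<in> trig_polys" "\<And>n. (L2_norm (\<lambda>x. f x - m n x))\<^sup>2 < \<delta> + 1 / (real n + 1)"
    by metis
  define g where "g n x = f x - m n x" for n x
  have gc: "continuous_on UNIV (g n)" for n unfolding g_def by (intro continuous_intros f tc m)
  have cauchy: "(L2_norm (\<lambda>x. g n x - g k x))\<^sup>2 \<le> 2 / (real n + 1) + 2 / (real k + 1)" for n k
  proof -
    \<comment> \<open>The midpoint of two approximants is again a competitor, so the parallelogram
      law bounds the distance of the residuals by their excess over the infimum.\<close>
    define a where "a x = (1/2) * (m n x + m k x)" for x
    have "a \<in> trig_polys" unfolding a_def by (intro trig_polys.scale trig_polys.add m)
    then have "\<delta> \<le> (L2_norm (\<lambda>x. f x - a x))\<^sup>2" by (rule low)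
    moreover have sumeq: "(\<lambda>x. g n x + g k x) = (\<lambda>x. 2 * (f x - a x))" by (auto simp: g_def a_def algebra_simps)
    then have "(L2_norm (\<lambda>x. g n x + g k x))\<^sup>2 = 4 * (L2_norm (\<lambda>x. f x - a x))\<^sup>2"
      by (subst sumeq, subst Lp_norm_scale) (simp_all add: power_mult_distrib)
    moreover have "(L2_norm (g n))\<^sup>2 < \<delta> + 1 / (real n + 1)" "(L2_norm (g k))\<^sup>2 < \<delta> + 1 / (real k + 1)"
      using m(2) by (simp_all add: g_def[abs_def])
    ultimately show ?thesis using L2_parallelogram[OF gc gc, of n k] by simp
  qed
  have "uniformly_Cauchy_on UNIV (\<lambda>n. conv \<phi> (g n))"
    unfolding uniformly_Cauchy_on_def
  proof (intro allI impI)
    fix e :: real assume e: "0 < e"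
    obtain N where N: "real N > 4 * B\<^sup>2 / e\<^sup>2" using reals_Archimedean2 by blast
    show "\<exists>N. \<forall>x\<in>UNIV. \<forall>n\<ge>N. \<forall>k\<ge>N. dist (conv \<phi> (g n) x) (conv \<phi> (g k) x) < e"
    proof (intro exI[of _ N] ballI allI impI)
      fix x n k assume nk: "N \<le> n" "N \<le> k"
      have "2 / (real n + 1) \<le> 2 / (real N + 1)" "2 / (real k + 1) \<le> 2 / (real N + 1)"
        using nk by (auto intro!: divide_left_mono)
      then have "(L2_norm (\<lambda>x. g n x - g k x))\<^sup>2 \<le> 4 / (real N + 1)" using cauchy[of n k] by simp
      then have "B\<^sup>2 * (L2_norm (\<lambda>x. g n x - g k x))\<^sup>2 \<le> B\<^sup>2 * (4 / (real N + 1))" by (intro mult_left_mono) auto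
      also have "\<dots> < e\<^sup>2"
      proof -
        have "4 * B\<^sup>2 < real N * e\<^sup>2" using N e by (simp add: divide_less_eq)
        also have "\<dots> \<le> (real N + 1) * e\<^sup>2" by (intro mult_right_mono) auto
        finally show ?thesis by (simp add: divide_less_eq mult_ac)
      qed
      finally have "(B * L2_norm (\<lambda>x. g n x - g k x))\<^sup>2 < e\<^sup>2" by (simp add: power_mult_distrib)
      then have "B * L2_norm (\<lambda>x. g n x - g k x) < e" using e by (intro power_less_imp_less_base[of _ 2 e]) auto
      moreover have "cmod (conv \<phi> (\<lambda>x. g n x - g k x) x) \<le> B * L2_norm (\<lambda>x. g n x - g k x)"
        by (intro B continuous_intros gc)
      ultimately show "dist (conv \<phi> (g n) x) (conv \<phi> (g k) x) < e" by (simp add: dist_norm conv_diff[OF gc gc])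
    qed
  qed
  then obtain h where h: "uniform_limit UNIV (\<lambda>n. conv \<phi> (g n)) h sequentially"
    using Cauchy_uniformly_convergent unfolding uniformly_convergent_on_def by blast
  have hc: "continuous_on UNIV h" using conv_cont[OF gc] by (intro uniform_limit_theorem[OF _ h]) auto
  have small: "(\<lambda>n. L2_inner (g n) w) \<longlonglongrightarrow> 0" if w: "w \<in> trig_polys" for w
  proof (cases "L2_norm w = 0")
    case True
    then have "w = (\<lambda>x. 0)" using L2_norm_zero[OF tc[OF w]] by blast
    then show ?thesis by simp
  next
    case False
    show ?thesis
    proof (rule Lim_null_comparison)
      have "cmod (L2_inner (g n) w) \<le> sqrt (1 / (real n + 1) * (L2_norm w)\<^sup>2)" for n
      proof (rule real_le_rsqrt, rule near_orthogonal[OF gc tc[OF w] False])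
        show "\<delta> \<le> (L2_norm (\<lambda>x. g n x - t * w x))\<^sup>2" for t
          using low[OF trig_polys.add[OF m(1)[of n] trig_polys.scale[OF w, of t]]] by (simp add: g_def algebra_simps)
        show "(L2_norm (g n))\<^sup>2 \<le> \<delta> + 1 / (real n + 1)" using m(2)[of n] by (simp add: g_def[abs_def])
      qed
      then show "\<forall>\<^sub>F n in sequentially. cmod (L2_inner (g n) w) \<le> sqrt (1 / (real n + 1) * (L2_norm w)\<^sup>2)" by simp
      have "(\<lambda>n. 1 / (real n + 1)) \<longlonglongrightarrow> 0" using LIMSEQ_Suc[OF lim_1_over_n] by (simp add: add.commute)
      then have "(\<lambda>n. sqrt (1 / (real n + 1) * (L2_norm w)\<^sup>2)) \<longlonglongrightarrow> sqrt (0 * (L2_norm w)\<^sup>2)" by (intro tendsto_intros)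
      then show "(\<lambda>n. sqrt (1 / (real n + 1) * (L2_norm w)\<^sup>2)) \<longlonglongrightarrow> 0" by simp
    qed
  qed
  have "L2_inner h w = 0" if "w \<in> matrix_coeffs" for w
  proof -
    have w: "w \<in> trig_polys" using that by (rule trig_polys.coeff)
    have "(\<lambda>n. L2_inner (conv \<phi> (g n)) w) \<longlonglongrightarrow> L2_inner h w"
      by (rule L2_inner_uniform_limit[OF conv_cont[OF gc] h tc[OF w]])
    moreover have "(\<lambda>n. L2_inner (conv \<phi> (g n)) w) \<longlonglongrightarrow> 0"
      unfolding conv_symmetric[OF gc tc[OF w]] by (rule small[OF conv_trig_polys[OF w]])
    ultimately show ?thesis by (rule LIMSEQ_unique)
  qed
  then have "h x = 0" for x using hc by (intro coeff_perp_trivial) (simp add: coeff_perp_def)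
  then have "\<forall>\<^sub>F n in sequentially. \<forall>x\<in>UNIV. cmod (conv \<phi> (g n) x) < e"
    using uniform_limitD[OF h e] by simp
  then obtain n where n: "\<And>x. cmod (conv \<phi> (g n) x) < e" by (auto simp: eventually_sequentially)
  have "conv \<phi> (g n) x = conv \<phi> f x - conv \<phi> (m n) x" for x
    unfolding g_def by (rule conv_diff[OF f tc[OF m(1)]])
  with n have "\<forall>x. cmod (conv \<phi> f x - conv \<phi> (m n) x) \<le> e" by (simp add: less_imp_le)
  then show ?thesis using conv_trig_polys[OF m(1)] by blast
qed

end

context haar_group
begin

text \<open>Three errors: from \<open>f\<close> to a continuous \<open>h\<close>, from
  \<open>h\<close> to a convolution of \<open>h\<close>, and from there to a trigonometric
  polynomial. The last two are uniform and hence small in every Lp.\<close>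

theorem peter_weyl:
  assumes p: "1 \<le> p" and f: "f \<in> Lp_space p M" and e: "0 < e"
  obtains m where "m \<in> trig_polys" "Lp_norm p M (\<lambda>x. f x - m x) < e"
proof -
  have e3: "0 < e / 3" using e by simp
  obtain h where h: "continuous_on UNIV h" "Lp_norm p M (\<lambda>x. f x - h x) < e / 3"
    by (rule continuous_dense_Lp[OF p f e3], rule that)
  obtain \<phi> where \<phi>: "conv_kernel G M \<phi>" "\<And>x. cmod (conv \<phi> h x - h x) \<le> e / 3"
    by (rule approximate_identity[OF h(1) e3], rule that)
  obtain m where m: "m \<in> trig_polys" "\<And>x. cmod (conv \<phi> h x - m x) \<le> e / 3"
    using conv_kernel.conv_approx_trig[OF \<phi>(1) h(1) e3] by blast
  have cc: "continuous_on UNIV (conv \<phi> h)" by (rule conv_kernel.conv_cont[OF \<phi>(1) h(1)])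
  have Lp: "h \<in> Lp_space p M" "conv \<phi> h \<in> Lp_space p M" "m \<in> Lp_space p M"
    by (intro continuous_Lp p h(1) cc trig_polys_cont m(1))+
  have "Lp_norm p M (\<lambda>x. conv \<phi> h x - h x) \<le> e / 3" using \<phi>(2) e by (intro Lp_norm_bounded p) auto
  moreover have "Lp_norm p M (\<lambda>x. conv \<phi> h x - m x) \<le> e / 3" using m(2) e by (intro Lp_norm_bounded p) auto
  moreover have "Lp_norm p M (\<lambda>x. h x - m x) \<le> Lp_norm p M (\<lambda>x. h x - conv \<phi> h x) + Lp_norm p M (\<lambda>x. conv \<phi> h x - m x)"
    by (rule Lp_norm_triangle_diff[OF p Lp])
  moreover have "Lp_norm p M (\<lambda>x. f x - m x) \<le> Lp_norm p M (\<lambda>x. f x - h x) + Lp_norm p M (\<lambda>x. h x - m x)"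
    by (rule Lp_norm_triangle_diff[OF p f Lp(1,3)])
  ultimately have "Lp_norm p M (\<lambda>x. f x - m x) < e"
    using h(2) Lp_norm_minus_commute[of p M h "conv \<phi> h"] by simp
  with m(1) show ?thesis by (rule that)
qed

end

section \<open>Schur orthogonality\<close>

lemma smult_one_mult:
  fixes A :: "complex mat"
  assumes "A \<in> carrier_mat m n"
  shows "(a \<cdot>\<^sub>m 1\<^sub>m m) * A = a \<cdot>\<^sub>m A" "A * (a \<cdot>\<^sub>m 1\<^sub>m n) = a \<cdot>\<^sub>m A"
  using assms by (auto simp: mult_smult_distrib[of _ m n _ n] mult_smult_assoc_mat[of _ m m _ n])

context haar_group
begin

lemma irreps_unitary_rep:
  assumes "\<xi> \<in> irreps G"
  shows "unitary_rep G \<xi> (rep_dim G \<xi>)" "0 < rep_dim G \<xi>"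
proof -
  obtain d where d: "0 < d" "unitary_rep G \<xi> d" using assms unfolding irreps_def by blast
  then have "rep_dim G \<xi> = d" using unitary_repD(1)[OF d(2)] unfolding rep_dim_def by blast
  with d show "unitary_rep G \<xi> (rep_dim G \<xi>)" "0 < rep_dim G \<xi>" by auto
qed

lemma irreps_carrier:
  assumes "\<xi> \<in> irreps G" "rep_dim G \<xi> = d"
  shows "\<xi> x \<in> carrier_mat d d"
  using unitary_repD(1)[OF irreps_unitary_rep(1)[OF assms(1)]] assms(2) by blast

lemma irreps_irreducible:
  assumes "\<xi> \<in> irreps G" "linear_subspace (rep_dim G \<xi>) W" "\<And>x w. w \<in> W \<Longrightarrow> \<xi> x *\<^sub>v w \<in> W"
  shows "W = {0\<^sub>v (rep_dim G \<xi>)} \<or> W = carrier_vec (rep_dim G \<xi>)"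
proof -
  obtain d where d: "unitary_rep G \<xi> d"
    "\<And>W. linear_subspace d W \<and> (\<forall>x. \<forall>w\<in>W. \<xi> x *\<^sub>v w \<in> W) \<Longrightarrow> W = {0\<^sub>v d} \<or> W = carrier_vec d"
    using assms(1) unfolding irreps_def by blast
  have "rep_dim G \<xi> = d" using unitary_repD(1)[OF d(1)] unfolding rep_dim_def by blast
  with d(2)[of W] assms(2,3) show ?thesis by auto
qed

lemma unitary_rep_adjoint:
  assumes \<xi>: "unitary_rep G \<xi> d" and "i < d" "j < d"
  shows "(\<Sum>k<d. cnj (\<xi> x $$ (k, i)) * \<xi> x $$ (k, j)) = (if i = j then 1 else 0)"
proof -
  have "mat_adjoint (\<xi> x) * \<xi> x = 1\<^sub>m d" using \<xi> by (simp add: unitary_rep_def)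
  then show ?thesis
    using adjoint_mult_index[OF unitary_repD(1)[OF \<xi>] unitary_repD(1)[OF \<xi>] assms(2,3), of x x] assms(2,3) by simp
qed

lemma unitary_rep_bound:
  assumes \<xi>: "unitary_rep G \<xi> d" and ij: "i < d" "j < d"
  shows "cmod (\<xi> x $$ (i, j)) \<le> 1"
proof -
  have "complex_of_real (\<Sum>k<d. (cmod (\<xi> x $$ (k, j)))\<^sup>2) = (\<Sum>k<d. cnj (\<xi> x $$ (k, j)) * \<xi> x $$ (k, j))"
    by (simp add: complex_norm_square mult.commute del: of_real_power)
  also have "\<dots> = complex_of_real 1" using unitary_rep_adjoint[OF \<xi> ij(2) ij(2)] by simp
  finally have "(\<Sum>k<d. (cmod (\<xi> x $$ (k, j)))\<^sup>2) = 1" using of_real_eq_iff by blast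
  moreover have "(cmod (\<xi> x $$ (i, j)))\<^sup>2 \<le> (\<Sum>k<d. (cmod (\<xi> x $$ (k, j)))\<^sup>2)"
    using ij by (intro member_le_sum) auto
  ultimately show ?thesis by (simp add: power_le_one_iff abs_square_le_1)
qed

text \<open>Over the complex numbers \<open>S\<close> has an eigenvalue; its eigenspace is invariant
  and nonzero, hence the whole space.\<close>

lemma schur_commutant:
  assumes \<xi>: "\<xi> \<in> irreps G" and S: "S \<in> carrier_mat (rep_dim G \<xi>) (rep_dim G \<xi>)"
    and comm: "\<And>x. S * \<xi> x = \<xi> x * S"
  obtains z where "S = z \<cdot>\<^sub>m 1\<^sub>m (rep_dim G \<xi>)"
proof -
  define d where "d = rep_dim G \<xi>"
  have S: "S \<in> carrier_mat d d" and d: "0 < d" and rep: "unitary_rep G \<xi> d"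
    using S irreps_unitary_rep[OF \<xi>] by (auto simp: d_def)
  have \<xi>c: "\<xi> x \<in> carrier_mat d d" for x by (rule unitary_repD(1)[OF rep])
  obtain z where "eigenvalue S z" using spectrum_non_empty[OF S d] by (auto simp: spectrum_def)
  then obtain v where v: "v \<in> carrier_vec d" "v \<noteq> 0\<^sub>v d" "S *\<^sub>v v = z \<cdot>\<^sub>v v"
    using S by (auto simp: eigenvalue_def eigenvector_def)
  define W where "W = {w \<in> carrier_vec d. S *\<^sub>v w = z \<cdot>\<^sub>v w}"
  have W: "linear_subspace d W"
    unfolding linear_subspace_def W_def using S
    by (auto simp: mult_add_distrib_mat_vec smult_add_distrib_vec mult_mat_vec smult_smult_assoc mult.commute)
  have inv: "\<xi> x *\<^sub>v w \<in> W" if "w \<in> W" for x w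
  proof -
    have w: "w \<in> carrier_vec d" "S *\<^sub>v w = z \<cdot>\<^sub>v w" using that by (auto simp: W_def)
    have "S *\<^sub>v (\<xi> x *\<^sub>v w) = (S * \<xi> x) *\<^sub>v w" by (rule assoc_mult_mat_vec[OF S \<xi>c w(1), symmetric])
    also have "\<dots> = \<xi> x *\<^sub>v (S *\<^sub>v w)" unfolding comm by (rule assoc_mult_mat_vec[OF \<xi>c S w(1)])
    also have "\<dots> = z \<cdot>\<^sub>v (\<xi> x *\<^sub>v w)" unfolding w(2) by (rule mult_mat_vec[OF \<xi>c w(1)])
    finally show ?thesis using \<xi>c[of x] w(1) by (simp add: W_def)
  qed
  have "W = {0\<^sub>v d} \<or> W = carrier_vec d"
    unfolding d_def by (rule irreps_irreducible[OF \<xi> W[unfolded d_def] inv])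
  moreover have "v \<in> W" using v by (simp add: W_def)
  ultimately have "W = carrier_vec d" using v(2) by blast
  then have "unit_vec d j \<in> W" for j by simp
  then have unit: "S *\<^sub>v unit_vec d j = z \<cdot>\<^sub>v unit_vec d j" for j unfolding W_def by blast
  have "S = z \<cdot>\<^sub>m 1\<^sub>m d"
  proof (rule eq_matI)
    fix i j assume "i < dim_row (z \<cdot>\<^sub>m 1\<^sub>m d :: complex mat)" "j < dim_col (z \<cdot>\<^sub>m 1\<^sub>m d :: complex mat)"
    then have ij: "i < d" "j < d" by auto
    have "S $$ (i, j) = (S *\<^sub>v unit_vec d j) $ i" using S ij by simp
    also have "\<dots> = (z \<cdot>\<^sub>v unit_vec d j) $ i" by (simp only: unit)
    finally show "S $$ (i, j) = (z \<cdot>\<^sub>m 1\<^sub>m d) $$ (i, j)" using ij by (auto simp: unit_vec_def)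
  qed (use S in auto)
  then show ?thesis using that by (simp add: d_def)
qed

text \<open>\<open>avg \<xi> \<eta> j l\<close> is the average of \<open>\<xi>(x) E\<^sub>j\<^sub>l \<eta>(x)\<^sup>*\<close> over the group, an intertwiner.\<close>

definition avg :: "('g \<Rightarrow> complex mat) \<Rightarrow> ('g \<Rightarrow> complex mat) \<Rightarrow> nat \<Rightarrow> nat \<Rightarrow> complex mat" where
  "avg \<xi> \<eta> j l = mat (rep_dim G \<xi>) (rep_dim G \<eta>)
     (\<lambda>(i, k). L2_inner (\<lambda>x. \<xi> x $$ (i, j)) (\<lambda>x. \<eta> x $$ (k, l)))"

lemma avg_carrier [simp]: "avg \<xi> \<eta> j l \<in> carrier_mat (rep_dim G \<xi>) (rep_dim G \<eta>)"
  by (simp add: avg_def)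

lemma avg_intertwines:
  assumes \<xi>: "\<xi> \<in> irreps G" and \<eta>: "\<eta> \<in> irreps G" and jl: "j < rep_dim G \<xi>" "l < rep_dim G \<eta>"
  shows "\<xi> g * avg \<xi> \<eta> j l = avg \<xi> \<eta> j l * \<eta> g"
proof (rule eq_matI)
  note r = irreps_unitary_rep(1)[OF \<xi>] and s = irreps_unitary_rep(1)[OF \<eta>]
  let ?d = "rep_dim G \<xi>" and ?e = "rep_dim G \<eta>"
  note rc = unitary_repD(3)[OF r] and sc = unitary_repD(3)[OF s]
  fix i k assume "i < dim_row (avg \<xi> \<eta> j l * \<eta> g)" "k < dim_col (avg \<xi> \<eta> j l * \<eta> g)"
  then have ik: "i < ?d" "k < ?e" using unitary_repD(1)[OF s, of g] by (auto simp: avg_def)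
  have "(\<xi> g * avg \<xi> \<eta> j l) $$ (i, k) =
      (\<Sum>a<?d. \<xi> g $$ (i, a) * L2_inner (\<lambda>x. \<xi> x $$ (a, j)) (\<lambda>x. \<eta> x $$ (k, l)))"
    unfolding mat_mult_index[OF unitary_repD(1)[OF r] avg_carrier ik] using ik by (simp add: avg_def)
  also have "\<dots> = L2_inner (\<lambda>x. \<xi> (g \<otimes> x) $$ (i, j)) (\<lambda>x. \<eta> x $$ (k, l))"
    unfolding unitary_repD(4)[OF r ik(1) jl(1)]
    using rc[OF _ jl(1)] sc[OF ik(2) jl(2)] by (intro L2_inner_sum_left[symmetric]) auto
  \<comment> \<open>Unitarity of \<open>\<eta> g\<close> writes \<open>\<eta> x\<close> as its
    adjoint times \<open>\<eta> (g \<otimes> x)\<close>. Both factors then depend on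
    \<open>g \<otimes> x\<close> alone and the translation can be removed.\<close>
  also have "(\<lambda>x. \<eta> x $$ (k, l)) = (\<lambda>x. \<Sum>b<?e. cnj (\<eta> g $$ (b, k)) * \<eta> (g \<otimes> x) $$ (b, l))"
  proof
    fix x
    have "(\<Sum>b<?e. cnj (\<eta> g $$ (b, k)) * \<eta> (g \<otimes> x) $$ (b, l)) =
        (\<Sum>b<?e. \<Sum>c<?e. cnj (\<eta> g $$ (b, k)) * \<eta> g $$ (b, c) * \<eta> x $$ (c, l))"
      using jl(2) by (intro sum.cong refl) (simp add: unitary_repD(4)[OF s] sum_distrib_left mult.assoc)
    also have "\<dots> = (\<Sum>c<?e. (\<Sum>b<?e. cnj (\<eta> g $$ (b, k)) * \<eta> g $$ (b, c)) * \<eta> x $$ (c, l))"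
      unfolding sum_distrib_right by (rule sum.swap)
    also have "\<dots> = (\<Sum>c<?e. if c = k then \<eta> x $$ (c, l) else 0)"
      using unitary_rep_adjoint[OF s ik(2)] by (intro sum.cong refl) auto
    also have "\<dots> = \<eta> x $$ (k, l)" using ik(2) by simp
    finally show "\<eta> x $$ (k, l) = (\<Sum>b<?e. cnj (\<eta> g $$ (b, k)) * \<eta> (g \<otimes> x) $$ (b, l))" by simp
  qed
  also have "L2_inner (\<lambda>x. \<xi> (g \<otimes> x) $$ (i, j)) (\<lambda>x. \<Sum>b<?e. cnj (\<eta> g $$ (b, k)) * \<eta> (g \<otimes> x) $$ (b, l)) =
      (\<Sum>b<?e. \<eta> g $$ (b, k) * L2_inner (\<lambda>x. \<xi> (g \<otimes> x) $$ (i, j)) (\<lambda>x. \<eta> (g \<otimes> x) $$ (b, l)))"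
    using continuous_translate[OF rc[OF ik(1) jl(1)], of g] continuous_translate[OF sc[OF _ jl(2)], of _ g]
    by (subst L2_inner_sum_right) auto
  also have "\<dots> = (\<Sum>b<?e. \<eta> g $$ (b, k) * L2_inner (\<lambda>x. \<xi> x $$ (i, j)) (\<lambda>x. \<eta> x $$ (b, l)))"
    using L2_inner_translate[OF rc[OF ik(1) jl(1)] sc[OF _ jl(2)], of _ g] by simp
  also have "\<dots> = (avg \<xi> \<eta> j l * \<eta> g) $$ (i, k)"
    unfolding mat_mult_index[OF avg_carrier unitary_repD(1)[OF s] ik] using ik by (simp add: avg_def mult.commute)
  finally show "(\<xi> g * avg \<xi> \<eta> j l) $$ (i, k) = (avg \<xi> \<eta> j l * \<eta> g) $$ (i, k)" .
qed (use unitary_repD(1)[OF irreps_unitary_rep(1)[OF \<xi>], of g] unitary_repD(1)[OF irreps_unitary_rep(1)[OF \<eta>], of g]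
  in \<open>auto simp: avg_def\<close>)

text \<open>The average is a scalar matrix by Schur's lemma; summing its diagonal entries and using
  unitarity under the integral determines the scalar.\<close>

lemma schur_orthogonality:
  assumes \<xi>: "\<xi> \<in> irreps G" and ij: "i < rep_dim G \<xi>" "j < rep_dim G \<xi>" "k < rep_dim G \<xi>" "l < rep_dim G \<xi>"
  shows "L2_inner (\<lambda>x. \<xi> x $$ (i, j)) (\<lambda>x. \<xi> x $$ (k, l)) =
    (if i = k \<and> j = l then 1 / of_nat (rep_dim G \<xi>) else 0)"
proof -
  let ?d = "rep_dim G \<xi>"
  note r = irreps_unitary_rep[OF \<xi>]
  obtain a where a: "avg \<xi> \<xi> j l = a \<cdot>\<^sub>m 1\<^sub>m ?d"
    by (rule schur_commutant[OF \<xi> avg_carrier avg_intertwines[OF \<xi> \<xi> ij(2,4), symmetric]], rule that)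
  have entry: "L2_inner (\<lambda>x. \<xi> x $$ (i, j)) (\<lambda>x. \<xi> x $$ (k, l)) = (if i = k then a else 0)"
    if "i < ?d" "k < ?d" for i k
    using arg_cong[OF a, of "\<lambda>S. S $$ (i, k)"] that by (simp add: avg_def)
  have "of_nat ?d * a = (\<Sum>b<?d. L2_inner (\<lambda>x. \<xi> x $$ (b, j)) (\<lambda>x. \<xi> x $$ (b, l)))"
    using entry by simp
  also have "\<dots> = (LINT x|M. (\<Sum>b<?d. \<xi> x $$ (b, j) * cnj (\<xi> x $$ (b, l))))"
    unfolding L2_inner_def using unitary_repD(3)[OF r(1) _ ij(2)] unitary_repD(3)[OF r(1) _ ij(4)]
    by (intro Bochner_Integration.integral_sum[symmetric] L2_integrable) auto
  also have "\<dots> = (LINT x|M. (if l = j then 1 else 0))"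
    using unitary_rep_adjoint[OF r(1) ij(4,2)] by (simp add: mult.commute)
  also have "\<dots> = (if l = j then 1 else 0)" using prob_space by simp
  finally have "a = (if l = j then 1 / of_nat ?d else 0)" using r(2) by (auto simp: field_simps)
  then show ?thesis using entry[OF ij(1,3)] by auto
qed

text \<open>Let T be a nonzero average and T' its adjoint. By Schur's lemma T T' and T' T are
  scalar, both have the squared Hilbert-Schmidt norm of T as trace, and associativity of T T' T
  equates the two scalars. Hence the dimensions agree and T' is an invertible intertwiner.\<close>

lemma schur_inequivalent:
  assumes \<xi>: "\<xi> \<in> irreps G" and \<eta>: "\<eta> \<in> irreps G" and neq: "(\<xi>, \<eta>) \<notin> rep_equiv G"
    and ij: "i < rep_dim G \<xi>" "j < rep_dim G \<xi>" "k < rep_dim G \<eta>" "l < rep_dim G \<eta>"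
  shows "L2_inner (\<lambda>x. \<xi> x $$ (i, j)) (\<lambda>x. \<eta> x $$ (k, l)) = 0"
proof (rule ccontr)
  assume nz: "L2_inner (\<lambda>x. \<xi> x $$ (i, j)) (\<lambda>x. \<eta> x $$ (k, l)) \<noteq> 0"
  let ?d = "rep_dim G \<xi>" and ?e = "rep_dim G \<eta>"
  note r = irreps_unitary_rep[OF \<xi>] and s = irreps_unitary_rep[OF \<eta>]
  note rc = unitary_repD(1)[OF r(1)] and sc = unitary_repD(1)[OF s(1)]
  define T where "T = avg \<xi> \<eta> j l"
  define T' where "T' = avg \<eta> \<xi> l j"
  have T: "T \<in> carrier_mat ?d ?e" and T': "T' \<in> carrier_mat ?e ?d" by (auto simp: T_def T'_def)
  have T'T: "T' $$ (b, a) = cnj (T $$ (a, b))" if "a < ?d" "b < ?e" for a b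
    using that by (simp add: T_def T'_def avg_def L2_inner_cnj)
  have i1: "\<xi> g * T = T * \<eta> g" for g unfolding T_def by (rule avg_intertwines[OF \<xi> \<eta> ij(2,4)])
  have i2: "\<eta> g * T' = T' * \<xi> g" for g unfolding T'_def by (rule avg_intertwines[OF \<eta> \<xi> ij(4,2)])
  have TT': "T * T' \<in> carrier_mat ?d ?d" and TT: "T' * T \<in> carrier_mat ?e ?e" using T T' by auto
  have c1: "T * T' * \<xi> g = \<xi> g * (T * T')" for g
  proof -
    have "T * T' * \<xi> g = T * (T' * \<xi> g)" by (rule assoc_mult_mat[OF T T' rc])
    also have "\<dots> = T * \<eta> g * T'" unfolding i2[symmetric] by (rule assoc_mult_mat[OF T sc T', symmetric])
    also have "\<dots> = \<xi> g * (T * T')" unfolding i1[symmetric] by (rule assoc_mult_mat[OF rc T T'])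
    finally show ?thesis .
  qed
  have c2: "T' * T * \<eta> g = \<eta> g * (T' * T)" for g
  proof -
    have "T' * T * \<eta> g = T' * (T * \<eta> g)" by (rule assoc_mult_mat[OF T' T sc])
    also have "\<dots> = T' * \<xi> g * T" unfolding i1[symmetric] by (rule assoc_mult_mat[OF T' rc T, symmetric])
    also have "\<dots> = \<eta> g * (T' * T)" unfolding i2[symmetric] by (rule assoc_mult_mat[OF sc T' T])
    finally show ?thesis .
  qed
  obtain a where a: "T * T' = a \<cdot>\<^sub>m 1\<^sub>m ?d" by (rule schur_commutant[OF \<xi> TT' c1], rule that)
  obtain b where b: "T' * T = b \<cdot>\<^sub>m 1\<^sub>m ?e" by (rule schur_commutant[OF \<eta> TT c2], rule that)
  define N where "N = (\<Sum>u<?d. \<Sum>v<?e. (cmod (T $$ (u, v)))\<^sup>2)"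
  have "T $$ (i, k) \<noteq> 0" using nz ij by (simp add: T_def avg_def)
  then have "0 < (\<Sum>v<?e. (cmod (T $$ (i, v)))\<^sup>2)" using ij by (rule_tac sum_pos2[of _ k]) auto
  then have N: "0 < N" unfolding N_def using ij by (rule_tac sum_pos2[of _ i]) (auto intro: sum_nonneg)
  have "of_nat ?d * a = (\<Sum>u<?d. (T * T') $$ (u, u))" by (simp add: a)
  also have "\<dots> = complex_of_real N"
    unfolding N_def of_real_sum
    by (intro sum.cong refl) (simp add: mat_mult_index[OF T T'] T'T complex_norm_square del: of_real_power)
  finally have da: "of_nat ?d * a = complex_of_real N" .
  have "of_nat ?e * b = (\<Sum>v<?e. (T' * T) $$ (v, v))" by (simp add: b)
  also have "\<dots> = (\<Sum>v<?e. \<Sum>u<?d. complex_of_real ((cmod (T $$ (u, v)))\<^sup>2))"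
    by (intro sum.cong refl) (simp add: mat_mult_index[OF T' T] T'T complex_norm_square mult.commute del: of_real_power)
  also have "\<dots> = complex_of_real N"
    unfolding N_def of_real_sum by (rule sum.swap)
  finally have eb: "of_nat ?e * b = complex_of_real N" .
  have "a \<cdot>\<^sub>m T = b \<cdot>\<^sub>m T"
    using assoc_mult_mat[OF T T' T] unfolding a b smult_one_mult[OF T] .
  then have "(a \<cdot>\<^sub>m T) $$ (i, k) = (b \<cdot>\<^sub>m T) $$ (i, k)" by simp
  then have ab: "a = b" using T ij \<open>T $$ (i, k) \<noteq> 0\<close> by simp
  have b0: "b \<noteq> 0" using eb N by auto
  have "of_nat ?d * a = of_nat ?e * a" using da eb ab by simp
  then have de: "?d = ?e" using b0 ab by simp
  have sm: "(1 / b) \<cdot>\<^sub>m (b \<cdot>\<^sub>m 1\<^sub>m m) = 1\<^sub>m m" for m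
    by (rule eq_matI) (auto simp: b0)
  have "invertible_mat T'"
    unfolding invertible_mat_def
  proof (intro conjI exI)
    show "square_mat T'" using T' de by simp
    show "inverts_mat T' ((1 / b) \<cdot>\<^sub>m T)"
      using T T' b b0 mult_smult_distrib[OF T' T, of "1 / b"] by (simp add: inverts_mat_def sm)
    show "inverts_mat ((1 / b) \<cdot>\<^sub>m T) T'"
      using T T' a ab b0 mult_smult_assoc_mat[OF T T', of "1 / b"] by (simp add: inverts_mat_def sm)
  qed
  moreover have "T' \<in> carrier_mat ?d ?d" using T' de by simp
  ultimately have "(\<xi>, \<eta>) \<in> rep_equiv G"
    unfolding rep_equiv_def using \<xi> \<eta> de i2[symmetric] by auto
  with neq show False by simp
qed

lemma rep_equivE:
  assumes "(\<xi>, \<eta>) \<in> rep_equiv G"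
  obtains T S d where "\<xi> \<in> irreps G" "\<eta> \<in> irreps G" "rep_dim G \<xi> = d" "rep_dim G \<eta> = d"
    "T \<in> carrier_mat d d" "S \<in> carrier_mat d d" "T * S = 1\<^sub>m d" "S * T = 1\<^sub>m d" "\<And>x. T * \<xi> x = \<eta> x * T"
proof -
  obtain T where T: "T \<in> carrier_mat (rep_dim G \<xi>) (rep_dim G \<xi>)" "invertible_mat T" "\<And>x. T * \<xi> x = \<eta> x * T"
    using assms by (auto simp: rep_equiv_def)
  obtain S where S: "T * S = 1\<^sub>m (rep_dim G \<xi>)" "S * T = 1\<^sub>m (dim_row S)"
    using T(1,2) by (auto simp: invertible_mat_def inverts_mat_def)
  have "dim_col S = rep_dim G \<xi>" using arg_cong[OF S(1), of dim_col] by simp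
  moreover have "dim_row S = rep_dim G \<xi>" using arg_cong[OF S(2), of dim_col] T(1) by simp
  ultimately have "S \<in> carrier_mat (rep_dim G \<xi>) (rep_dim G \<xi>)" by auto
  with assms T S show ?thesis by (intro that[of _ T S]) (auto simp: rep_equiv_def)
qed

lemma rep_equivI:
  assumes "\<xi> \<in> irreps G" "\<eta> \<in> irreps G" "rep_dim G \<xi> = d" "rep_dim G \<eta> = d"
    "T \<in> carrier_mat d d" "S \<in> carrier_mat d d" "T * S = 1\<^sub>m d" "S * T = 1\<^sub>m d" "\<And>x. T * \<xi> x = \<eta> x * T"
  shows "(\<xi>, \<eta>) \<in> rep_equiv G"
proof -
  have "invertible_mat T"
    unfolding invertible_mat_def inverts_mat_def using assms(5-8) by (auto intro!: exI[of _ S])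
  with assms show ?thesis by (auto simp: rep_equiv_def)
qed

lemma equiv_rep_equiv: "equiv (irreps G) (rep_equiv G)"
proof (rule equivI)
  show "rep_equiv G \<subseteq> irreps G \<times> irreps G" by (auto simp: rep_equiv_def)
  show "refl_on (irreps G) (rep_equiv G)"
  proof (rule refl_onI)
    fix \<xi> assume \<xi>: "\<xi> \<in> irreps G"
    have c: "\<xi> x \<in> carrier_mat (rep_dim G \<xi>) (rep_dim G \<xi>)" for x
      by (rule unitary_repD(1)[OF irreps_unitary_rep(1)[OF \<xi>]])
    show "(\<xi>, \<xi>) \<in> rep_equiv G"
      by (rule rep_equivI[OF \<xi> \<xi> refl refl, of "1\<^sub>m (rep_dim G \<xi>)" "1\<^sub>m (rep_dim G \<xi>)"])
        (simp_all add: left_mult_one_mat[OF c] right_mult_one_mat[OF c])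
  qed
  show "sym (rep_equiv G)"
  proof (rule symI)
    fix \<xi> \<eta> assume 1: "(\<xi>, \<eta>) \<in> rep_equiv G"
    obtain T S d where R: "\<xi> \<in> irreps G" "\<eta> \<in> irreps G" "rep_dim G \<xi> = d" "rep_dim G \<eta> = d"
      "T \<in> carrier_mat d d" "S \<in> carrier_mat d d" "T * S = 1\<^sub>m d" "S * T = 1\<^sub>m d" "\<And>x. T * \<xi> x = \<eta> x * T"
      by (rule rep_equivE[OF 1], rule that)
    have \<xi>c: "\<xi> x \<in> carrier_mat d d" and \<eta>c: "\<eta> x \<in> carrier_mat d d" for x
      by (rule irreps_carrier[OF R(1,3)], rule irreps_carrier[OF R(2,4)])
    have "S * \<eta> x = \<xi> x * S" for x
    proof -
      have "S * \<eta> x = S * \<eta> x * (T * S)" using R \<eta>c[of x] by simp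
      also have "\<dots> = S * (\<eta> x * T) * S"
        using R(5,6) \<eta>c[of x] by (simp add: assoc_mult_mat[of _ d d _ d _ d])
      also have "\<dots> = S * T * \<xi> x * S"
        unfolding R(9)[symmetric] using R(5,6) \<xi>c[of x] by (simp add: assoc_mult_mat[of _ d d _ d _ d])
      also have "\<dots> = \<xi> x * S" using R(8) \<xi>c[of x] by simp
      finally show ?thesis .
    qed
    then show "(\<eta>, \<xi>) \<in> rep_equiv G" using R by (intro rep_equivI[of \<eta> \<xi> d S T]) auto
  qed
  show "trans (rep_equiv G)"
  proof (rule transI)
    fix \<xi> \<eta> \<zeta> assume 1: "(\<xi>, \<eta>) \<in> rep_equiv G" and 2: "(\<eta>, \<zeta>) \<in> rep_equiv G"
    obtain T S d where R: "\<xi> \<in> irreps G" "\<eta> \<in> irreps G" "rep_dim G \<xi> = d" "rep_dim G \<eta> = d"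
      "T \<in> carrier_mat d d" "S \<in> carrier_mat d d" "T * S = 1\<^sub>m d" "S * T = 1\<^sub>m d" "\<And>x. T * \<xi> x = \<eta> x * T"
      by (rule rep_equivE[OF 1], rule that)
    obtain T' S' d' where R': "\<eta> \<in> irreps G" "\<zeta> \<in> irreps G" "rep_dim G \<eta> = d'" "rep_dim G \<zeta> = d'"
      "T' \<in> carrier_mat d' d'" "S' \<in> carrier_mat d' d'" "T' * S' = 1\<^sub>m d'" "S' * T' = 1\<^sub>m d'" "\<And>x. T' * \<eta> x = \<zeta> x * T'"
      by (rule rep_equivE[OF 2], rule that)
    have d': "d' = d" using R R' by simp
    note R' = R'[unfolded d']
    have c: "\<xi> x \<in> carrier_mat d d" "\<eta> x \<in> carrier_mat d d" "\<zeta> x \<in> carrier_mat d d" for x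
      by (rule irreps_carrier[OF R(1,3)], rule irreps_carrier[OF R(2,4)], rule irreps_carrier[OF R'(2,4)])
    note as = assoc_mult_mat[of _ d d _ d _ d]
    show "(\<xi>, \<zeta>) \<in> rep_equiv G"
    proof (rule rep_equivI[of \<xi> \<zeta> d "T' * T" "S * S'"])
      have "T' * T * (S * S') = T' * (T * S) * S'" using R(5,6) R'(5,6) by (simp add: as)
      then show "T' * T * (S * S') = 1\<^sub>m d" using R(7) R'(5-7) by simp
      have "S * S' * (T' * T) = S * (S' * T') * T" using R(5,6) R'(5,6) by (simp add: as)
      then show "S * S' * (T' * T) = 1\<^sub>m d" using R(5,6,8) R'(8) by simp
      fix x
      have "T' * T * \<xi> x = T' * (\<eta> x * T)" using R(5,9) R'(5) c[of x] by (simp add: as)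
      also have "\<dots> = \<zeta> x * T' * T" unfolding R'(9)[symmetric] using R(5) R'(5) c[of x] by (simp add: as)
      finally show "T' * T * \<xi> x = \<zeta> x * (T' * T)" using R(5) R'(5) c[of x] by (simp add: as)
    qed (use R R' in auto)
  qed
qed

end

section \<open>Countable index sets\<close>

definition seq_of :: "'i set \<Rightarrow> ('i \<Rightarrow> 'b) \<Rightarrow> 'b \<Rightarrow> nat \<Rightarrow> 'b" where
  "seq_of I f z n = (if n \<in> to_nat_on I ` I then f (inv_into I (to_nat_on I) n) else z)"

lemma seq_of_to_nat_on:
  assumes "countable I" "i \<in> I"
  shows "seq_of I f z (to_nat_on I i) = f i"
  using assms inj_on_to_nat_on[OF assms(1)] by (simp add: seq_of_def inv_into_f_f)

lemma seq_of_cases: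
  obtains "seq_of I f z n = z" "n \<notin> to_nat_on I ` I" | i where "i \<in> I" "n = to_nat_on I i"
  by (auto simp: seq_of_def)

lemma seq_of_apply: "h (seq_of I f z n) = seq_of I (\<lambda>i. h (f i)) (h z) n"
  by (simp add: seq_of_def)

lemma seq_of_apply2: "h (seq_of I f y n) (seq_of I g z n) = seq_of I (\<lambda>i. h (f i) (g i)) (h y z) n"
  by (simp add: seq_of_def)

lemma has_sum_seq_of:
  fixes f :: "'i \<Rightarrow> 'b::{comm_monoid_add, topological_space}"
  assumes "countable I"
  shows "(seq_of I f 0 has_sum s) UNIV \<longleftrightarrow> (f has_sum s) I"
proof -
  have "(seq_of I f 0 has_sum s) UNIV \<longleftrightarrow> (seq_of I f 0 has_sum s) (to_nat_on I ` I)"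
    by (rule has_sum_cong_neutral) (auto simp: seq_of_def)
  also have "\<dots> \<longleftrightarrow> ((seq_of I f 0 \<circ> to_nat_on I) has_sum s) I"
    by (rule has_sum_reindex[OF inj_on_to_nat_on[OF assms]])
  also have "\<dots> \<longleftrightarrow> (f has_sum s) I"
    by (rule has_sum_cong) (simp add: seq_of_to_nat_on[OF assms])
  finally show ?thesis .
qed

lemma summable_seq_of:
  assumes "countable I" "f summable_on I"
  shows "summable (seq_of I f 0)"
  using assms has_sum_seq_of[OF assms(1)] by (metis has_sum_imp_sums summable_on_def sums_summable)

lemma integral_infsum_countable:
  fixes g :: "'i \<Rightarrow> 'a \<Rightarrow> complex"
  assumes I: "countable I" and g: "\<And>i. i \<in> I \<Longrightarrow> integrable M (g i)"
    and sum: "(\<lambda>i. LINT x|M. cmod (g i x)) summable_on I"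
  shows "AE x in M. (\<lambda>i. g i x) summable_on I"
    and "integrable M (\<lambda>x. \<Sum>\<^sub>\<infinity>i\<in>I. g i x)"
    and "(LINT x|M. (\<Sum>\<^sub>\<infinity>i\<in>I. g i x)) = (\<Sum>\<^sub>\<infinity>i\<in>I. LINT x|M. g i x)"
proof -
  define h where "h = seq_of I g (\<lambda>_. 0)"
  have hx: "h n x = seq_of I (\<lambda>i. g i x) 0 n" for n x
    unfolding h_def by (rule seq_of_apply[where h="\<lambda>f. f x"])
  have hi: "integrable M (h n)" for n
    by (rule seq_of_cases[of I g "\<lambda>_. 0" n]) (auto simp: h_def seq_of_to_nat_on[OF I] g)
  then have [measurable]: "h n \<in> borel_measurable M" for n by auto
  have "(\<lambda>n. LINT x|M. cmod (h n x)) = seq_of I (\<lambda>i. LINT x|M. cmod (g i x)) 0"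
    unfolding h_def by (rule ext, subst seq_of_apply[where h="\<lambda>f. LINT x|M. cmod (f x)"]) simp
  then have hs: "summable (\<lambda>n. LINT x|M. cmod (h n x))" using summable_seq_of[OF I sum] by argo
  have "(\<integral>\<^sup>+x. (\<Sum>n. ennreal (cmod (h n x))) \<partial>M) = (\<Sum>n. \<integral>\<^sup>+x. ennreal (cmod (h n x)) \<partial>M)"
    by (rule nn_integral_suminf) simp
  also have "\<dots> = (\<Sum>n. ennreal (LINT x|M. cmod (h n x)))"
    using hi by (intro suminf_cong nn_integral_eq_integral) auto
  also have "\<dots> \<noteq> \<infinity>"
    unfolding infinity_ennreal_def by (rule ennreal_suminf_neq_top[OF hs]) (auto intro: integral_nonneg_AE)
  finally have "AE x in M. (\<Sum>n. ennreal (cmod (h n x))) \<noteq> \<infinity>"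
    by (intro nn_integral_PInf_AE) auto
  then have ae: "AE x in M. summable (\<lambda>n. cmod (h n x))"
    by eventually_elim (rule summable_suminf_not_top, simp_all)
  have summable_iff: "(\<lambda>i. g i x) summable_on I \<longleftrightarrow> summable (\<lambda>n. cmod (h n x))" for x
  proof -
    have "(\<lambda>i. g i x) summable_on I \<longleftrightarrow> (\<lambda>n. h n x) summable_on UNIV"
      unfolding hx summable_on_def using has_sum_seq_of[OF I] by blast
    also have "\<dots> \<longleftrightarrow> (\<lambda>n. cmod (h n x)) summable_on UNIV" by (rule summable_on_iff_abs_summable_on_complex)
    also have "\<dots> \<longleftrightarrow> summable (\<lambda>n. cmod (h n x))" by (rule summable_on_UNIV_nonneg_real_iff) simp
    finally show ?thesis .
  qed
  show "AE x in M. (\<lambda>i. g i x) summable_on I" using ae by (simp add: summable_iff)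
  \<comment> \<open>The value is made explicit also where the series diverges and
    \<open>infsum\<close> is 0, because measurability is a statement about every point and not only
    about almost every point.\<close>
  have infsum_eq: "(\<Sum>\<^sub>\<infinity>i\<in>I. g i x) = (if summable (\<lambda>n. cmod (h n x)) then (\<Sum>n. h n x) else 0)" for x
  proof (cases "summable (\<lambda>n. cmod (h n x))")
    case True
    then have "((\<lambda>i. g i x) has_sum (\<Sum>\<^sub>\<infinity>i\<in>I. g i x)) I" using summable_iff by (simp add: has_sum_infsum)
    then have "((\<lambda>n. h n x) has_sum (\<Sum>\<^sub>\<infinity>i\<in>I. g i x)) UNIV" unfolding hx using has_sum_seq_of[OF I] by blast
    then have "(\<lambda>n. h n x) sums (\<Sum>\<^sub>\<infinity>i\<in>I. g i x)" by (rule has_sum_imp_sums)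
    with True show ?thesis by (simp add: sums_iff)
  next
    case False
    then show ?thesis using summable_iff by (simp add: infsum_not_exists)
  qed
  have "summable (\<lambda>n. cmod (h n x)) \<longleftrightarrow> (\<Sum>n. ennreal (cmod (h n x))) \<noteq> \<infinity>" for x
    unfolding infinity_ennreal_def
    by (rule iffI, erule ennreal_suminf_neq_top, simp, rule summable_suminf_not_top) simp_all
  then have [measurable]: "(\<lambda>x. \<Sum>\<^sub>\<infinity>i\<in>I. g i x) \<in> borel_measurable M"
    unfolding infsum_eq by simp
  have aeq: "AE x in M. (\<Sum>n. h n x) = (\<Sum>\<^sub>\<infinity>i\<in>I. g i x)"
    using ae by eventually_elim (simp add: infsum_eq)
  have "integrable M (\<lambda>x. \<Sum>n. h n x)" by (rule integrable_suminf[OF hi ae hs])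
  then show "integrable M (\<lambda>x. \<Sum>\<^sub>\<infinity>i\<in>I. g i x)"
    by (rule integrable_cong_AE_imp) (use aeq in auto)
  have "(LINT x|M. (\<Sum>\<^sub>\<infinity>i\<in>I. g i x)) = (LINT x|M. (\<Sum>n. h n x))"
    using aeq by (intro integral_cong_AE) auto
  also have "\<dots> = (\<Sum>n. LINT x|M. h n x)" by (rule integral_suminf[OF hi ae hs])
  also have "(\<lambda>n. LINT x|M. h n x) = seq_of I (\<lambda>i. LINT x|M. g i x) 0"
    unfolding h_def by (rule ext, subst seq_of_apply[where h="\<lambda>f. LINT x|M. f x"]) simp
  also have "suminf \<dots> = (\<Sum>\<^sub>\<infinity>i\<in>I. LINT x|M. g i x)"
  proof -
    have "(\<lambda>i. cmod (LINT x|M. g i x)) summable_on I"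
      by (rule summable_on_comparison_test[OF sum]) (auto intro: integral_norm_bound)
    then have "(\<lambda>i. LINT x|M. g i x) summable_on I" by (rule abs_summable_summable)
    then have "((\<lambda>i. LINT x|M. g i x) has_sum (\<Sum>\<^sub>\<infinity>i\<in>I. LINT x|M. g i x)) I" by (rule has_sum_infsum)
    then show ?thesis using has_sum_seq_of[OF I] has_sum_imp_sums sums_unique by metis
  qed
  finally show "(LINT x|M. (\<Sum>\<^sub>\<infinity>i\<in>I. g i x)) = (\<Sum>\<^sub>\<infinity>i\<in>I. LINT x|M. g i x)" .
qed

text \<open>The inclusion of l^r in l^1: with \<open>S\<close> the sum of the r-th powers, every a^r
  is at most \<open>S\<close>, so a = a^r a^(1 - r) is at most a^r times a fixed power of
  \<open>S\<close>.\<close>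

lemma summable_on_of_powr:
  fixes a :: "'i \<Rightarrow> real"
  assumes sum: "(\<lambda>i. a i powr r) summable_on I" and a: "\<And>i. i \<in> I \<Longrightarrow> 0 \<le> a i" and r: "0 < r" "r \<le> 1"
  shows "a summable_on I"
proof (rule summable_on_comparison_test)
  define S where "S = (\<Sum>\<^sub>\<infinity>i\<in>I. a i powr r)"
  show "(\<lambda>i. a i powr r * S powr ((1 - r) / r)) summable_on I" using sum by (rule summable_on_cmult_left)
  fix i assume i: "i \<in> I"
  have "sum (\<lambda>i. a i powr r) {i} \<le> S" unfolding S_def by (rule finite_sum_le_infsum[OF sum]) (use i in auto)
  then have le: "a i powr r \<le> S" by simp
  have "a i = a i powr r * a i powr (1 - r)" using a[OF i] r by (cases "a i = 0") (auto simp flip: powr_add)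
  also have "a i powr (1 - r) = (a i powr r) powr ((1 - r) / r)" using r by (simp add: powr_powr)
  also have "a i powr r * (a i powr r) powr ((1 - r) / r) \<le> a i powr r * S powr ((1 - r) / r)"
    using le r by (intro mult_left_mono powr_mono2) auto
  finally show "a i \<le> a i powr r * S powr ((1 - r) / r)" .
qed (rule a)

section \<open>Countability of the unitary dual\<close>

context haar_group
begin

lemma unitary_dual_irreps:
  assumes "c \<in> unitary_dual G" "\<xi> \<in> c"
  shows "\<xi> \<in> irreps G"
  using in_quotient_imp_subset[OF equiv_rep_equiv] assms unfolding unitary_dual_def by blast

lemma unitary_dual_inequivalent:
  assumes "c \<in> unitary_dual G" "c' \<in> unitary_dual G" "\<xi> \<in> c" "\<eta> \<in> c'" "c \<noteq> c'"
  shows "(\<xi>, \<eta>) \<notin> rep_equiv G"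
  using quotient_eqI[OF equiv_rep_equiv] assms unfolding unitary_dual_def by blast

text \<open>\<open>unitary_rep\<close> postulates only multiplicativity and unitarity; the value at
  \<open>\<one>\<close> follows by multiplying \<open>\<xi> (\<one> \<otimes> \<one>) = \<xi> \<one>
  * \<xi> \<one>\<close> with the adjoint of \<open>\<xi> \<one>\<close>.\<close>

lemma unitary_rep_one:
  assumes \<xi>: "\<xi> \<in> irreps G" and ij: "i < rep_dim G \<xi>" "j < rep_dim G \<xi>"
  shows "\<xi> \<one> $$ (i, j) = (if i = j then 1 else 0)"
proof -
  let ?d = "rep_dim G \<xi>"
  note r = irreps_unitary_rep(1)[OF \<xi>]
  have "(\<Sum>k<?d. cnj (\<xi> \<one> $$ (k, i)) * \<xi> (\<one> \<otimes> \<one>) $$ (k, j)) =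
      (\<Sum>k<?d. \<Sum>l<?d. cnj (\<xi> \<one> $$ (k, i)) * \<xi> \<one> $$ (k, l) * \<xi> \<one> $$ (l, j))"
    using ij by (intro sum.cong refl) (simp only: unitary_repD(4)[OF r] lessThan_iff sum_distrib_left mult.assoc)
  also have "\<dots> = (\<Sum>l<?d. (\<Sum>k<?d. cnj (\<xi> \<one> $$ (k, i)) * \<xi> \<one> $$ (k, l)) * \<xi> \<one> $$ (l, j))"
    unfolding sum_distrib_right by (rule sum.swap)
  also have "\<dots> = (\<Sum>l<?d. if l = i then \<xi> \<one> $$ (l, j) else 0)"
    using unitary_rep_adjoint[OF r ij(1)] by (intro sum.cong refl) auto
  also have "\<dots> = \<xi> \<one> $$ (i, j)" using ij by simp
  finally show ?thesis using unitary_rep_adjoint[OF r ij, of \<one>] by simp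
qed

text \<open>One normalised coefficient per class gives an orthonormal family, so by Bessel's
  inequality any continuous function has a nonzero inner product with only countably many of its
  members. Countably many bump functions at \<open>\<one>\<close> suffice to detect every
  class.\<close>

theorem countable_unitary_dual:
  assumes rep: "\<And>c. c \<in> unitary_dual G \<Longrightarrow> rep c \<in> c"
  shows "countable (unitary_dual G)"
proof -
  let ?D = "unitary_dual G"
  \<comment> \<open>The square root of the dimension compensates the square norm 1 / d of a
    coefficient.\<close>
  define \<zeta> where "\<zeta> c x = complex_of_real (sqrt (real (rep_dim G (rep c)))) * rep c x $$ (0, 0)" for c x
  have irr: "rep c \<in> irreps G" if "c \<in> ?D" for c by (rule unitary_dual_irreps[OF that rep[OF that]])
  have coeff: "continuous_on UNIV (\<lambda>x. rep c x $$ (0, 0))" and pos: "0 < rep_dim G (rep c)" if "c \<in> ?D" for c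
    using unitary_repD(3)[OF irreps_unitary_rep(1)[OF irr[OF that]]] irreps_unitary_rep(2)[OF irr[OF that]] by auto
  have \<zeta>c: "continuous_on UNIV (\<zeta> c)" if "c \<in> ?D" for c unfolding \<zeta>_def by (intro continuous_intros coeff that)
  have ortho: "L2_inner (\<zeta> c) (\<zeta> c') = (if c = c' then 1 else 0)" if c: "c \<in> ?D" "c' \<in> ?D" for c c'
  proof (cases "c = c'")
    case True
    have "complex_of_real (sqrt (real (rep_dim G (rep c)))) * complex_of_real (sqrt (real (rep_dim G (rep c))))
        = of_nat (rep_dim G (rep c))"
      unfolding of_real_mult[symmetric] by simp
    moreover have "L2_inner (\<lambda>x. rep c x $$ (0, 0)) (\<lambda>x. rep c x $$ (0, 0)) = 1 / of_nat (rep_dim G (rep c))"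
      using schur_orthogonality[OF irr[OF c(1)]] pos[OF c(1)] by simp
    ultimately show ?thesis
      using pos[OF c(1)] unfolding True[symmetric]
      by (simp add: \<zeta>_def[abs_def] L2_inner_scale_left L2_inner_scale_right flip: mult.assoc)
  next
    case False
    then show ?thesis
      using schur_inequivalent[OF irr[OF c(1)] irr[OF c(2)] unitary_dual_inequivalent[OF c rep[OF c(1)] rep[OF c(2)] False]] pos c
      by (simp add: \<zeta>_def[abs_def] L2_inner_scale_left L2_inner_scale_right)
  qed
  have cnt: "countable {c \<in> ?D. L2_inner \<psi> (\<zeta> c) \<noteq> 0}" if \<psi>: "continuous_on UNIV \<psi>" for \<psi>
  proof -
    have "(\<lambda>c. (cmod (L2_inner \<psi> (\<zeta> c)))\<^sup>2) summable_on ?D"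
    proof (rule nonneg_bdd_above_summable_on)
      show "bdd_above (sum (\<lambda>c. (cmod (L2_inner \<psi> (\<zeta> c)))\<^sup>2) ` {F. F \<subseteq> ?D \<and> finite F})"
      proof (rule bdd_aboveI)
        fix t assume "t \<in> sum (\<lambda>c. (cmod (L2_inner \<psi> (\<zeta> c)))\<^sup>2) ` {F. F \<subseteq> ?D \<and> finite F}"
        then obtain F where F: "F \<subseteq> ?D" "finite F" "t = (\<Sum>c\<in>F. (cmod (L2_inner \<psi> (\<zeta> c)))\<^sup>2)" by blast
        obtain h where h: "bij_betw h {..<card F} F"
          using ex_bij_betw_nat_finite[OF F(2)] by (auto simp: atLeast0LessThan)
        have hF: "h i \<in> F" if "i < card F" for i using h that by (auto simp: bij_betw_def)
        have "orthonormal {f. continuous_on UNIV f} (card F) (\<lambda>i. \<zeta> (h i))"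
          using hF F(1) h by (auto simp: orthonormal_def \<zeta>c ortho subset_iff bij_betw_def inj_on_eq_iff)
        moreover have "left_invariant_subspace {f :: 'g \<Rightarrow> complex. continuous_on UNIV f}"
          by (auto simp: left_invariant_subspace_def intro: continuous_intros continuous_translate)
        ultimately have "(\<Sum>i<card F. (cmod (L2_inner \<psi> (\<zeta> (h i))))\<^sup>2) \<le> (L2_norm \<psi>)\<^sup>2"
          by (rule bessel[OF _ _ \<psi>])
        also have "(\<Sum>i<card F. (cmod (L2_inner \<psi> (\<zeta> (h i))))\<^sup>2) = t"
          unfolding F(3) by (rule sum.reindex_bij_betw[OF h])
        finally show "t \<le> (L2_norm \<psi>)\<^sup>2" .
      qed
    qed simp
    then have "countable {c \<in> ?D. (cmod (L2_inner \<psi> (\<zeta> c)))\<^sup>2 \<noteq> 0}" by (rule summable_countable_real)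
    then show ?thesis by simp
  qed
  \<comment> \<open>A countable neighbourhood base at \<open>\<one>\<close>. The diagonal
    coefficient of a class is 1 there, so its real part exceeds 1/2 on some \<open>U i\<close>, and
    a bump function supported in \<open>U i\<close> has a nonzero inner product with it.\<close>
  obtain U :: "nat \<Rightarrow> 'g set" where U: "\<And>i. \<one> \<in> U i" "\<And>i. open (U i)" "\<And>S. open S \<Longrightarrow> \<one> \<in> S \<Longrightarrow> \<exists>i. U i \<subseteq> S"
    using first_countable_basis[of \<one>] by metis
  have "\<exists>\<psi>. continuous_on UNIV \<psi> \<and> (\<forall>x. 0 \<le> \<psi> x) \<and> (\<forall>x. x \<notin> U i \<longrightarrow> \<psi> x = 0) \<and> \<psi> \<one> = (1::real)" for i
  proof -
    have cl: "closed (- U i)" "closed {\<one>}" "- U i \<inter> {\<one>} = {}" using U by (auto simp: closed_Compl)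
    obtain f :: "'g \<Rightarrow> real" where f: "continuous_on UNIV f" "\<And>x. 0 \<le> f x" "\<And>x. f x \<le> 1"
      "\<And>x. x \<in> - U i \<Longrightarrow> f x = 0" "\<And>x. x \<in> {\<one>} \<Longrightarrow> f x = 1"
      by (rule compact_Urysohn[OF compact_UNIV cl], rule that)
    then show ?thesis by (intro exI[of _ f]) auto
  qed
  then obtain \<psi> where \<psi>: "\<And>i. continuous_on UNIV (\<psi> i)" "\<And>i x. 0 \<le> \<psi> i x" "\<And>i x. x \<notin> U i \<Longrightarrow> \<psi> i x = 0"
    "\<And>i. \<psi> i \<one> = (1::real)" by metis
  define \<Psi> where "\<Psi> i x = complex_of_real (\<psi> i x)" for i x
  have \<Psi>c: "continuous_on UNIV (\<Psi> i)" for i unfolding \<Psi>_def by (intro continuous_intros \<psi>)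
  have "\<exists>i. L2_inner (\<Psi> i) (\<zeta> c) \<noteq> 0" if c: "c \<in> ?D" for c
  proof -
    define \<xi> where "\<xi> x = rep c x $$ (0, 0)" for x
    have \<xi>c: "continuous_on UNIV \<xi>" unfolding \<xi>_def by (rule coeff[OF c])
    have "open {x. 1/2 < Re (\<xi> x)}" by (intro open_Collect_less continuous_intros \<xi>c)
    moreover have "\<xi> \<one> = 1" using unitary_rep_one[OF irr[OF c] pos[OF c] pos[OF c]] by (simp add: \<xi>_def)
    then have "\<one> \<in> {x. 1/2 < Re (\<xi> x)}" by simp
    ultimately obtain i where i: "U i \<subseteq> {x. 1/2 < Re (\<xi> x)}" using U(3) by blast
    have "0 < (LINT x|M. \<psi> i x)"
    proof (rule ccontr)
      assume "\<not> 0 < (LINT x|M. \<psi> i x)"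
      moreover have "0 \<le> (LINT x|M. \<psi> i x)" using \<psi>(2) by (intro integral_nonneg_AE) auto
      ultimately have "(LINT x|M. \<psi> i x) = 0" by simp
      then have "AE x in M. \<psi> i x = 0"
        using \<psi>(2) continuous_integrable[OF \<psi>(1)] by (subst (asm) integral_nonneg_eq_0_iff_AE) auto
      then have "AE x in M. \<Psi> i x = 0" by eventually_elim (simp add: \<Psi>_def)
      then have "\<Psi> i \<one> = 0" by (rule continuous_ae_zero[OF \<Psi>c])
      then show False by (simp add: \<Psi>_def \<psi>(4))
    qed
    also have "(LINT x|M. \<psi> i x) \<le> (LINT x|M. 2 * Re (\<Psi> i x * cnj (\<xi> x)))"
    proof (rule integral_mono)
      show "integrable M (\<psi> i)" by (rule continuous_integrable[OF \<psi>(1)])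
      show "integrable M (\<lambda>x. 2 * Re (\<Psi> i x * cnj (\<xi> x)))" by (intro continuous_integrable continuous_intros \<Psi>c \<xi>c)
      fix x
      show "\<psi> i x \<le> 2 * Re (\<Psi> i x * cnj (\<xi> x))"
      proof (cases "x \<in> U i")
        case True
        then have "\<psi> i x * (1/2) \<le> \<psi> i x * Re (\<xi> x)" using i \<psi>(2) by (intro mult_left_mono) auto
        then show ?thesis by (simp add: \<Psi>_def)
      qed (simp add: \<psi>(3) \<Psi>_def)
    qed
    also have "\<dots> = 2 * Re (L2_inner (\<Psi> i) \<xi>)"
      by (simp only: L2_inner_def integral_mult_right_zero integral_Re[OF L2_integrable[OF \<Psi>c \<xi>c]])
    finally have "L2_inner (\<Psi> i) \<xi> \<noteq> 0" by auto
    then have "L2_inner (\<Psi> i) (\<zeta> c) \<noteq> 0"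
      using pos[OF c] by (simp add: \<zeta>_def[abs_def] L2_inner_scale_right \<xi>_def[abs_def])
    then show ?thesis by blast
  qed
  then have "?D \<subseteq> (\<Union>i. {c \<in> ?D. L2_inner (\<Psi> i) (\<zeta> c) \<noteq> 0})" by blast
  moreover have "countable (\<Union>i. {c \<in> ?D. L2_inner (\<Psi> i) (\<zeta> c) \<noteq> 0})" using cnt[OF \<Psi>c] by blast
  ultimately show ?thesis by (rule countable_subset)
qed

end

section \<open>Operators and their symbols\<close>

lemma Lp_space_mono:
  fixes f g :: "'a \<Rightarrow> complex"
  assumes "1 \<le> p" "g \<in> Lp_space p M" "f \<in> borel_measurable M" "\<And>x. cmod (f x) \<le> cmod (g x)"
  shows "f \<in> Lp_space p M"
proof -
  have "integrable M (\<lambda>x. cmod (f x) powr p)"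
    using assms by (intro Bochner_Integration.integrable_bound[OF Lp_spaceD(2)[OF assms(2)]]) (auto intro!: powr_mono2)
  with assms(3) show ?thesis by (simp add: Lp_space_def)
qed

lemma Lp_norm_of_real: "Lp_norm p M (\<lambda>x. complex_of_real (g x)) = Lp_norm p M g"
  by (simp add: Lp_norm_def)

lemma nuclear_rep_one:
  assumes p: "1 \<le> p" and r: "0 < r" "r \<le> 1"
    and rep: "Lp_nuclear_rep r p M T x y"
  shows "Lp_nuclear_rep 1 p M T x y"
proof -
  let ?a = "\<lambda>n. Lp_dual_norm p M (x n) * Lp_norm p M (y n)"
  have dn: "0 \<le> Lp_dual_norm p M (x n)" for n
    using rep by (intro dual_norm_nonneg[OF p]) (simp add: nuclear_rep_def)
  have "summable (\<lambda>n. ?a n powr r)"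
    using rep by (simp add: nuclear_rep_def powr_mult dn)
  then have "(\<lambda>n. ?a n powr r) summable_on UNIV" by (subst summable_on_UNIV_nonneg_real_iff) auto
  then have "?a summable_on UNIV" using dn r by (rule_tac summable_on_of_powr) auto
  then have "summable ?a" using dn by (subst (asm) summable_on_UNIV_nonneg_real_iff) auto
  then show ?thesis using rep dn by (simp add: nuclear_rep_def)
qed

text \<open>The inclusion of L^(q/p) in L^1, applied to |f|^p.\<close>

lemma (in prob_space) Lp_norm_exponent_mono:
  assumes pq: "1 \<le> p" "p \<le> q" and f: "f \<in> Lp_space q M"
  shows "f \<in> Lp_space p M" "Lp_norm p M f \<le> Lp_norm q M f"
proof -
  note [measurable] = Lp_spaceD(1)[OF f]
  define g where "g x = complex_of_real (cmod (f x) powr p)" for x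
  have gq: "cmod (g x) powr (q / p) = cmod (f x) powr q" for x using pq by (simp add: g_def powr_powr)
  have g: "g \<in> Lp_space (q / p) M"
  proof -
    have "integrable M (\<lambda>x. cmod (g x) powr (q / p))" using Lp_spaceD(2)[OF f] by (simp only: gq)
    moreover have "g \<in> borel_measurable M" unfolding g_def by measurable
    ultimately show ?thesis unfolding Lp_space_def by blast
  qed
  have qp: "1 \<le> q / p" using pq by simp
  have "integrable M (\<lambda>x. cmod (g x))" using Lp_integrable(1)[OF qp g] by (rule integrable_norm)
  then show "f \<in> Lp_space p M" by (simp add: Lp_space_def g_def)
  have "(LINT x|M. cmod (f x) powr p) \<le> Lp_norm (q / p) M g"
    using Lp_integrable(2)[OF qp g] by (simp add: g_def)
  also have "\<dots> = Lp_norm q M f powr p"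
    using pq by (simp add: Lp_norm_def gq powr_powr)
  finally show "Lp_norm p M f \<le> Lp_norm q M f"
    using pq by (subst Lp_norm_le_iff) auto
qed

section \<open>Norms of the Fourier functionals\<close>

context haar_group
begin

lemma L2_norm_coeff:
  assumes \<xi>: "\<xi> \<in> irreps G" and ij: "i < rep_dim G \<xi>" "j < rep_dim G \<xi>"
  shows "(L2_norm (\<lambda>x. \<xi> x $$ (i, j)))\<^sup>2 = 1 / rep_dim G \<xi>"
proof -
  have "complex_of_real ((L2_norm (\<lambda>x. \<xi> x $$ (i, j)))\<^sup>2) = complex_of_real (1 / rep_dim G \<xi>)"
    unfolding L2_inner_self[symmetric] schur_orthogonality[OF \<xi> ij ij] by simp
  then show ?thesis using of_real_eq_iff by blast
qed

text \<open>For p = 1 the bound |\<xi>_ij| \<le> 1 gives the exponent 0. For 1 < p < 2 the conjugate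
  q is at least 2, so |\<xi>_ij|^q is at most |\<xi>_ij|^2, whose integral is 1/d; the q-norm is
  then at most d^(-1/q) with -1/q = 1/p - 1. From p = 2 on, Cauchy-Schwarz with the L2 norm d^(-1/2)
  applies.\<close>

lemma coeff_functional_bound:
  assumes p: "1 \<le> p" and \<xi>: "\<xi> \<in> irreps G" and ij: "i < rep_dim G \<xi>" "j < rep_dim G \<xi>"
    and f: "f \<in> Lp_space p M"
  shows "cmod (L2_inner f (\<lambda>x. \<xi> x $$ (i, j))) \<le> real (rep_dim G \<xi>) powr (1 / min 2 p - 1) * Lp_norm p M f"
proof -
  let ?d = "real (rep_dim G \<xi>)" and ?\<xi> = "\<lambda>x. \<xi> x $$ (i, j)"
  note r = irreps_unitary_rep[OF \<xi>]
  have d: "1 \<le> ?d" using r(2) by simp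
  have \<xi>c: "continuous_on UNIV ?\<xi>" by (rule unitary_repD(3)[OF r(1) ij])
  have \<xi>1: "cmod (?\<xi> x) \<le> 1" for x by (rule unitary_rep_bound[OF r(1) ij])
  note [measurable] = Lp_spaceD(1)[OF f] continuous_measurable[OF \<xi>c]
  consider "p = 1" | "1 < p" "p < 2" | "2 \<le> p" using p by linarith
  then show ?thesis
  proof cases
    case 1
    have "cmod (L2_inner f ?\<xi>) \<le> (LINT x|M. cmod (f x * cnj (?\<xi> x)))"
      unfolding L2_inner_def by (rule integral_norm_bound)
    also have "\<dots> \<le> (LINT x|M. cmod (f x))"
    proof (rule integral_mono_AE')
      have "cmod (f x * cnj (?\<xi> x)) \<le> cmod (f x)" for x
        using \<xi>1[of x] by (simp add: norm_mult mult_left_le)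
      then show "AE x in M. cmod (f x * cnj (?\<xi> x)) \<le> cmod (f x)" by simp
    qed (use Lp_integrable(1)[OF p f] in auto)
    also have "\<dots> \<le> Lp_norm p M f" by (rule Lp_integrable(2)[OF p f])
    finally show ?thesis using 1 d by simp
  next
    case 2
    define q where "q = p / (p - 1)"
    have pq: "1 < p" "1 < q" "1 / p + 1 / q = 1" "2 \<le> q" using 2 by (auto simp: q_def field_simps)
    have \<xi>q: "(\<lambda>x. cnj (?\<xi> x)) \<in> Lp_space q M" using pq by (intro continuous_Lp continuous_intros \<xi>c) auto
    have "(LINT x|M. cmod (cnj (?\<xi> x)) powr q) \<le> (LINT x|M. (cmod (?\<xi> x))\<^sup>2)"
    proof (rule integral_mono)
      show "integrable M (\<lambda>x. cmod (cnj (?\<xi> x)) powr q)" by (rule Lp_spaceD(2)[OF \<xi>q])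
      show "integrable M (\<lambda>x. (cmod (?\<xi> x))\<^sup>2)" by (intro continuous_integrable continuous_intros \<xi>c)
      show "cmod (cnj (?\<xi> x)) powr q \<le> (cmod (?\<xi> x))\<^sup>2" for x
        using powr_mono'[of 2 q "cmod (?\<xi> x)"] pq \<xi>1[of x] by simp
    qed
    also have "\<dots> = 1 / ?d" using L2_norm_coeff[OF \<xi> ij] by (simp add: L2_norm_sq)
    also have "\<dots> = (?d powr (- (1 / q))) powr q"
    proof -
      have "- (1 / q) * q = - 1" using pq by simp
      then show ?thesis unfolding powr_powr using d by (simp add: powr_minus_divide)
    qed
    finally have "Lp_norm q M (\<lambda>x. cnj (?\<xi> x)) \<le> ?d powr (- (1 / q))"
      using pq by (subst Lp_norm_le_iff) auto
    also have "- (1 / q) = 1 / min 2 p - 1" using pq 2 by (simp add: min_def)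
    finally have qn: "Lp_norm q M (\<lambda>x. cnj (?\<xi> x)) \<le> ?d powr (1 / min 2 p - 1)" .
    have "cmod (L2_inner f ?\<xi>) \<le> (LINT x|M. cmod (f x * cnj (?\<xi> x)))"
      unfolding L2_inner_def by (rule integral_norm_bound)
    also have "\<dots> \<le> Lp_norm p M f * Lp_norm q M (\<lambda>x. cnj (?\<xi> x))" by (rule Holder(2)[OF pq(1-3) f \<xi>q])
    also have "\<dots> \<le> Lp_norm p M f * ?d powr (1 / min 2 p - 1)" using qn by (intro mult_left_mono) auto
    finally show ?thesis by (simp add: mult.commute)
  next
    case 3
    have "cmod (L2_inner f ?\<xi>) \<le> L2_norm f * L2_norm ?\<xi>"
      by (rule L2_cauchy_schwarz[OF Lp_norm_exponent_mono(1)[OF _ 3 f] continuous_Lp[OF _ \<xi>c]]) auto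
    also have "\<dots> \<le> Lp_norm p M f * L2_norm ?\<xi>"
      using Lp_norm_exponent_mono(2)[OF _ 3 f] by (intro mult_right_mono) auto
    also have "L2_norm ?\<xi> = sqrt (1 / ?d)" 
      by (rule real_sqrt_unique[OF L2_norm_coeff[OF \<xi> ij] Lp_norm_nonneg, symmetric])
    also have "\<dots> = ?d powr (1 / min 2 p - 1)"
    proof -
      have "1 / min 2 p - 1 = - (1 / 2)" using 3 by simp
      then show ?thesis
        unfolding powr_minus_divide[symmetric] using d by (simp add: powr_minus_divide powr_half_sqrt real_sqrt_divide)
    qed
    finally show ?thesis by (simp add: mult.commute)
  qed
qed

end

text \<open>\<open>A\<close> is linear only up to functions of seminorm 0, so the Lipschitz estimate
  needs a triangle step through \<open>A\<close> applied to the difference.\<close>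

lemma bounded_operator_diff:
  assumes p: "1 \<le> p" and A: "bounded_operator (Lp_space p M) (Lp_norm p M) (Lp_space p M) (Lp_norm p M) A"
  obtains C where "0 < C" "\<And>f g. f \<in> Lp_space p M \<Longrightarrow> g \<in> Lp_space p M \<Longrightarrow>
    Lp_norm p M (\<lambda>x. A f x - A g x) \<le> C * Lp_norm p M (\<lambda>x. f x - g x)"
proof -
  have AE: "A f \<in> Lp_space p M" if "f \<in> Lp_space p M" for f using A that by (simp add: bounded_operator_def)
  obtain C where C: "\<And>f. f \<in> Lp_space p M \<Longrightarrow> Lp_norm p M (A f) \<le> C * Lp_norm p M f"
    using A unfolding bounded_operator_def by blast
  show ?thesis
  proof (rule that[of "\<bar>C\<bar> + 1"])
    fix f g assume f: "f \<in> Lp_space p M" and g: "g \<in> Lp_space p M"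
    define h where "h x = f x - g x" for x
    have h: "h \<in> Lp_space p M" unfolding h_def by (rule Lp_space_diff[OF p f g])
    have "Lp_norm p M (\<lambda>x. A (\<lambda>y. h y + g y) x - (A h x + A g x)) = 0"
      using A h g by (simp add: bounded_operator_def)
    then have "Lp_norm p M (\<lambda>x. A f x - (A h x + A g x)) = 0" by (simp add: h_def)
    then have "Lp_norm p M (\<lambda>x. (A f x - A g x) - A h x) = 0" by (simp add: algebra_simps)
    moreover have "Lp_norm p M (\<lambda>x. (A f x - A g x) - 0) \<le>
        Lp_norm p M (\<lambda>x. (A f x - A g x) - A h x) + Lp_norm p M (\<lambda>x. A h x - 0)"
      by (intro Lp_norm_triangle_diff p Lp_space_diff AE f g h Lp_space_zero)
    moreover have "Lp_norm p M (A h) \<le> (\<bar>C\<bar> + 1) * Lp_norm p M h"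
      using C[OF h] by (rule order_trans) (intro mult_right_mono, auto)
    ultimately show "Lp_norm p M (\<lambda>x. A f x - A g x) \<le> (\<bar>C\<bar> + 1) * Lp_norm p M (\<lambda>x. f x - g x)"
      by (simp add: h_def[abs_def])
  qed simp
qed

section \<open>Pointwise and integral estimates for the symbol\<close>

locale symbol_operator = haar_group +
  fixes rep :: "('a \<Rightarrow> complex mat) set \<Rightarrow> 'a \<Rightarrow> complex mat" and A and p :: real
  assumes rep: "c \<in> unitary_dual G \<Longrightarrow> rep c \<in> c" and p: "1 \<le> p"
    and A: "bounded_operator (Lp_space p M) (Lp_norm p M) (Lp_space p M) (Lp_norm p M) A"
begin

abbreviation dm :: "('a \<Rightarrow> complex mat) set \<Rightarrow> nat" where
  "dm c \<equiv> rep_dim G (rep c)"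

abbreviation symb :: "('a \<Rightarrow> complex mat) set \<Rightarrow> 'a \<Rightarrow> complex mat" where
  "symb c x \<equiv> symbol G A x (rep c)"

definition opn :: "('a \<Rightarrow> complex mat) set \<Rightarrow> 'a \<Rightarrow> real" where
  "opn c x = opnorm_linf (transpose_mat (symb c x))"

abbreviation coeff :: "('a \<Rightarrow> complex mat) set \<Rightarrow> nat \<Rightarrow> nat \<Rightarrow> 'a \<Rightarrow> complex" where
  "coeff c i j \<equiv> \<lambda>x. rep c x $$ (i, j)"

lemma rep_irreps: "c \<in> unitary_dual G \<Longrightarrow> rep c \<in> irreps G"
  by (rule unitary_dual_irreps[OF _ rep])

lemma A_Lp: "f \<in> Lp_space p M \<Longrightarrow> A f \<in> Lp_space p M"
  using A by (simp add: bounded_operator_def)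

context
  fixes c assumes c: "c \<in> unitary_dual G"
begin

lemmas rep_unitary = irreps_unitary_rep[OF rep_irreps[OF c]]

lemma coeff_cont: "i < dm c \<Longrightarrow> j < dm c \<Longrightarrow> continuous_on UNIV (coeff c i j)"
  by (rule unitary_repD(3)[OF rep_unitary(1)])

lemma coeff_Lp: "i < dm c \<Longrightarrow> j < dm c \<Longrightarrow> coeff c i j \<in> Lp_space p M"
  by (intro continuous_Lp p coeff_cont)

lemma A_coeff_Lp: "i < dm c \<Longrightarrow> j < dm c \<Longrightarrow> A (coeff c i j) \<in> Lp_space p M"
  by (intro A_Lp coeff_Lp)

lemma symb_carrier: "symb c x \<in> carrier_mat (dm c) (dm c)"
  unfolding symbol_def
  by (rule mult_carrier_mat[OF mat_adjoint_carrier[OF unitary_repD(1)[OF rep_unitary(1)]] mat_carrier])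

lemma symb_index:
  assumes "i < dm c" "j < dm c"
  shows "symb c x $$ (i, j) = (\<Sum>k<dm c. cnj (rep c x $$ (k, i)) * A (coeff c k j) x)"
  unfolding symbol_def
  by (subst adjoint_mult_index[OF unitary_repD(1)[OF rep_unitary(1)] _ assms]) (use assms in auto)

lemma A_coeff_eq:
  assumes "i < dm c" "j < dm c"
  shows "A (coeff c i j) x = (\<Sum>k<dm c. rep c x $$ (i, k) * symb c x $$ (k, j))"
proof -
  let ?B = "mat (dm c) (dm c) (\<lambda>(i, j). A (coeff c i j) x)"
  note \<xi> = unitary_repD(1)[OF rep_unitary(1), of x]
  have B: "?B \<in> carrier_mat (dm c) (dm c)" by simp
  have "rep c x * mat_adjoint (rep c x) = 1\<^sub>m (dm c)"
    by (rule mat_mult_left_right_inverse[OF mat_adjoint_carrier[OF \<xi>] \<xi>])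
      (use rep_unitary(1) in \<open>simp add: unitary_rep_def\<close>)
  then have "rep c x * symb c x = ?B"
    unfolding symbol_def assoc_mult_mat[OF \<xi> mat_adjoint_carrier[OF \<xi>] B, symmetric] by simp
  then have "(rep c x * symb c x) $$ (i, j) = A (coeff c i j) x" using assms by simp
  then show ?thesis using mat_mult_index[OF \<xi> symb_carrier assms] by simp
qed

text \<open>Transposition turns the row sums in \<open>opnorm_linf\<close> into column sums of the
  symbol. These are what bounds an entry of \<xi> \<sigma>, where column j of \<sigma> is weighted
  with entries of \<xi> of modulus at most 1.\<close>

lemma opn_ge:
  assumes "j < dm c"
  shows "(\<Sum>k<dm c. cmod (symb c x $$ (k, j))) \<le> opn c x"
proof -
  have "(\<Sum>k<dm c. cmod (transpose_mat (symb c x) $$ (j, k))) \<le> opn c x"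
    unfolding opn_def opnorm_linf_def using symb_carrier[of x] assms by (intro Max_ge) auto
  also have "(\<Sum>k<dm c. cmod (transpose_mat (symb c x) $$ (j, k))) = (\<Sum>k<dm c. cmod (symb c x $$ (k, j)))"
    using symb_carrier[of x] assms by (intro sum.cong refl) auto
  finally show ?thesis .
qed

lemma opn_eq: "opn c x = (MAX j\<in>{..<dm c}. \<Sum>k<dm c. cmod (symb c x $$ (k, j)))"
proof -
  have "(\<lambda>j. \<Sum>k<dm c. cmod (transpose_mat (symb c x) $$ (j, k))) ` {..<dm c}
      = (\<lambda>j. \<Sum>k<dm c. cmod (symb c x $$ (k, j))) ` {..<dm c}"
    using symb_carrier[of x] by (intro image_cong refl sum.cong) auto
  then show ?thesis using symb_carrier[of x] by (simp add: opn_def opnorm_linf_def)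
qed

lemma opn_nonneg: "0 \<le> opn c x"
  using order_trans[OF sum_nonneg opn_ge[OF rep_unitary(2), of x]] by simp

text \<open>The integral of a non-integrable function is 0 by default, so comparing norms with that
  of \<open>opn c\<close> is sound only once this membership is known. The majorant \<open>g\<close>
  sums the moduli of all \<open>A (coeff c l j)\<close>.\<close>

lemma opn_Lp: "(\<lambda>x. complex_of_real (opn c x)) \<in> Lp_space p M"
proof -
  have Am: "A (coeff c k j) \<in> borel_measurable M" if "k < dm c" "j < dm c" for k j
    by (rule Lp_spaceD(1)[OF A_coeff_Lp[OF that]])
  have sm: "(\<lambda>x. symb c x $$ (k, j)) \<in> borel_measurable M" if "k < dm c" "j < dm c" for k j
    unfolding symb_index[OF that] using that
    by (intro borel_measurable_sum borel_measurable_times Am continuous_measurable continuous_intros coeff_cont) auto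
  have meas: "opn c \<in> borel_measurable M"
    unfolding opn_eq[abs_def] using sm by (intro borel_measurable_Max borel_measurable_sum measurable_compose[OF _ borel_measurable_norm]) auto
  define g where "g x = (\<Sum>j<dm c. \<Sum>k<dm c. \<Sum>l<dm c. complex_of_real (cmod (A (coeff c l j) x)))" for x
  have cmod_Lp: "(\<lambda>x. complex_of_real (cmod (A (coeff c l j) x))) \<in> Lp_space p M" if "l < dm c" "j < dm c" for l j
    by (rule Lp_space_mono[OF p A_coeff_Lp[OF that]])
      (use Am[OF that] in \<open>auto intro: borel_measurable_of_real borel_measurable_norm\<close>)
  have g: "g \<in> Lp_space p M" unfolding g_def by (intro Lp_space_sum p cmod_Lp) auto
  show ?thesis
  proof (rule Lp_space_mono[OF p g])
    show "(\<lambda>x. complex_of_real (opn c x)) \<in> borel_measurable M" using meas by simp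
    fix x
    have gr: "g x = complex_of_real (\<Sum>j<dm c. \<Sum>k<dm c. \<Sum>l<dm c. cmod (A (coeff c l j) x))"
      by (simp add: g_def)
    have sle: "cmod (symb c x $$ (k, j)) \<le> (\<Sum>l<dm c. cmod (A (coeff c l j) x))" if "k < dm c" "j < dm c" for k j
    proof -
      have "cmod (symb c x $$ (k, j)) \<le> (\<Sum>l<dm c. cmod (cnj (rep c x $$ (l, k)) * A (coeff c l j) x))"
        unfolding symb_index[OF that] by (rule norm_sum)
      also have "\<dots> \<le> (\<Sum>l<dm c. cmod (A (coeff c l j) x))"
        using unitary_rep_bound[OF rep_unitary(1) _ that(1)]
        by (intro sum_mono) (auto simp: norm_mult intro: mult_left_le_one_le)
      finally show ?thesis .
    qed
    have "opn c x \<le> (\<Sum>j<dm c. \<Sum>k<dm c. \<Sum>l<dm c. cmod (A (coeff c l j) x))"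
      unfolding opn_eq
    proof (rule Max.boundedI)
      fix a assume "a \<in> (\<lambda>j. \<Sum>k<dm c. cmod (symb c x $$ (k, j))) ` {..<dm c}"
      then obtain j where j: "j < dm c" "a = (\<Sum>k<dm c. cmod (symb c x $$ (k, j)))" by auto
      have "a \<le> (\<Sum>k<dm c. \<Sum>l<dm c. cmod (A (coeff c l j) x))"
        unfolding j(2) using j(1) by (intro sum_mono sle) auto
      also have "\<dots> \<le> (\<Sum>j<dm c. \<Sum>k<dm c. \<Sum>l<dm c. cmod (A (coeff c l j) x))"
        using j(1) by (intro member_le_sum[of j "{..<dm c}" "\<lambda>j. \<Sum>k<dm c. \<Sum>l<dm c. cmod (A (coeff c l j) x)"])
          (simp_all add: sum_nonneg)
      finally show "a \<le> (\<Sum>j<dm c. \<Sum>k<dm c. \<Sum>l<dm c. cmod (A (coeff c l j) x))" .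
    qed (use rep_unitary(2) in auto)
    then show "cmod (complex_of_real (opn c x)) \<le> cmod (g x)"
      unfolding gr norm_of_real using opn_nonneg[of x] by linarith
  qed
qed

lemma A_coeff_norm_le:
  assumes ij: "i < dm c" "j < dm c"
  shows "Lp_norm p M (A (coeff c i j)) \<le> Lp_norm p M (opn c)"
proof (rule Lp_norm_mono[OF p])
  show "integrable M (\<lambda>x. norm (opn c x) powr p)" using Lp_spaceD(2)[OF opn_Lp] by simp
  have "cmod (A (coeff c i j) x) \<le> opn c x" for x
  proof -
    have "cmod (A (coeff c i j) x) \<le> (\<Sum>k<dm c. cmod (rep c x $$ (i, k) * symb c x $$ (k, j)))"
      unfolding A_coeff_eq[OF ij] by (rule norm_sum)
    also have "\<dots> \<le> (\<Sum>k<dm c. cmod (symb c x $$ (k, j)))"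
      using unitary_rep_bound[OF rep_unitary(1) ij(1)]
      by (intro sum_mono) (auto simp: norm_mult intro: mult_left_le_one_le)
    also have "\<dots> \<le> opn c x" by (rule opn_ge[OF ij(2)])
    finally show ?thesis .
  qed
  then show "AE x in M. cmod (A (coeff c i j) x) \<le> norm (opn c x)"
    using opn_nonneg by simp
qed

lemma symb_trace_eq: "mat_trace (symb c x) = (\<Sum>i<dm c. \<Sum>j<dm c. A (coeff c i j) x * cnj (coeff c i j x))"
proof -
  have "mat_trace (symb c x) = (\<Sum>j<dm c. \<Sum>i<dm c. A (coeff c i j) x * cnj (coeff c i j x))"
    unfolding mat_trace_def using symb_carrier[of x] by (auto simp: symb_index mult.commute intro!: sum.cong)
  also have "\<dots> = (\<Sum>i<dm c. \<Sum>j<dm c. A (coeff c i j) x * cnj (coeff c i j x))" by (rule sum.swap)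
  finally show ?thesis .
qed

lemma A_coeff_integrable:
  assumes ij: "i < dm c" "j < dm c" and f: "f \<in> Lp_space p M"
  shows "integrable M (\<lambda>x. f x * cnj (coeff c i j x))"
proof (rule Bochner_Integration.integrable_bound[OF Lp_integrable(1)[OF p f]])
  have "cmod (f x * cnj (coeff c i j x)) \<le> cmod (f x)" for x
    using unitary_rep_bound[OF rep_unitary(1) ij, of x] by (simp add: norm_mult mult_left_le)
  then show "AE x in M. cmod (f x * cnj (coeff c i j x)) \<le> cmod (f x)" by simp
  show "(\<lambda>x. f x * cnj (coeff c i j x)) \<in> borel_measurable M"
    by (intro borel_measurable_times Lp_spaceD(1)[OF f] continuous_measurable continuous_intros coeff_cont ij)
qed

lemma symb_trace_integrable: "integrable M (\<lambda>x. of_nat (dm c) * mat_trace (symb c x))"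
  unfolding symb_trace_eq
  by (intro integrable_mult_right Bochner_Integration.integrable_sum A_coeff_integrable A_coeff_Lp) auto

text \<open>The right-hand side is the block of class \<open>c\<close> in the trace of the nuclear
  series.\<close>

lemma symb_trace_integral:
  "(LINT x|M. of_nat (dm c) * mat_trace (symb c x)) =
    (\<Sum>(i, j)\<in>{..<dm c} \<times> {..<dm c}. of_nat (dm c) * L2_inner (A (coeff c i j)) (coeff c i j))"
proof -
  have "(LINT x|M. mat_trace (symb c x)) = (\<Sum>i<dm c. \<Sum>j<dm c. LINT x|M. A (coeff c i j) x * cnj (coeff c i j x))"
    unfolding symb_trace_eq
    by (subst Bochner_Integration.integral_sum, intro Bochner_Integration.integrable_sum A_coeff_integrable A_coeff_Lp,
        simp_all, intro sum.cong refl Bochner_Integration.integral_sum A_coeff_integrable A_coeff_Lp) auto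
  then show ?thesis unfolding L2_inner_def sum.cartesian_product[symmetric] by (simp add: sum_distrib_left)
qed

text \<open>One factor d is the weight in the trace formula, the other counts the diagonal entries,
  each of which is at most a column sum.\<close>

lemma symb_trace_norm_integral: "(LINT x|M. cmod (of_nat (dm c) * mat_trace (symb c x))) \<le> (real (dm c))\<^sup>2 * Lp_norm p M (opn c)"
proof -
  have le: "cmod (of_nat (dm c) * mat_trace (symb c x)) \<le> (real (dm c))\<^sup>2 * cmod (complex_of_real (opn c x))" for x
  proof -
    have "cmod (mat_trace (symb c x)) \<le> (\<Sum>i<dm c. cmod (symb c x $$ (i, i)))"
      unfolding mat_trace_def using symb_carrier[of x] by (auto intro: norm_sum)
    also have "\<dots> \<le> (\<Sum>i<dm c. opn c x)"
    proof (rule sum_mono)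
      fix i assume "i \<in> {..<dm c}"
      then have i: "i < dm c" by simp
      have "cmod (symb c x $$ (i, i)) \<le> (\<Sum>k<dm c. cmod (symb c x $$ (k, i)))"
        using i by (intro member_le_sum) auto
      also have "\<dots> \<le> opn c x" by (rule opn_ge[OF i])
      finally show "cmod (symb c x $$ (i, i)) \<le> opn c x" .
    qed
    finally have "cmod (mat_trace (symb c x)) \<le> real (dm c) * opn c x" by simp
    then have "real (dm c) * cmod (mat_trace (symb c x)) \<le> real (dm c) * (real (dm c) * opn c x)"
      by (intro mult_left_mono) auto
    then show ?thesis using opn_nonneg[of x] by (simp add: norm_mult power2_eq_square mult.assoc)
  qed
  have "(LINT x|M. cmod (of_nat (dm c) * mat_trace (symb c x))) \<le> (LINT x|M. (real (dm c))\<^sup>2 * cmod (complex_of_real (opn c x)))"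
    using le symb_trace_integrable Lp_integrable(1)[OF p opn_Lp] by (intro integral_mono) (auto simp del: norm_of_real)
  also have "\<dots> = (real (dm c))\<^sup>2 * (LINT x|M. cmod (complex_of_real (opn c x)))" by (rule integral_mult_right_zero)
  also have "\<dots> \<le> (real (dm c))\<^sup>2 * Lp_norm p M (\<lambda>x. complex_of_real (opn c x))"
    by (intro mult_left_mono Lp_integrable(2)[OF p opn_Lp]) auto
  finally show ?thesis by (simp add: Lp_norm_of_real)
qed

end

end

section \<open>The Fourier series of the operator and its trace\<close>

context symbol_operator
begin

definition idx :: "(('a \<Rightarrow> complex mat) set \<times> nat \<times> nat) set" where
  "idx = (SIGMA c:unitary_dual G. {..<dm c} \<times> {..<dm c})"

text \<open>Up to the factor d this is entry (j, i) of the Fourier coefficient of \<open>f\<close>,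
  so the inversion formula expands \<open>f\<close> in the \<open>coeff c i j\<close> with exactly
  these values.\<close>

definition fourier :: "('a \<Rightarrow> complex mat) set \<times> nat \<times> nat \<Rightarrow> ('a \<Rightarrow> complex) \<Rightarrow> complex" where
  "fourier = (\<lambda>(c, i, j) f. of_nat (dm c) * L2_inner f (coeff c i j))"

definition fourier_image :: "('a \<Rightarrow> complex mat) set \<times> nat \<times> nat \<Rightarrow> 'a \<Rightarrow> complex" where
  "fourier_image = (\<lambda>(c, i, j). A (coeff c i j))"

lemma countable_dual: "countable (unitary_dual G)"
  by (rule countable_unitary_dual[where rep=rep]) (rule rep)

lemma countable_idx: "countable idx"
  unfolding idx_def using countable_dual by (intro countable_SIGMA) auto

lemma idx_cases:
  assumes "t \<in> idx"
  obtains c i j where "t = (c, i, j)" "c \<in> unitary_dual G" "i < dm c" "j < dm c"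
  using assms by (auto simp: idx_def)

lemma fourier_bound:
  assumes "c \<in> unitary_dual G" "i < dm c" "j < dm c" "f \<in> Lp_space p M"
  shows "cmod (fourier (c, i, j) f) \<le> real (dm c) powr (1 / min 2 p) * Lp_norm p M f"
proof -
  have d: "0 < real (dm c)" using rep_unitary(2)[OF assms(1)] by simp
  have "cmod (fourier (c, i, j) f) = real (dm c) * cmod (L2_inner f (coeff c i j))"
    by (simp add: fourier_def norm_mult)
  also have "\<dots> \<le> real (dm c) * (real (dm c) powr (1 / min 2 p - 1) * Lp_norm p M f)"
    by (intro mult_left_mono coeff_functional_bound p rep_irreps assms) auto
  also have "\<dots> = real (dm c) powr (1 / min 2 p) * Lp_norm p M f"
    using d by (simp add: powr_diff)
  finally show ?thesis .
qed

lemma fourier_dual: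
  assumes t: "t \<in> idx"
  shows "fourier t \<in> Lp_dual p M"
proof -
  obtain c i j where t: "t = (c, i, j)" "c \<in> unitary_dual G" "i < dm c" "j < dm c" by (rule idx_cases[OF t], rule that)
  show ?thesis
    unfolding dual_space_def t(1)
  proof (intro CollectI conjI ballI allI exI)
    fix f g assume f: "f \<in> Lp_space p M" and g: "g \<in> Lp_space p M"
    show "fourier (c, i, j) (\<lambda>y. f y + g y) = fourier (c, i, j) f + fourier (c, i, j) g"
      using A_coeff_integrable[OF t(2-4) f] A_coeff_integrable[OF t(2-4) g]
      by (simp add: fourier_def L2_inner_def distrib_right distrib_left)
  next
    fix a f
    show "fourier (c, i, j) (\<lambda>y. a * f y) = a * fourier (c, i, j) f"
      by (simp add: fourier_def L2_inner_scale_left)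
  next
    fix f assume "f \<in> Lp_space p M"
    then show "cmod (fourier (c, i, j) f) \<le> real (dm c) powr (1 / min 2 p) * Lp_norm p M f"
      by (rule fourier_bound[OF t(2-4)])
  qed
qed

lemma zero_dual: "(\<lambda>_. 0) \<in> Lp_dual p M"
  by (auto simp: dual_space_def intro!: exI[of _ 0])

lemma fourier_image_Lp: "t \<in> idx \<Longrightarrow> fourier_image t \<in> Lp_space p M"
  by (erule idx_cases) (simp add: fourier_image_def A_coeff_Lp)

text \<open>The weight d cancels the 1/d of Schur orthogonality, which makes the functionals
  biorthogonal to the coefficients.\<close>

lemma fourier_coeff:
  assumes s: "s \<in> idx" and t: "(c, i, j) \<in> idx"
  shows "fourier s (coeff c i j) = (if s = (c, i, j) then 1 else 0)"
proof -
  obtain c' k l where s: "s = (c', k, l)" "c' \<in> unitary_dual G" "k < dm c'" "l < dm c'" by (rule idx_cases[OF s], rule that)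
  have t: "c \<in> unitary_dual G" "i < dm c" "j < dm c" using t by (auto simp: idx_def)
  show ?thesis
  proof (cases "c = c'")
    case True
    then show ?thesis
      using s t rep_unitary(2)[OF s(2)]
      by (auto simp: fourier_def schur_orthogonality[OF rep_irreps[OF s(2)]])
  next
    case False
    then have "(rep c, rep c') \<notin> rep_equiv G"
      by (intro unitary_dual_inequivalent[OF t(1) s(2) rep[OF t(1)] rep[OF s(2)]])
    then show ?thesis
      using False s t by (auto simp: fourier_def schur_inequivalent[OF rep_irreps[OF t(1)] rep_irreps[OF s(2)]])
  qed
qed

definition xs :: "nat \<Rightarrow> ('a \<Rightarrow> complex) \<Rightarrow> complex" where
  "xs = seq_of idx fourier (\<lambda>_. 0)"

definition ys :: "nat \<Rightarrow> 'a \<Rightarrow> complex" where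
  "ys = seq_of idx fourier_image (\<lambda>_. 0)"

lemma xs_dual: "xs n \<in> Lp_dual p M"
  by (rule seq_of_cases[of idx fourier "\<lambda>_. 0" n])
    (auto simp: xs_def zero_dual seq_of_to_nat_on[OF countable_idx] fourier_dual)

lemma ys_Lp: "ys n \<in> Lp_space p M"
  by (rule seq_of_cases[of idx fourier_image "\<lambda>_. 0" n])
    (auto simp: ys_def seq_of_to_nat_on[OF countable_idx] fourier_image_Lp)

definition partial :: "nat \<Rightarrow> ('a \<Rightarrow> complex) \<Rightarrow> 'a \<Rightarrow> complex" where
  "partial k f x = (\<Sum>n<k. xs n f * ys n x)"

lemma partial_Lp: "partial k f \<in> Lp_space p M"
  unfolding partial_def by (intro Lp_space_sum p Lp_space_scale ys_Lp)

lemma partial_add: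
  assumes "f \<in> Lp_space p M" "g \<in> Lp_space p M"
  shows "partial k (\<lambda>y. f y + g y) x = partial k f x + partial k g x"
  by (simp add: partial_def dual_spaceD(1)[OF xs_dual assms] distrib_right sum.distrib)

lemma partial_scale:
  assumes "f \<in> Lp_space p M"
  shows "partial k (\<lambda>y. a * f y) x = a * partial k f x"
  by (simp add: partial_def dual_spaceD(2)[OF xs_dual assms] sum_distrib_left mult.assoc)

text \<open>By biorthogonality a single term survives; \<open>partial k\<close> runs over n < k, so
  the code of the index must lie strictly below \<open>k\<close>.\<close>

lemma partial_coeff:
  assumes t: "(c, i, j) \<in> idx" and k: "to_nat_on idx (c, i, j) < k"
  shows "partial k (coeff c i j) x = A (coeff c i j) x"
proof -
  let ?n = "to_nat_on idx (c, i, j)"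
  have "xs n (coeff c i j) * ys n x = (if n = ?n then A (coeff c i j) x else 0)" for n
  proof (rule seq_of_cases[of idx fourier "\<lambda>_. 0" n])
    assume "seq_of idx fourier (\<lambda>_. 0) n = (\<lambda>_. 0)" "n \<notin> to_nat_on idx ` idx"
    then show ?thesis using t by (auto simp: xs_def)
  next
    fix s assume s: "s \<in> idx" "n = to_nat_on idx s"
    have "n = ?n \<longleftrightarrow> s = (c, i, j)" using s t countable_idx by simp
    then show ?thesis
      using s t fourier_coeff[OF s(1) t]
      by (auto simp: xs_def ys_def seq_of_to_nat_on[OF countable_idx] fourier_image_def)
  qed
  then show ?thesis using k by (simp add: partial_def)
qed

text \<open>Singles out the functions on which the series represents \<open>A\<close>. They are
  shown to include the trigonometric polynomials and then, by density and uniform bounds, all of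
  Lp.\<close>

definition converges :: "('a \<Rightarrow> complex) \<Rightarrow> bool" where
  "converges f \<longleftrightarrow> f \<in> Lp_space p M \<and> (\<lambda>k. Lp_norm p M (\<lambda>x. A f x - partial k f x)) \<longlonglongrightarrow> 0"

lemma converges_coeff:
  assumes "c \<in> unitary_dual G" "i < dm c" "j < dm c"
  shows "converges (coeff c i j)"
  unfolding converges_def
proof
  have t: "(c, i, j) \<in> idx" using assms by (auto simp: idx_def)
  show "coeff c i j \<in> Lp_space p M" by (rule coeff_Lp[OF assms])
  have "\<forall>\<^sub>F k in sequentially. to_nat_on idx (c, i, j) < k" by (rule eventually_gt_at_top)
  then have "\<forall>\<^sub>F k in sequentially. Lp_norm p M (\<lambda>x. A (coeff c i j) x - partial k (coeff c i j) x) = 0"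
    by eventually_elim (simp add: partial_coeff[OF t])
  then show "(\<lambda>k. Lp_norm p M (\<lambda>x. A (coeff c i j) x - partial k (coeff c i j) x)) \<longlonglongrightarrow> 0"
    by (rule tendsto_eventually)
qed

lemma converges_add:
  assumes "converges f" "converges g"
  shows "converges (\<lambda>y. f y + g y)"
proof -
  have f: "f \<in> Lp_space p M" "(\<lambda>k. Lp_norm p M (\<lambda>x. A f x - partial k f x)) \<longlonglongrightarrow> 0"
    and g: "g \<in> Lp_space p M" "(\<lambda>k. Lp_norm p M (\<lambda>x. A g x - partial k g x)) \<longlonglongrightarrow> 0"
    using assms by (auto simp: converges_def)
  have fg: "(\<lambda>y. f y + g y) \<in> Lp_space p M" by (rule Lp_space_add[OF p f(1) g(1)])
  have "(\<lambda>k. Lp_norm p M (\<lambda>x. A (\<lambda>y. f y + g y) x - partial k (\<lambda>y. f y + g y) x)) \<longlonglongrightarrow> 0"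
  proof (rule Lim_null_comparison)
    show "(\<lambda>k. Lp_norm p M (\<lambda>x. A f x - partial k f x) + Lp_norm p M (\<lambda>x. A g x - partial k g x)) \<longlonglongrightarrow> 0"
      using tendsto_add[OF f(2) g(2)] by simp
    have "Lp_norm p M (\<lambda>x. A (\<lambda>y. f y + g y) x - partial k (\<lambda>y. f y + g y) x)
        \<le> Lp_norm p M (\<lambda>x. A f x - partial k f x) + Lp_norm p M (\<lambda>x. A g x - partial k g x)" for k
    proof -
      have "Lp_norm p M (\<lambda>x. A (\<lambda>y. f y + g y) x - partial k (\<lambda>y. f y + g y) x)
          \<le> Lp_norm p M (\<lambda>x. A (\<lambda>y. f y + g y) x - (A f x + A g x))
            + Lp_norm p M (\<lambda>x. (A f x + A g x) - partial k (\<lambda>y. f y + g y) x)"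
        by (intro Lp_norm_triangle_diff p A_Lp fg partial_Lp Lp_space_add f g)
      \<comment> \<open>Additivity of \<open>A\<close> holds in the seminorm and not
        pointwise.\<close>
      also have "Lp_norm p M (\<lambda>x. A (\<lambda>y. f y + g y) x - (A f x + A g x)) = 0"
        using A f(1) g(1) by (simp add: bounded_operator_def)
      also have "(\<lambda>x. (A f x + A g x) - partial k (\<lambda>y. f y + g y) x)
          = (\<lambda>x. (A f x - partial k f x) + (A g x - partial k g x))"
        by (simp add: partial_add[OF f(1) g(1)] algebra_simps)
      also have "Lp_norm p M \<dots> \<le> Lp_norm p M (\<lambda>x. A f x - partial k f x) + Lp_norm p M (\<lambda>x. A g x - partial k g x)"
        by (intro Lp_norm_triangle p Lp_space_diff A_Lp partial_Lp f g)
      finally show ?thesis by simp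
    qed
    then show "\<forall>\<^sub>F k in sequentially. norm (Lp_norm p M (\<lambda>x. A (\<lambda>y. f y + g y) x - partial k (\<lambda>y. f y + g y) x))
        \<le> Lp_norm p M (\<lambda>x. A f x - partial k f x) + Lp_norm p M (\<lambda>x. A g x - partial k g x)"
      by simp
  qed
  with fg show ?thesis by (simp add: converges_def)
qed

lemma converges_scale:
  assumes "converges f"
  shows "converges (\<lambda>y. a * f y)"
proof -
  have f: "f \<in> Lp_space p M" "(\<lambda>k. Lp_norm p M (\<lambda>x. A f x - partial k f x)) \<longlonglongrightarrow> 0"
    using assms by (auto simp: converges_def)
  have af: "(\<lambda>y. a * f y) \<in> Lp_space p M" by (rule Lp_space_scale[OF f(1)])
  have "(\<lambda>k. Lp_norm p M (\<lambda>x. A (\<lambda>y. a * f y) x - partial k (\<lambda>y. a * f y) x)) \<longlonglongrightarrow> 0"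
  proof (rule Lim_null_comparison)
    show "(\<lambda>k. cmod a * Lp_norm p M (\<lambda>x. A f x - partial k f x)) \<longlonglongrightarrow> 0"
      using tendsto_mult_left[OF f(2)] by simp
    have "Lp_norm p M (\<lambda>x. A (\<lambda>y. a * f y) x - partial k (\<lambda>y. a * f y) x)
        \<le> cmod a * Lp_norm p M (\<lambda>x. A f x - partial k f x)" for k
    proof -
      have "Lp_norm p M (\<lambda>x. A (\<lambda>y. a * f y) x - partial k (\<lambda>y. a * f y) x)
          \<le> Lp_norm p M (\<lambda>x. A (\<lambda>y. a * f y) x - a * A f x)
            + Lp_norm p M (\<lambda>x. a * A f x - partial k (\<lambda>y. a * f y) x)"
        by (intro Lp_norm_triangle_diff p A_Lp af partial_Lp Lp_space_scale f)
      also have "Lp_norm p M (\<lambda>x. A (\<lambda>y. a * f y) x - a * A f x) = 0"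
        using A f(1) by (simp add: bounded_operator_def)
      also have "(\<lambda>x. a * A f x - partial k (\<lambda>y. a * f y) x) = (\<lambda>x. a * (A f x - partial k f x))"
        by (simp add: partial_scale[OF f(1)] algebra_simps)
      finally show ?thesis by (simp only: Lp_norm_scale[OF p])
    qed
    then show "\<forall>\<^sub>F k in sequentially. norm (Lp_norm p M (\<lambda>x. A (\<lambda>y. a * f y) x - partial k (\<lambda>y. a * f y) x))
        \<le> cmod a * Lp_norm p M (\<lambda>x. A f x - partial k f x)"
      by simp
  qed
  with af show ?thesis by (simp add: converges_def)
qed

lemma converges_zero: "converges (\<lambda>x. 0)"
proof -
  have "Lp_norm p M (\<lambda>x. A (\<lambda>y. a * f y) x - a * A f x) = 0" if "f \<in> Lp_space p M" for a f
    using A that by (simp add: bounded_operator_def)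
  from this[OF Lp_space_zero, of 0] have "Lp_norm p M (\<lambda>x. A (\<lambda>y. 0) x - partial k (\<lambda>y. 0) x) = 0" for k
    by (simp add: partial_def dual_zero[OF p xs_dual])
  then show ?thesis by (simp add: converges_def)
qed

lemma converges_sum:
  assumes "\<And>i. i \<in> I \<Longrightarrow> converges (f i)"
  shows "converges (\<lambda>x. \<Sum>i\<in>I. f i x)"
  using assms by (induction I rule: infinite_finite_induct) (auto intro: converges_zero converges_add)

text \<open>Every class of irreducible representations is represented by \<open>rep\<close>, and the coefficients of
  equivalent representations are linear combinations of each other.\<close>

lemma converges_matrix_coeff:
  assumes "m \<in> matrix_coeffs"
  shows "converges m"
proof -
  obtain \<xi> d' i j where \<xi>: "\<xi> \<in> irreps G" "unitary_rep G \<xi> d'" "i < d'" "j < d'" "m = (\<lambda>x. \<xi> x $$ (i, j))"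
    using assms unfolding matrix_coeffs_def by blast
  define c where "c = rep_equiv G `` {\<xi>}"
  have c: "c \<in> unitary_dual G" unfolding unitary_dual_def c_def by (rule quotientI[OF \<xi>(1)])
  have equiv: "(\<xi>, rep c) \<in> rep_equiv G" using rep[OF c] by (simp add: c_def)
  obtain T S d where R: "\<xi> \<in> irreps G" "rep c \<in> irreps G" "rep_dim G \<xi> = d" "dm c = d"
    "T \<in> carrier_mat d d" "S \<in> carrier_mat d d" "T * S = 1\<^sub>m d" "S * T = 1\<^sub>m d" "\<And>x. T * \<xi> x = rep c x * T"
    by (rule rep_equivE[OF equiv], rule that)
  have \<xi>c: "\<xi> x \<in> carrier_mat d d" and \<eta>c: "rep c x \<in> carrier_mat d d" for x
    by (rule irreps_carrier[OF R(1,3)], rule irreps_carrier[OF R(2,4)])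
  have "d' = d" using \<xi>c[of \<one>] unitary_repD(1)[OF \<xi>(2), of \<one>] by auto
  then have ij: "i < d" "j < d" using \<xi> by auto
  have "m x = (\<Sum>k<d. \<Sum>l<d. (S $$ (i, k) * T $$ (l, j)) * coeff c k l x)" for x
  proof -
    have "\<xi> x = S * T * \<xi> x" using R(8) \<xi>c[of x] by simp
    also have "\<dots> = S * (rep c x * T)" unfolding assoc_mult_mat[OF R(6,5) \<xi>c] R(9) ..
    finally have "m x = (S * (rep c x * T)) $$ (i, j)" using \<xi>(5) by simp
    also have "\<dots> = (\<Sum>k<d. S $$ (i, k) * (\<Sum>l<d. rep c x $$ (k, l) * T $$ (l, j)))"
      unfolding mat_mult_index[OF R(6) mult_carrier_mat[OF \<eta>c R(5)] ij]
      using mat_mult_index[OF \<eta>c R(5) _ ij(2)] by (intro sum.cong refl) simp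
    finally show ?thesis by (simp add: sum_distrib_left mult_ac)
  qed
  then have "m = (\<lambda>x. \<Sum>k<d. \<Sum>l<d. (S $$ (i, k) * T $$ (l, j)) * coeff c k l x)" by blast
  moreover have "converges (\<lambda>x. \<Sum>k<d. \<Sum>l<d. (S $$ (i, k) * T $$ (l, j)) * coeff c k l x)"
    using R(4) by (intro converges_sum converges_scale converges_coeff c) auto
  ultimately show ?thesis by simp
qed

lemma converges_trig: "f \<in> trig_polys \<Longrightarrow> converges f"
  by (induction rule: trig_polys.induct)
    (auto intro: converges_matrix_coeff converges_zero converges_add converges_scale)

context
  fixes r :: real
  assumes r: "0 < r" "r \<le> 1"
    and sum: "(\<lambda>c. real (dm c) powr (2 + r / min 2 p) * Lp_norm p M (opn c) powr r) summable_on unitary_dual G"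
begin

abbreviation dn :: "(('a \<Rightarrow> complex) \<Rightarrow> complex) \<Rightarrow> real" where
  "dn \<equiv> Lp_dual_norm p M"

lemma summable_idx: "(\<lambda>t. dn (fourier t) powr r * Lp_norm p M (fourier_image t) powr r) summable_on idx"
proof (rule summable_on_comparison_test)
  let ?b = "\<lambda>c. real (dm c) powr (r / min 2 p) * Lp_norm p M (opn c) powr r"
  have "(\<lambda>(c, ij). ?b c) summable_on (SIGMA c:unitary_dual G. {..<dm c} \<times> {..<dm c})"
  proof (rule summable_on_SigmaI[OF _ sum])
    fix c assume c: "c \<in> unitary_dual G"
    have "((\<lambda>_. ?b c) has_sum (\<Sum>_\<in>{..<dm c} \<times> {..<dm c}. ?b c)) ({..<dm c} \<times> {..<dm c})"
      by (rule has_sum_finite) simp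
    also have "(\<Sum>_\<in>{..<dm c} \<times> {..<dm c}. ?b c) = real (dm c) powr (2 + r / min 2 p) * Lp_norm p M (opn c) powr r"
      using rep_unitary(2)[OF c] by (simp add: powr_add powr_numeral power2_eq_square)
    finally show "((\<lambda>y. case (c, y) of (c, ij) \<Rightarrow> ?b c) has_sum
        real (dm c) powr (2 + r / min 2 p) * Lp_norm p M (opn c) powr r) ({..<dm c} \<times> {..<dm c})" by simp
  qed simp
  then show "(\<lambda>(c, ij). ?b c) summable_on idx" by (simp add: idx_def)
  fix t assume t: "t \<in> idx"
  obtain c i j where t': "t = (c, i, j)" "c \<in> unitary_dual G" "i < dm c" "j < dm c" by (rule idx_cases[OF t], rule that)
  have "dn (fourier t) \<le> real (dm c) powr (1 / min 2 p)"
    unfolding t'(1) by (rule dual_norm_le[OF p]) (auto intro: fourier_bound[OF t'(2-4)])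
  then have "dn (fourier t) powr r \<le> (real (dm c) powr (1 / min 2 p)) powr r"
    using r dual_norm_nonneg[OF p fourier_dual[OF t]] by (intro powr_mono2) auto
  moreover have "Lp_norm p M (fourier_image t) powr r \<le> Lp_norm p M (opn c) powr r"
    using r A_coeff_norm_le[OF t'(2-4)] by (intro powr_mono2) (auto simp: t'(1) fourier_image_def)
  ultimately show "dn (fourier t) powr r * Lp_norm p M (fourier_image t) powr r \<le> (case t of (c, ij) \<Rightarrow> ?b c)"
    unfolding t'(1) by (auto simp: powr_powr mult.commute[of _ r] intro!: mult_mono)
qed simp

lemma summable_idx_one: "(\<lambda>t. dn (fourier t) * Lp_norm p M (fourier_image t)) summable_on idx"
proof (rule summable_on_of_powr[OF _ _ r])
  show "0 \<le> dn (fourier t) * Lp_norm p M (fourier_image t)" if "t \<in> idx" for t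
    using dual_norm_nonneg[OF p fourier_dual[OF that]] by simp
  have "(\<lambda>t. (dn (fourier t) * Lp_norm p M (fourier_image t)) powr r) summable_on idx \<longleftrightarrow>
      (\<lambda>t. dn (fourier t) powr r * Lp_norm p M (fourier_image t) powr r) summable_on idx"
    using dual_norm_nonneg[OF p fourier_dual] by (intro summable_on_cong) (simp add: powr_mult)
  then show "(\<lambda>t. (dn (fourier t) * Lp_norm p M (fourier_image t)) powr r) summable_on idx"
    using summable_idx by simp
qed

lemma summable_seq: "summable (\<lambda>n. dn (xs n) * Lp_norm p M (ys n))"
proof -
  have "(\<lambda>n. dn (xs n) * Lp_norm p M (ys n)) = seq_of idx (\<lambda>t. dn (fourier t) * Lp_norm p M (fourier_image t)) 0"
    unfolding xs_def ys_def
    by (rule ext, subst seq_of_apply2[where h="\<lambda>x y. dn x * Lp_norm p M y"]) simp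
  then show ?thesis using summable_seq_of[OF countable_idx summable_idx_one] by argo
qed

lemma summable_seq_powr: "summable (\<lambda>n. dn (xs n) powr r * Lp_norm p M (ys n) powr r)"
proof -
  have "(\<lambda>n. dn (xs n) powr r * Lp_norm p M (ys n) powr r)
      = seq_of idx (\<lambda>t. dn (fourier t) powr r * Lp_norm p M (fourier_image t) powr r) 0"
    unfolding xs_def ys_def
    by (rule ext, subst seq_of_apply2[where h="\<lambda>x y. dn x powr r * Lp_norm p M y powr r"]) simp
  then show ?thesis using summable_seq_of[OF countable_idx summable_idx] by argo
qed

text \<open>The bound does not depend on \<open>k\<close>, which is what allows convergence to pass
  from a dense subspace to the whole space. \<open>K\<close> is the sum of the products of the norms
  in the series, plus 1 for positivity.\<close>

lemma partial_diff_bound: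
  obtains K where "0 < K" "\<And>f g k. f \<in> Lp_space p M \<Longrightarrow> g \<in> Lp_space p M \<Longrightarrow>
    Lp_norm p M (\<lambda>x. partial k f x - partial k g x) \<le> K * Lp_norm p M (\<lambda>x. f x - g x)"
proof -
  define K where "K = (\<Sum>n. dn (xs n) * Lp_norm p M (ys n)) + 1"
  have nn: "0 \<le> dn (xs n) * Lp_norm p M (ys n)" for n using dual_norm_nonneg[OF p xs_dual] by simp
  show ?thesis
  proof (rule that[of K])
    show "0 < K" using suminf_nonneg[OF summable_seq nn] by (simp add: K_def)
    fix f g k assume f: "f \<in> Lp_space p M" and g: "g \<in> Lp_space p M"
    have fg: "(\<lambda>x. f x - g x) \<in> Lp_space p M" by (rule Lp_space_diff[OF p f g])
    have "partial k f x - partial k g x = (\<Sum>n<k. xs n (\<lambda>x. f x - g x) * ys n x)" for x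
      by (simp add: partial_def dual_diff[OF p xs_dual f g] left_diff_distrib sum_subtractf)
    then have "Lp_norm p M (\<lambda>x. partial k f x - partial k g x)
        \<le> (\<Sum>n<k. Lp_norm p M (\<lambda>x. xs n (\<lambda>x. f x - g x) * ys n x))"
      using Lp_norm_sum[OF p, of "{..<k}" "\<lambda>n x. xs n (\<lambda>x. f x - g x) * ys n x"]
      by (simp add: Lp_space_scale ys_Lp)
    also have "\<dots> \<le> (\<Sum>n<k. dn (xs n) * Lp_norm p M (ys n) * Lp_norm p M (\<lambda>x. f x - g x))"
    proof (rule sum_mono)
      fix n
      have "cmod (xs n (\<lambda>x. f x - g x)) * Lp_norm p M (ys n) \<le> dn (xs n) * Lp_norm p M (\<lambda>x. f x - g x) * Lp_norm p M (ys n)"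
        by (intro mult_right_mono dual_norm_bound[OF p xs_dual fg]) auto
      then show "Lp_norm p M (\<lambda>x. xs n (\<lambda>x. f x - g x) * ys n x) \<le> dn (xs n) * Lp_norm p M (ys n) * Lp_norm p M (\<lambda>x. f x - g x)"
        unfolding Lp_norm_scale[OF p] by (simp add: mult_ac)
    qed
    also have "\<dots> = (\<Sum>n<k. dn (xs n) * Lp_norm p M (ys n)) * Lp_norm p M (\<lambda>x. f x - g x)"
      by (rule sum_distrib_right[symmetric])
    also have "\<dots> \<le> K * Lp_norm p M (\<lambda>x. f x - g x)"
    proof (rule mult_right_mono)
      show "(\<Sum>n<k. dn (xs n) * Lp_norm p M (ys n)) \<le> K"
        using sum_le_suminf[OF summable_seq, of "{..<k}"] nn by (simp add: K_def)
    qed simp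
    finally show "Lp_norm p M (\<lambda>x. partial k f x - partial k g x) \<le> K * Lp_norm p M (\<lambda>x. f x - g x)" .
  qed
qed

lemma converges_all:
  assumes f: "f \<in> Lp_space p M"
  shows "converges f"
proof -
  obtain C where C: "0 < C" "\<And>f g. f \<in> Lp_space p M \<Longrightarrow> g \<in> Lp_space p M \<Longrightarrow>
    Lp_norm p M (\<lambda>x. A f x - A g x) \<le> C * Lp_norm p M (\<lambda>x. f x - g x)"
    by (rule bounded_operator_diff[OF p A], rule that)
  obtain K where K: "0 < K" "\<And>f g k. f \<in> Lp_space p M \<Longrightarrow> g \<in> Lp_space p M \<Longrightarrow>
    Lp_norm p M (\<lambda>x. partial k f x - partial k g x) \<le> K * Lp_norm p M (\<lambda>x. f x - g x)"
    by (rule partial_diff_bound, rule that)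
  have "(\<lambda>k. Lp_norm p M (\<lambda>x. A f x - partial k f x)) \<longlonglongrightarrow> 0"
  proof (rule tendstoI)
    fix e :: real assume e: "0 < e"
    define L where "L = C + K"
    have L: "0 < L" using C(1) K(1) by (simp add: L_def)
    \<comment> \<open>Replacing \<open>f\<close> by \<open>g\<close> costs at most \<open>C\<close>
      times their distance in \<open>A\<close> and \<open>K\<close> times in the partial sum,
      together at most e / 2; the other half is left for the convergence at
      \<open>g\<close>.\<close>
    define \<delta> where "\<delta> = e / (2 * L)"
    have \<delta>: "0 < \<delta>" using e L by (simp add: \<delta>_def)
    obtain g where g: "g \<in> trig_polys" "Lp_norm p M (\<lambda>x. f x - g x) < \<delta>"
      by (rule peter_weyl[OF p f \<delta>], rule that)
    have gL: "g \<in> Lp_space p M" by (rule continuous_Lp[OF p trig_polys_cont[OF g(1)]])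
    have "(\<lambda>k. Lp_norm p M (\<lambda>x. A g x - partial k g x)) \<longlonglongrightarrow> 0"
      using converges_trig[OF g(1)] by (simp add: converges_def)
    then have "\<forall>\<^sub>F k in sequentially. Lp_norm p M (\<lambda>x. A g x - partial k g x) < e / 2"
      using e by (intro order_tendstoD(2)) auto
    then show "\<forall>\<^sub>F k in sequentially. dist (Lp_norm p M (\<lambda>x. A f x - partial k f x)) 0 < e"
    proof eventually_elim
      case (elim k)
      have "Lp_norm p M (\<lambda>x. A f x - partial k f x) \<le> Lp_norm p M (\<lambda>x. A f x - A g x) + Lp_norm p M (\<lambda>x. A g x - partial k f x)"
        by (intro Lp_norm_triangle_diff p A_Lp f gL partial_Lp)
      moreover have "Lp_norm p M (\<lambda>x. A g x - partial k f x) \<le> Lp_norm p M (\<lambda>x. A g x - partial k g x) + Lp_norm p M (\<lambda>x. partial k g x - partial k f x)"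
        by (intro Lp_norm_triangle_diff p A_Lp gL partial_Lp)
      moreover have "Lp_norm p M (\<lambda>x. A f x - A g x) \<le> C * Lp_norm p M (\<lambda>x. f x - g x)" by (rule C(2)[OF f gL])
      moreover have "Lp_norm p M (\<lambda>x. partial k g x - partial k f x) \<le> K * Lp_norm p M (\<lambda>x. f x - g x)"
        using K(2)[OF gL f, of k] Lp_norm_minus_commute[of p M f g] by simp
      moreover have "L * Lp_norm p M (\<lambda>x. f x - g x) \<le> L * \<delta>"
        using g(2) L by (intro mult_left_mono) auto
      moreover have "L * \<delta> = e / 2" using L by (simp add: \<delta>_def)
      ultimately show ?case using elim by (simp add: L_def distrib_right)
    qed
  qed
  with f show ?thesis by (simp add: converges_def)
qed

lemma nuclear_rep_r: "Lp_nuclear_rep r p M A xs ys"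
  unfolding nuclear_rep_def
  using xs_dual ys_Lp converges_all summable_seq_powr by (auto simp: converges_def partial_def)

text \<open>Each integral is at most d^2 times the norm of \<open>opn c\<close>. As r \<le> 1, the
  exponent 2 r of d in the r-th power does not exceed the one in the hypothesis, and r-summability
  implies summability.\<close>

lemma summable_trace: "(\<lambda>c. LINT x|M. cmod (of_nat (dm c) * mat_trace (symb c x))) summable_on unitary_dual G"
proof (rule summable_on_comparison_test)
  show "(\<lambda>c. (real (dm c))\<^sup>2 * Lp_norm p M (opn c)) summable_on unitary_dual G"
  proof (rule summable_on_of_powr[OF _ _ r])
    show "(\<lambda>c. ((real (dm c))\<^sup>2 * Lp_norm p M (opn c)) powr r) summable_on unitary_dual G"
    proof (rule summable_on_comparison_test[OF sum])
      fix c assume c: "c \<in> unitary_dual G"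
      have d: "1 \<le> real (dm c)" using rep_unitary(2)[OF c] by simp
      have "((real (dm c))\<^sup>2) powr r = real (dm c) powr (2 * r)"
        using d by (simp add: powr_powr flip: powr_numeral)
      also have "\<dots> \<le> real (dm c) powr (2 + r / min 2 p)"
      proof (rule powr_mono[OF _ d])
        have "0 \<le> r / min 2 p" using r p by auto
        then show "2 * r \<le> 2 + r / min 2 p" using r by linarith
      qed
      finally show "((real (dm c))\<^sup>2 * Lp_norm p M (opn c)) powr r
          \<le> real (dm c) powr (2 + r / min 2 p) * Lp_norm p M (opn c) powr r"
        by (simp add: powr_mult mult_right_mono)
    qed simp
  qed simp
qed (auto intro: symb_trace_norm_integral)

text \<open>Absolute summability over all index triples permits grouping them by class; each finite
  block is the integral of the weighted trace of the symbol, and \<open>summable_trace\<close>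
  permits exchanging sum and integral.\<close>

lemma trace_sum: "(\<Sum>n. xs n (ys n)) = (LINT x|M. (\<Sum>\<^sub>\<infinity>c\<in>unitary_dual G. of_nat (dm c) * mat_trace (symb c x)))"
proof -
  have "(\<lambda>t. cmod (fourier t (fourier_image t))) summable_on idx"
    by (rule summable_on_comparison_test[OF summable_idx_one])
      (auto intro: dual_norm_bound[OF p fourier_dual fourier_image_Lp])
  then have s: "(\<lambda>t. fourier t (fourier_image t)) summable_on idx" by (rule abs_summable_summable)
  have "(\<lambda>n. xs n (ys n)) = seq_of idx (\<lambda>t. fourier t (fourier_image t)) 0"
    unfolding xs_def ys_def by (rule ext, subst seq_of_apply2[where h="\<lambda>x y. x y"]) simp
  moreover have "seq_of idx (\<lambda>t. fourier t (fourier_image t)) 0 sums (\<Sum>\<^sub>\<infinity>t\<in>idx. fourier t (fourier_image t))"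
    using s by (intro has_sum_imp_sums) (simp add: has_sum_seq_of[OF countable_idx] has_sum_infsum)
  ultimately have "(\<Sum>n. xs n (ys n)) = (\<Sum>\<^sub>\<infinity>t\<in>idx. fourier t (fourier_image t))" by (simp add: sums_iff)
  also have "\<dots> = (\<Sum>\<^sub>\<infinity>c\<in>unitary_dual G. \<Sum>\<^sub>\<infinity>ij\<in>{..<dm c} \<times> {..<dm c}. fourier (c, ij) (fourier_image (c, ij)))"
    unfolding idx_def by (rule infsum_Sigma_banach[symmetric]) (use s in \<open>simp add: idx_def\<close>)
  also have "\<dots> = (\<Sum>\<^sub>\<infinity>c\<in>unitary_dual G. LINT x|M. of_nat (dm c) * mat_trace (symb c x))"
  proof (rule infsum_cong)
    fix c assume c: "c \<in> unitary_dual G"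
    have "(\<Sum>\<^sub>\<infinity>ij\<in>{..<dm c} \<times> {..<dm c}. fourier (c, ij) (fourier_image (c, ij)))
        = (\<Sum>ij\<in>{..<dm c} \<times> {..<dm c}. fourier (c, ij) (fourier_image (c, ij)))" by simp
    also have "\<dots> = (LINT x|M. of_nat (dm c) * mat_trace (symb c x))"
      unfolding symb_trace_integral[OF c] by (rule sum.cong) (auto simp: fourier_def fourier_image_def)
    finally show "(\<Sum>\<^sub>\<infinity>ij\<in>{..<dm c} \<times> {..<dm c}. fourier (c, ij) (fourier_image (c, ij)))
        = (LINT x|M. of_nat (dm c) * mat_trace (symb c x))" .
  qed
  also have "\<dots> = (LINT x|M. (\<Sum>\<^sub>\<infinity>c\<in>unitary_dual G. of_nat (dm c) * mat_trace (symb c x)))"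
    by (rule integral_infsum_countable(3)[OF countable_dual symb_trace_integrable summable_trace, symmetric])
  finally show ?thesis .
qed

theorem nuclear_and_trace:
  "r_nuclear r (Lp_space p M) (Lp_norm p M) (Lp_space p M) (Lp_norm p M) A"
  "AE x in M. (\<lambda>c. of_nat (dm c) * mat_trace (symb c x)) summable_on unitary_dual G"
  "integrable M (\<lambda>x. \<Sum>\<^sub>\<infinity>c\<in>unitary_dual G. of_nat (dm c) * mat_trace (symb c x))"
  "has_nuclear_trace (Lp_space p M) (Lp_norm p M) A
     (LINT x|M. (\<Sum>\<^sub>\<infinity>c\<in>unitary_dual G. of_nat (dm c) * mat_trace (symb c x)))"
proof -
  show "r_nuclear r (Lp_space p M) (Lp_norm p M) (Lp_space p M) (Lp_norm p M) A"
    unfolding r_nuclear_def using nuclear_rep_r by blast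
  note I = integral_infsum_countable[OF countable_dual symb_trace_integrable summable_trace]
  show "AE x in M. (\<lambda>c. of_nat (dm c) * mat_trace (symb c x)) summable_on unitary_dual G" by (rule I(1))
  show "integrable M (\<lambda>x. \<Sum>\<^sub>\<infinity>c\<in>unitary_dual G. of_nat (dm c) * mat_trace (symb c x))" by (rule I(2))
  note one = nuclear_rep_one[OF p r nuclear_rep_r]
  show "has_nuclear_trace (Lp_space p M) (Lp_norm p M) A
     (LINT x|M. (\<Sum>\<^sub>\<infinity>c\<in>unitary_dual G. of_nat (dm c) * mat_trace (symb c x)))"
    unfolding has_nuclear_trace_def r_nuclear_def trace_sum[symmetric]
  proof (intro conjI allI impI)
    show "\<exists>x' y. Lp_nuclear_rep 1 p M A x' y" using one by blast
    fix x' y assume "Lp_nuclear_rep 1 p M A x' y"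
    then show "(\<lambda>n. x' n (y n)) sums (\<Sum>n. xs n (ys n))"
      by (intro nuclear_trace_unique[OF p A_Lp one])
  qed
qed

end

end

text \<open>\<open>infsum\<close> and the integral are 0 by default where they do not exist; the
  summability and integrability claims ensure that the trace formula speaks of a genuine sum and a
  genuine integral.\<close>

theorem theorem4p2:
  fixes G :: "'g::{t2_space, second_countable_topology} monoid"
    and n :: nat and \<A> :: "'g chart set" and \<mu> :: "'g measure"
    and rep :: "('g \<Rightarrow> complex mat) set \<Rightarrow> 'g \<Rightarrow> complex mat"
    and A :: "('g \<Rightarrow> complex) \<Rightarrow> ('g \<Rightarrow> complex)"
    and r p :: real
  assumes G: "compact_lie_group G n \<A>"
    and haar: "normalised_haar G \<mu>"
    and rep: "\<And>c. c \<in> unitary_dual G \<Longrightarrow> rep c \<in> c"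
    and r: "0 < r" "r \<le> 1"
    and p: "1 \<le> p"
    and A: "bounded_operator (Lp_space p \<mu>) (Lp_norm p \<mu>) (Lp_space p \<mu>) (Lp_norm p \<mu>) A"
    and sum: "(\<lambda>c. real (rep_dim G (rep c)) powr (2 + r / min 2 p) *
                 Lp_norm p \<mu> (\<lambda>x. opnorm_linf (transpose_mat (symbol G A x (rep c)))) powr r)
               summable_on unitary_dual G"
  shows "r_nuclear r (Lp_space p \<mu>) (Lp_norm p \<mu>) (Lp_space p \<mu>) (Lp_norm p \<mu>) A \<and>
    (AE x in \<mu>. (\<lambda>c. of_nat (rep_dim G (rep c)) * mat_trace (symbol G A x (rep c)))
       summable_on unitary_dual G) \<and>
    integrable \<mu> (\<lambda>x. \<Sum>\<^sub>\<infinity>c\<in>unitary_dual G.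
       of_nat (rep_dim G (rep c)) * mat_trace (symbol G A x (rep c))) \<and>
    has_nuclear_trace (Lp_space p \<mu>) (Lp_norm p \<mu>) A
      (LINT x|\<mu>. (\<Sum>\<^sub>\<infinity>c\<in>unitary_dual G.
         of_nat (rep_dim G (rep c)) * mat_trace (symbol G A x (rep c))))"
proof -
  interpret compact_lie_group G n \<A> by (rule G)
  interpret prob_space \<mu> using haar by (simp add: normalised_haar_def)
  interpret symbol_operator G \<mu> rep A p
  proof unfold_locales
    show "sets \<mu> = sets borel" using haar by (simp add: normalised_haar_def)
    show "distr \<mu> borel (\<lambda>x. g \<otimes>\<^bsub>G\<^esub> x) = \<mu>" for g using haar by (simp add: normalised_haar_def carrier_UNIV)
  qed (fact carrier_UNIV compact_UNIV continuous_mult continuous_inv rep p A)+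
  have "(\<lambda>c. real (rep_dim G (rep c)) powr (2 + r / min 2 p) * Lp_norm p \<mu> (opn c) powr r) summable_on unitary_dual G"
    using sum by (simp add: opn_def[abs_def])
  from nuclear_and_trace[OF r this] show ?thesis by blast
qed

end
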